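(* Let $n\ge 2$, $N\ge 1$, $0<\alpha<1$ and $1\le k\le\infty$. Let $a(x,p,q)=(a_1,\dots,a_N)(x,p,q)$ be of class $C^{k+\alpha}_{loc}$ in $x\in\mathbb{R}^n$, $p\in\mathbb{R}^N$, $q\in\mathbb{R}^n\otimes\mathbb{R}^N$. Then for any given $c_0\in\mathbb{R}^N$ and $c_1\in\mathbb{R}^n\otimes\mathbb{R}^N$, for all sufficiently small $R>0$ the system for $u=(u_1,\dots,u_N):\{|x|\le R\}\to\mathbb{R}^N$ $$\Delta u(x)=a(x,u(x),\nabla u(x)),\qquad u(0)=c_0,\qquad\nabla u(0)=c_1$$ has infinitely many solutions in $C^{k+2+\alpha}(\{|x|\le R\})$, and all these solutions are not radially symmetric.
   Context: A map $u$ on the ball is radially symmetric if $u(x)$ depends only on $|x|$. $C^{k+\alpha}$ denotes functions whose $k$-th order partial derivatives exist and are Hölder continuous with exponent $\alpha$ (locally, for $C^{k+\alpha}_{loc}$); for $k=\infty$ it means $C^\infty$. *)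

theory Defs
  imports "HOL-Analysis.Analysis" "HOL-Library.Extended_Nat"
begin

text \<open>
  All derivatives are taken within a set \<open>S\<close>, which below is the whole space or a closed ball of
  positive radius. A convex set with nonempty interior determines the derivative within it uniquely
  at each of its points, boundary points included, so the choice made by \<^const>\<open>frechet_derivative\<close>
  is harmless there. At interior points it is the usual derivative; at boundary points
  it is the continuous extension of the interior derivative whenever such an extension exists.
\<close>

definition partial_deriv ::
    "'a::euclidean_space set \<Rightarrow> 'a \<Rightarrow> ('a \<Rightarrow> 'b::real_normed_vector) \<Rightarrow> 'a \<Rightarrow> 'b" where
  "partial_deriv S b f x = frechet_derivative f (at x within S) b"

definition laplacian ::
    "'a::euclidean_space set \<Rightarrow> ('a \<Rightarrow> 'b::real_normed_vector) \<Rightarrow> 'a \<Rightarrow> 'b" where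
  "laplacian S f x = (\<Sum>b\<in>Basis. partial_deriv S b (partial_deriv S b f) x)"

text \<open>
  \<open>partials_upto P S m f\<close>: the partial derivatives of \<open>f\<close> on \<open>S\<close> exist up to order \<open>m\<close>, and those
  of order exactly \<open>m\<close> satisfy \<open>P\<close>. For every \<open>P\<close> used below, \<open>P\<close> implies continuity on \<open>S\<close>, and
  then requiring differentiability of the derivatives of lower order is the same as requiring that
  their partial derivatives exist and are continuous.
\<close>

primrec partials_upto ::
    "(('a::euclidean_space \<Rightarrow> 'b::real_normed_vector) \<Rightarrow> bool) \<Rightarrow> 'a set \<Rightarrow> nat \<Rightarrow> ('a \<Rightarrow> 'b) \<Rightarrow> bool"
where
  "partials_upto P S 0 f \<longleftrightarrow> P f"
| "partials_upto P S (Suc m) f \<longleftrightarrow>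
     f differentiable_on S \<and> (\<forall>b\<in>Basis. partials_upto P S m (partial_deriv S b f))"

definition smooth_on :: "'a::euclidean_space set \<Rightarrow> ('a \<Rightarrow> 'b::real_normed_vector) \<Rightarrow> bool" where
  "smooth_on S f \<longleftrightarrow> (\<forall>m. partials_upto (continuous_on S) S m f)"

definition holder_on ::
    "real \<Rightarrow> 'a::metric_space set \<Rightarrow> ('a \<Rightarrow> 'b::metric_space) \<Rightarrow> bool" where
  "holder_on \<alpha> S f \<longleftrightarrow> (\<exists>C. \<forall>x\<in>S. \<forall>y\<in>S. dist (f x) (f y) \<le> C * dist x y powr \<alpha>)"

definition locally_holder_on ::
    "real \<Rightarrow> 'a::metric_space set \<Rightarrow> ('a \<Rightarrow> 'b::metric_space) \<Rightarrow> bool" where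
  "locally_holder_on \<alpha> S f \<longleftrightarrow> (\<forall>K. compact K \<and> K \<subseteq> S \<longrightarrow> holder_on \<alpha> K f)"

text \<open>The classes \<open>C\<^sup>k\<^sup>+\<^sup>\<alpha>(S)\<close> and \<open>C\<^sup>k\<^sup>+\<^sup>\<alpha>\<^sub>l\<^sub>o\<^sub>c(S)\<close>, both read as \<open>C\<^sup>\<infinity>(S)\<close> for \<open>k = \<infinity>\<close>.\<close>

definition C_holder ::
    "enat \<Rightarrow> real \<Rightarrow> 'a::euclidean_space set \<Rightarrow> ('a \<Rightarrow> 'b::real_normed_vector) \<Rightarrow> bool" where
  "C_holder k \<alpha> S f \<longleftrightarrow>
     (case k of enat m \<Rightarrow> partials_upto (holder_on \<alpha> S) S m f | \<infinity> \<Rightarrow> smooth_on S f)"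

definition C_holder_loc ::
    "enat \<Rightarrow> real \<Rightarrow> 'a::euclidean_space set \<Rightarrow> ('a \<Rightarrow> 'b::real_normed_vector) \<Rightarrow> bool" where
  "C_holder_loc k \<alpha> S f \<longleftrightarrow>
     (case k of enat m \<Rightarrow> partials_upto (locally_holder_on \<alpha> S) S m f | \<infinity> \<Rightarrow> smooth_on S f)"

definition radially_symmetric_on ::
    "'a::real_normed_vector set \<Rightarrow> ('a \<Rightarrow> 'b) \<Rightarrow> bool" where
  "radially_symmetric_on S u \<longleftrightarrow> (\<forall>x\<in>S. \<forall>y\<in>S. norm x = norm y \<longrightarrow> u x = u y)"

text \<open>
  The gradient of \<open>u\<close> is its Jacobian matrix, whose entry \<open>$ j $ i\<close> is \<open>\<partial>\<^sub>i u\<^sub>j\<close>. The equation is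
  imposed on the whole closed ball.
\<close>

definition solves_system ::
    "(real^'n \<Rightarrow> real^'N \<Rightarrow> real^'n^'N \<Rightarrow> real^'N) \<Rightarrow> real^'N \<Rightarrow> real^'n^'N \<Rightarrow> real
      \<Rightarrow> (real^'n \<Rightarrow> real^'N) \<Rightarrow> bool" where
  "solves_system a c0 c1 R u \<longleftrightarrow>
     (\<forall>x\<in>cball 0 R.
        laplacian (cball 0 R) u x = a x (u x) (jacobian u (at x within cball 0 R))) \<and>
     u 0 = c0 \<and> jacobian u (at 0 within cball 0 R) = c1"

end

theory Submission
  imports Defs
begin

text \<open>
  Look for \<open>u = c\<^sub>0 + c\<^sub>1 x + (\<tau>/R) x\<^sub>1 x\<^sub>2 e + (N f - its 1-jet at 0)\<close>, where \<open>N\<close> is a Newton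
  potential and \<open>f\<close> a bounded continuous function supported in \<open>|x| \<le> 2R\<close>. Up to a cutoff the equation
  is the fixed point problem \<open>f = a(x, u, \<nabla>u)\<close>. On the small ball the gradient of \<open>u\<close> stays within a
  fixed compact set for all \<open>\<tau>\<close> in an interval that does not depend on \<open>R\<close>, and the fixed point map is a
  contraction in the supremum norm. The second difference of \<open>u\<close> that isolates \<open>x\<^sub>1 x\<^sub>2\<close> is
  dominated by \<open>\<tau> R\<close>, which shows that the solutions are distinct and not radially symmetric.

  Only a local parametrix \<open>N\<close> is needed: it is the sum over dyadic scales \<open>r = r\<^sub>0 / 2\<^sup>j\<close> of smooth
  compactly supported kernels whose Laplacians telescope to an approximate identity minus one
  smooth kernel, and that error is small on small balls. Summing the trivial estimates at each
  scale gives the Schauder estimates without singular integrals, and since all functions live on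
  the whole space and are restricted to the ball only at the end, no boundary regularity occurs.
\<close>


section \<open>Functions with locally Hoelder continuous derivatives\<close>

text \<open>The ball may shrink, yet the solutions have to stay distinct and non-radial on it, while
  the sup norm of \<open>f\<close> controls only first derivatives of the potential. Its second
  difference is therefore only known to be O(r0 R), which would swamp the value t R^2 coming from t
  x1 x2 with fixed t. The amplitude \<tau>/R balances this: on |x| <= 2R the gradient of the
  quadratic term has size \<tau> whatever R is, and its second difference \<tau> R is of the same
  order in R as that of the potential, so that only constants compete and a small r0 decides. Hence
  the order of choice: bounds for \<open>a\<close> near the prescribed 1-jet, then \<tau>0, then r0,
  and R last. The telescoping error is a convolution of \<open>f\<close> with a kernel of fixed
  width r0. As \<open>f\<close> lives on |x| <= 2R, the error is O((R/r0)^n) times sup |f|, and it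
  is added to the fixed point map instead of being inverted. The unknown is \<open>f\<close> and not
  \<open>u\<close> because \<open>a\<close> sees only \<open>u\<close> and its gradient, which sup
  |f| controls. Second derivatives enter only after the fixed point equation has made
  \<open>f\<close> Hoelder continuous.\<close>

abbreviation pd :: "'a::euclidean_space \<Rightarrow> ('a \<Rightarrow> 'b::real_normed_vector) \<Rightarrow> 'a \<Rightarrow> 'b" where
  "pd \<equiv> partial_deriv UNIV"

text \<open>One finite order at a time: membership in the class of order \<open>k\<close> becomes
  \<open>CH \<alpha> m\<close> for all \<open>enat m \<le> k\<close>, so that finite
  \<open>k\<close> and \<open>k = \<infinity>\<close> go through the same inductions.\<close>

definition CH :: "real \<Rightarrow> nat \<Rightarrow> ('a::euclidean_space \<Rightarrow> 'b::real_normed_vector) \<Rightarrow> bool" where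
  "CH \<alpha> m f \<longleftrightarrow> partials_upto (locally_holder_on \<alpha> UNIV) UNIV m f"

lemma CH_0: "CH \<alpha> 0 f \<longleftrightarrow> locally_holder_on \<alpha> UNIV f"
  by (simp add: CH_def)

lemma CH_Suc: "CH \<alpha> (Suc m) f \<longleftrightarrow> f differentiable_on UNIV \<and> (\<forall>b\<in>Basis. CH \<alpha> m (pd b f))"
  by (simp add: CH_def)

lemma pd_eqI: "(f has_derivative f') (at x) \<Longrightarrow> pd b f x = f' b"
  unfolding partial_deriv_def using frechet_derivative_at by metis

lemma has_derivative_pd:
  fixes f :: "'a::euclidean_space \<Rightarrow> 'b::real_normed_vector"
  assumes "f differentiable at x"
  shows "(f has_derivative (\<lambda>v. \<Sum>b\<in>Basis. (v \<bullet> b) *\<^sub>R pd b f x)) (at x)"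
proof -
  obtain D where D: "(f has_derivative D) (at x)"
    using assms by (auto simp: differentiable_def)
  have "D v = (\<Sum>b\<in>Basis. (v \<bullet> b) *\<^sub>R pd b f x)" for v
  proof -
    have lin: "linear D" using D has_derivative_linear by blast
    have "D v = D (\<Sum>b\<in>Basis. (v \<bullet> b) *\<^sub>R b)" by (simp add: euclidean_representation)
    also have "\<dots> = (\<Sum>b\<in>Basis. (v \<bullet> b) *\<^sub>R D b)"
      by (simp add: linear_sum[OF lin] linear_cmul[OF lin])
    finally show ?thesis by (simp add: pd_eqI[OF D])
  qed
  then show ?thesis using D by (metis (no_types, lifting) ext)
qed

lemma CH_SucI:
  assumes "\<And>x. (f has_derivative f' x) (at x)" "\<And>b. b \<in> Basis \<Longrightarrow> CH \<alpha> m (\<lambda>x. f' x b)"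
  shows "CH \<alpha> (Suc m) f"
  unfolding CH_Suc
proof
  show "f differentiable_on UNIV"
    using assms(1) by (auto simp: differentiable_on_def differentiable_def)
  have "pd b f = (\<lambda>x. f' x b)" for b
    using pd_eqI[OF assms(1)] by auto
  then show "\<forall>b\<in>Basis. CH \<alpha> m (pd b f)" using assms(2) by simp
qed

lemma CH_Suc_has_derivative:
  assumes "CH \<alpha> (Suc m) f"
  shows "(f has_derivative (\<lambda>v. \<Sum>b\<in>Basis. (v \<bullet> b) *\<^sub>R pd b f x)) (at x)"
  using assms by (intro has_derivative_pd) (auto simp: CH_Suc differentiable_on_def)

lemma CH_Suc_pd: "CH \<alpha> (Suc m) f \<Longrightarrow> b \<in> Basis \<Longrightarrow> CH \<alpha> m (pd b f)"
  by (simp add: CH_Suc)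

lemma locally_holder_cball:
  assumes "locally_holder_on \<alpha> UNIV f"
  obtains C where "C \<ge> 0" "\<And>x y. x \<in> cball 0 \<rho> \<Longrightarrow> y \<in> cball 0 \<rho> \<Longrightarrow>
    dist (f x) (f (y::'a::euclidean_space)) \<le> C * dist x y powr \<alpha>"
proof -
  have "holder_on \<alpha> (cball 0 \<rho>) f"
    using assms by (simp add: locally_holder_on_def)
  then obtain C where C: "\<forall>x\<in>cball 0 \<rho>. \<forall>y\<in>cball 0 \<rho>. dist (f x) (f y) \<le> C * dist x y powr \<alpha>"
    by (auto simp: holder_on_def)
  have "C * dist x y powr \<alpha> \<le> max C 0 * dist x y powr \<alpha>" for x y :: 'a
    by (intro mult_right_mono) auto
  with C have "dist (f x) (f y) \<le> max C 0 * dist x y powr \<alpha>"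
    if "x \<in> cball 0 \<rho>" "y \<in> cball 0 \<rho>" for x y
    using that by (meson order_trans)
  then show ?thesis using that[of "max C 0"] by simp
qed

lemma locally_holderI:
  assumes "\<And>\<rho>. \<rho> > 0 \<Longrightarrow> \<exists>C. \<forall>x\<in>cball 0 \<rho>. \<forall>y\<in>cball 0 \<rho>.
    dist (f x) (f (y::'a::euclidean_space)) \<le> C * dist x y powr \<alpha>"
  shows "locally_holder_on \<alpha> UNIV f"
  unfolding locally_holder_on_def
proof (intro allI impI)
  fix K :: "'a set" assume K: "compact K \<and> K \<subseteq> UNIV"
  then obtain \<rho> where "\<rho> > 0" "K \<subseteq> cball 0 \<rho>"
    using bounded_subset_ballD[of K 0] ball_subset_cball by (metis compact_imp_bounded subset_trans)
  then show "holder_on \<alpha> K f"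
    using assms[of \<rho>] unfolding holder_on_def by (meson subsetD)
qed

lemma locally_holder_continuous:
  fixes f :: "'a::euclidean_space \<Rightarrow> 'b::metric_space"
  assumes "locally_holder_on \<alpha> UNIV f" "0 < \<alpha>"
  shows "continuous_on UNIV f"
proof -
  have "isCont f x" for x
  proof -
    obtain C where C: "C \<ge> 0" "\<And>y z. y \<in> cball 0 (norm x + 1) \<Longrightarrow> z \<in> cball 0 (norm x + 1) \<Longrightarrow>
      dist (f y) (f z) \<le> C * dist y z powr \<alpha>"
      using locally_holder_cball[OF assms(1)] by blast
    have "((\<lambda>y. C * dist y x powr \<alpha>) \<longlongrightarrow> C * dist x x powr \<alpha>) (at x)"
      using assms(2) by (intro tendsto_intros) auto
    then have lim: "((\<lambda>y. C * dist y x powr \<alpha>) \<longlongrightarrow> 0) (at x)" by simp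
    have "((\<lambda>y. dist (f y) (f x)) \<longlongrightarrow> 0) (at x)"
    proof (rule tendsto_sandwich[OF _ _ tendsto_const lim])
      have "\<forall>\<^sub>F y in at x. y \<in> ball x 1"
        by (intro eventually_at_in_open') auto
      then show "\<forall>\<^sub>F y in at x. dist (f y) (f x) \<le> C * dist y x powr \<alpha>"
      proof eventually_elim
        case (elim y)
        have "norm y \<le> norm x + 1"
          using elim norm_triangle_ineq[of x "y - x"] by (simp add: dist_norm norm_minus_commute)
        then show ?case by (intro C(2)) auto
      qed
    qed auto
    then show ?thesis unfolding isCont_def by (rule tendsto_dist_iff[THEN iffD2])
  qed
  then show ?thesis by (simp add: continuous_at_imp_continuous_on)
qed

lemma norm_sum_Basis_le:
  "norm (\<Sum>b\<in>Basis. (v \<bullet> b) *\<^sub>R (w b :: 'b::real_normed_vector)) \<le> (\<Sum>b\<in>Basis. norm (w b)) * norm (v::'a::euclidean_space)"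
proof -
  have "norm (\<Sum>b\<in>Basis. (v \<bullet> b) *\<^sub>R w b) \<le> (\<Sum>b\<in>Basis. norm (w b) * norm v)"
  proof (rule sum_norm_le)
    fix b :: 'a assume "b \<in> Basis"
    then show "norm ((v \<bullet> b) *\<^sub>R w b) \<le> norm (w b) * norm v"
      using Basis_le_norm[of b v] mult_left_mono[of "\<bar>v \<bullet> b\<bar>" "norm v" "norm (w b)"]
      by (simp add: mult.commute)
  qed
  then show ?thesis by (simp add: sum_distrib_right)
qed

text \<open>The operator norm of the derivative is at most the sum of the norms of the partial
  derivatives, hence the crude factor \<open>DIM('a)\<close>.\<close>

lemma lipschitz_if_pd_bounded:
  fixes f :: "'a::euclidean_space \<Rightarrow> 'b::real_normed_vector" and B :: real
  assumes "convex S" "\<And>x. x \<in> S \<Longrightarrow> f differentiable at x"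
    and "\<And>x b. x \<in> S \<Longrightarrow> b \<in> Basis \<Longrightarrow> norm (pd b f x) \<le> B"
    and "x \<in> S" "y \<in> S"
  shows "norm (f x - f y) \<le> DIM('a) * B * norm (x - y)"
proof (rule differentiable_bound[OF assms(1) _ _ assms(4,5)])
  fix z assume z: "z \<in> S"
  show "(f has_derivative (\<lambda>v. \<Sum>b\<in>Basis. (v \<bullet> b) *\<^sub>R pd b f z)) (at z within S)"
    using has_derivative_pd[OF assms(2)[OF z]] has_derivative_at_withinI by blast
  have "(\<Sum>b\<in>Basis. norm (pd b f z)) \<le> DIM('a) * B"
    using sum_bounded_above[of Basis "\<lambda>b. norm (pd b f z)" B] assms(3)[OF z] by simp
  moreover have "0 \<le> (\<Sum>b\<in>Basis. norm (pd b f z))" by (simp add: sum_nonneg)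
  ultimately show "onorm (\<lambda>v. \<Sum>b\<in>Basis. (v \<bullet> b) *\<^sub>R pd b f z) \<le> DIM('a) * B"
    by (intro onorm_le order_trans[OF norm_sum_Basis_le] mult_right_mono) auto
qed

lemma C1_lipschitz_on_compact_convex:
  fixes f :: "'a::euclidean_space \<Rightarrow> 'b::real_normed_vector"
  assumes "compact S" "convex S" "f differentiable_on UNIV"
    and "\<And>b. b \<in> Basis \<Longrightarrow> continuous_on UNIV (pd b f)"
  obtains L where "L \<ge> 0" "\<And>x y. x \<in> S \<Longrightarrow> y \<in> S \<Longrightarrow> norm (f x - f y) \<le> L * norm (x - y)"
proof -
  have "\<exists>B. \<forall>x\<in>S. norm (pd b f x) \<le> B" if "b \<in> Basis" for b
  proof -
    have "bounded (pd b f ` S)"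
      using compact_continuous_image[OF continuous_on_subset[OF assms(4)[OF that]] assms(1)]
      by (simp add: compact_imp_bounded)
    then show ?thesis by (auto simp: bounded_iff)
  qed
  then obtain B where B: "\<And>b x. b \<in> Basis \<Longrightarrow> x \<in> S \<Longrightarrow> norm (pd b f x) \<le> B b" by metis
  define M where "M = (\<Sum>b\<in>Basis. \<bar>B b\<bar>)"
  have M: "norm (pd b f x) \<le> M" if "b \<in> Basis" "x \<in> S" for b x
  proof -
    have "norm (pd b f x) \<le> \<bar>B b\<bar>" using B[OF that] by simp
    also have "\<dots> \<le> M" unfolding M_def using that by (intro member_le_sum) auto
    finally show ?thesis .
  qed
  have "M \<ge> 0" by (simp add: M_def sum_nonneg)
  then show ?thesis
    using lipschitz_if_pd_bounded[OF assms(2), where f = f and B = M] M assms(3)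
    by (intro that[of "real DIM('a) * M"]) (auto simp: differentiable_on_def)
qed

text \<open>On a ball of radius \<rho>, |x - y| = |x - y|^(1-\<alpha>) |x - y|^\<alpha>, and the
  first factor is at most (2\<rho>)^(1-\<alpha>).\<close>

lemma locally_lipschitz_imp_locally_holder:
  fixes f :: "'a::euclidean_space \<Rightarrow> 'b::metric_space"
  assumes "0 < \<alpha>" "\<alpha> \<le> 1"
    and lip: "\<And>\<rho>. \<rho> > 0 \<Longrightarrow> \<exists>L. \<forall>x\<in>cball 0 \<rho>. \<forall>y\<in>cball 0 \<rho>. dist (f x) (f y) \<le> L * dist x y"
  shows "locally_holder_on \<alpha> UNIV f"
proof (rule locally_holderI)
  fix \<rho> :: real assume "\<rho> > 0"
  from lip[OF this] obtain L where
    L: "\<And>x y. x \<in> cball 0 \<rho> \<Longrightarrow> y \<in> cball 0 \<rho> \<Longrightarrow> dist (f x) (f y) \<le> L * dist x y"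
    by blast
  have "dist (f x) (f y) \<le> (\<bar>L\<bar> * (2 * \<rho>) powr (1 - \<alpha>)) * dist x y powr \<alpha>"
    if "x \<in> cball 0 \<rho>" "y \<in> cball 0 \<rho>" for x y
  proof (cases "x = y")
    case False
    have "dist x y \<le> 2 * \<rho>" using that norm_triangle_ineq4[of x y] by (simp add: dist_norm)
    then have "dist x y powr (1 - \<alpha>) \<le> (2 * \<rho>) powr (1 - \<alpha>)"
      using assms by (intro powr_mono2) auto
    moreover have "dist x y = dist x y powr (1 - \<alpha>) * dist x y powr \<alpha>"
      using False by (simp flip: powr_add)
    ultimately have "dist x y \<le> (2 * \<rho>) powr (1 - \<alpha>) * dist x y powr \<alpha>"
      by (metis mult_right_mono powr_ge_zero)
    then have "\<bar>L\<bar> * dist x y \<le> \<bar>L\<bar> * ((2 * \<rho>) powr (1 - \<alpha>) * dist x y powr \<alpha>)"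
      by (intro mult_left_mono) auto
    moreover have "dist (f x) (f y) \<le> \<bar>L\<bar> * dist x y"
      using L[OF that] by (meson abs_ge_self mult_right_mono order_trans zero_le_dist)
    ultimately show ?thesis by (simp add: mult.assoc)
  qed auto
  then show "\<exists>C. \<forall>x\<in>cball 0 \<rho>. \<forall>y\<in>cball 0 \<rho>. dist (f x) (f y) \<le> C * dist x y powr \<alpha>"
    by blast
qed

lemma C1_locally_lipschitz:
  fixes f :: "'a::euclidean_space \<Rightarrow> 'b::real_normed_vector"
  assumes "f differentiable_on UNIV" "\<And>b. b \<in> Basis \<Longrightarrow> continuous_on UNIV (pd b f)"
  shows "\<exists>L. \<forall>x\<in>cball 0 \<rho>. \<forall>y\<in>cball 0 \<rho>. dist (f x) (f y) \<le> L * dist x y"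
  using C1_lipschitz_on_compact_convex[OF compact_cball convex_cball assms, of 0 \<rho>]
  by (metis dist_norm)

context
  fixes \<alpha> :: real
  assumes \<alpha>: "0 < \<alpha>" "\<alpha> \<le> 1"
begin

lemma CH_C1:
  assumes "f differentiable_on UNIV" "\<And>b. b \<in> Basis \<Longrightarrow> continuous_on UNIV (pd b f)"
  shows "CH \<alpha> 0 f"
  unfolding CH_0 using C1_locally_lipschitz[OF assms] \<alpha>
  by (intro locally_lipschitz_imp_locally_holder) auto

lemma CH_0_continuous: "CH \<alpha> 0 f \<Longrightarrow> continuous_on UNIV f"
  using locally_holder_continuous \<alpha> by (auto simp: CH_0)

text \<open>At the bottom, Hoelder partial derivatives are continuous, so the function is locally
  Lipschitz and therefore Hoelder. Higher orders reduce to this by passing to the partial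
  derivatives.\<close>

lemma CH_Suc_imp: "CH \<alpha> (Suc m) f \<Longrightarrow> CH \<alpha> m f"
proof (induction m arbitrary: f)
  case 0
  then show ?case by (intro CH_C1) (auto simp: CH_Suc CH_0_continuous)
next
  case (Suc m)
  then show ?case using CH_Suc by blast
qed

lemma CH_mono: "CH \<alpha> m f \<Longrightarrow> l \<le> m \<Longrightarrow> CH \<alpha> l f"
  by (induction m) (auto simp: le_Suc_eq CH_Suc_imp)

lemma CH_continuous: "CH \<alpha> m f \<Longrightarrow> continuous_on UNIV f"
  using CH_0_continuous CH_mono by blast

lemma CH_differentiable: "CH \<alpha> (Suc m) f \<Longrightarrow> f differentiable at x"
  by (auto simp: CH_Suc differentiable_on_def)

lemma CH_Suc_lipschitz:
  assumes "CH \<alpha> (Suc m) f"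
  shows "\<exists>L. \<forall>x\<in>cball 0 \<rho>. \<forall>y\<in>cball 0 \<rho>. dist (f x) (f y) \<le> L * dist x y"
  using assms by (intro C1_locally_lipschitz) (auto simp: CH_Suc CH_continuous)

lemma CH_bounded_linear:
  assumes "bounded_linear L"
  shows "CH \<alpha> m f \<Longrightarrow> CH \<alpha> m (\<lambda>x. L (f x))"
proof (induction m arbitrary: f)
  case 0
  obtain K where K: "K \<ge> 0" "\<And>v. norm (L v) \<le> norm v * K"
    using bounded_linear.nonneg_bounded[OF assms] by blast
  show ?case unfolding CH_0
  proof (rule locally_holderI)
    fix \<rho> :: real
    obtain C where C: "C \<ge> 0" "\<And>x y. x \<in> cball 0 \<rho> \<Longrightarrow> y \<in> cball 0 \<rho> \<Longrightarrow>
        dist (f x) (f y) \<le> C * dist x y powr \<alpha>"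
      using locally_holder_cball 0[unfolded CH_0] by blast
    have "dist (L (f x)) (L (f y)) \<le> (K * C) * dist x y powr \<alpha>"
      if "x \<in> cball 0 \<rho>" "y \<in> cball 0 \<rho>" for x y
    proof -
      have "dist (L (f x)) (L (f y)) \<le> K * dist (f x) (f y)"
        using K(2)[of "f x - f y"]
        by (simp add: dist_norm mult.commute linear_diff[OF bounded_linear.linear[OF assms]])
      also have "\<dots> \<le> K * (C * dist x y powr \<alpha>)"
        using C(2)[OF that] K(1) by (intro mult_left_mono)
      finally show ?thesis by (simp add: mult.assoc)
    qed
    then show "\<exists>C. \<forall>x\<in>cball 0 \<rho>. \<forall>y\<in>cball 0 \<rho>. dist (L (f x)) (L (f y)) \<le> C * dist x y powr \<alpha>"
      by blast
  qed
next
  case (Suc m)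
  have D: "(f has_derivative frechet_derivative f (at x)) (at x)" for x
    using CH_differentiable[OF Suc.prems] frechet_derivative_works by blast
  show ?case
  proof (rule CH_SucI)
    show "((\<lambda>x. L (f x)) has_derivative (\<lambda>v. L (frechet_derivative f (at x) v))) (at x)" for x
      using bounded_linear.has_derivative[OF assms D] .
    show "CH \<alpha> m (\<lambda>x. L (frechet_derivative f (at x) b))" if "b \<in> Basis" for b
      using Suc.IH[OF CH_Suc_pd[OF Suc.prems that]] by (simp add: partial_deriv_def)
  qed
qed

lemma CH_const: "CH \<alpha> m (\<lambda>x. c)"
proof (induction m arbitrary: c)
  case 0
  show ?case unfolding CH_0
    by (intro locally_holderI) (auto intro!: exI[of _ 0])
next
  case (Suc m)
  show ?case by (rule CH_SucI[where f' = "\<lambda>_ _. 0"]) (use Suc in auto)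
qed

lemma CH_linear: "bounded_linear L \<Longrightarrow> CH \<alpha> m L"
proof (rule CH_mono[of "Suc m"])
  assume "bounded_linear L"
  then show "CH \<alpha> (Suc m) L"
    by (intro CH_SucI[where f' = "\<lambda>_. L"]) (auto simp: CH_const bounded_linear_imp_has_derivative)
qed auto

lemma CH_ident: "CH \<alpha> m (\<lambda>x. x)"
  by (rule CH_linear) (rule bounded_linear_ident)

lemma CH_add: "CH \<alpha> m f \<Longrightarrow> CH \<alpha> m g \<Longrightarrow> CH \<alpha> m (\<lambda>x. f x + g x)"
proof (induction m arbitrary: f g)
  case 0
  show ?case unfolding CH_0
  proof (rule locally_holderI)
    fix \<rho> :: real
    obtain C where C: "C \<ge> 0" "\<And>x y. x \<in> cball 0 \<rho> \<Longrightarrow> y \<in> cball 0 \<rho> \<Longrightarrow>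
        dist (f x) (f y) \<le> C * dist x y powr \<alpha>"
      using locally_holder_cball 0(1)[unfolded CH_0] by blast
    obtain D where D: "D \<ge> 0" "\<And>x y. x \<in> cball 0 \<rho> \<Longrightarrow> y \<in> cball 0 \<rho> \<Longrightarrow>
        dist (g x) (g y) \<le> D * dist x y powr \<alpha>"
      using locally_holder_cball 0(2)[unfolded CH_0] by blast
    have "dist (f x + g x) (f y + g y) \<le> (C + D) * dist x y powr \<alpha>"
      if "x \<in> cball 0 \<rho>" "y \<in> cball 0 \<rho>" for x y
      using C(2)[OF that] D(2)[OF that] dist_triangle_add[of "f x" "g x" "f y" "g y"]
      by (simp add: distrib_right)
    then show "\<exists>C. \<forall>x\<in>cball 0 \<rho>. \<forall>y\<in>cball 0 \<rho>.
        dist (f x + g x) (f y + g y) \<le> C * dist x y powr \<alpha>"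
      by blast
  qed
next
  case (Suc m)
  have D: "(f has_derivative frechet_derivative f (at x)) (at x)"
    "(g has_derivative frechet_derivative g (at x)) (at x)" for x
    using CH_differentiable[OF Suc.prems(1)] CH_differentiable[OF Suc.prems(2)]
      frechet_derivative_works by blast+
  show ?case
  proof (rule CH_SucI)
    show "((\<lambda>x. f x + g x) has_derivative
        (\<lambda>v. frechet_derivative f (at x) v + frechet_derivative g (at x) v)) (at x)" for x
      using D by (intro has_derivative_add)
    show "CH \<alpha> m (\<lambda>x. frechet_derivative f (at x) b + frechet_derivative g (at x) b)"
      if "b \<in> Basis" for b
      using Suc.IH[OF CH_Suc_pd[OF Suc.prems(1) that] CH_Suc_pd[OF Suc.prems(2) that]]
      by (simp add: partial_deriv_def)
  qed
qed

lemma CH_sum: "(\<And>i. i \<in> I \<Longrightarrow> CH \<alpha> m (f i)) \<Longrightarrow> CH \<alpha> m (\<lambda>x. \<Sum>i\<in>I. f i x)"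
  by (induction I rule: infinite_finite_induct) (auto intro: CH_const CH_add)

lemma CH_cmult: "CH \<alpha> m f \<Longrightarrow> CH \<alpha> m (\<lambda>x. c *\<^sub>R f x)"
  by (rule CH_bounded_linear) (rule bounded_linear_scaleR_right)

lemma CH_minus: "CH \<alpha> m f \<Longrightarrow> CH \<alpha> m (\<lambda>x. - f x)"
  using CH_cmult[of m f "-1"] by simp

lemma CH_diff: "CH \<alpha> m f \<Longrightarrow> CH \<alpha> m g \<Longrightarrow> CH \<alpha> m (\<lambda>x. f x - g x)"
  using CH_add[of m f "\<lambda>x. - g x"] CH_minus by auto

lemma CH_bounded_on_cball:
  assumes "CH \<alpha> m f"
  obtains B where "B \<ge> 0" "\<And>x. x \<in> cball 0 \<rho> \<Longrightarrow> norm (f x) \<le> B"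
proof -
  have *: "bounded (f ` cball 0 \<rho>)"
    using compact_continuous_image[OF continuous_on_subset[OF CH_continuous[OF assms]]]
    by (simp add: compact_imp_bounded)
  then obtain B where "\<forall>y\<in>f ` cball 0 \<rho>. norm y \<le> B" using bounded_iff by blast
  then have "norm (f x) \<le> max B 0" if "x \<in> cball 0 \<rho>" for x
    using that by (meson image_eqI max.coboundedI1)
  then show ?thesis by (intro that[of "max B 0"]) auto
qed

lemma CH_scaleR:
  fixes f :: "'a::euclidean_space \<Rightarrow> real" and g :: "'a \<Rightarrow> 'b::real_normed_vector"
  shows "CH \<alpha> m f \<Longrightarrow> CH \<alpha> m g \<Longrightarrow> CH \<alpha> m (\<lambda>x. f x *\<^sub>R g x)"
proof (induction m arbitrary: f g)
  case 0
  show ?case unfolding CH_0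
  proof (rule locally_holderI)
    fix \<rho> :: real
    obtain C where C: "C \<ge> 0" "\<And>x y. x \<in> cball 0 \<rho> \<Longrightarrow> y \<in> cball 0 \<rho> \<Longrightarrow>
        dist (f x) (f y) \<le> C * dist x y powr \<alpha>"
      using locally_holder_cball 0(1)[unfolded CH_0] by blast
    obtain D where D: "D \<ge> 0" "\<And>x y. x \<in> cball 0 \<rho> \<Longrightarrow> y \<in> cball 0 \<rho> \<Longrightarrow>
        dist (g x) (g y) \<le> D * dist x y powr \<alpha>"
      using locally_holder_cball 0(2)[unfolded CH_0] by blast
    obtain M where M: "M \<ge> 0" "\<And>x. x \<in> cball 0 \<rho> \<Longrightarrow> norm (f x) \<le> M"
      using CH_bounded_on_cball[OF 0(1)] by blast
    obtain M' where M': "M' \<ge> 0" "\<And>x. x \<in> cball 0 \<rho> \<Longrightarrow> norm (g x) \<le> M'"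
      using CH_bounded_on_cball[OF 0(2)] by blast
    have "dist (f x *\<^sub>R g x) (f y *\<^sub>R g y) \<le> (C * M' + M * D) * dist x y powr \<alpha>"
      if "x \<in> cball 0 \<rho>" "y \<in> cball 0 \<rho>" for x y
    proof -
      have "f x *\<^sub>R g x - f y *\<^sub>R g y = (f x - f y) *\<^sub>R g x + f y *\<^sub>R (g x - g y)"
        by (simp add: algebra_simps)
      then have "dist (f x *\<^sub>R g x) (f y *\<^sub>R g y)
          \<le> dist (f x) (f y) * norm (g x) + norm (f y) * dist (g x) (g y)"
        by (metis dist_norm norm_scaleR norm_triangle_ineq real_norm_def)
      also have "\<dots> \<le> C * dist x y powr \<alpha> * M' + M * (D * dist x y powr \<alpha>)"
        using C(2)[OF that] D(2)[OF that] M M' that C(1) by (intro add_mono mult_mono) auto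
      finally show ?thesis by (simp add: algebra_simps)
    qed
    then show "\<exists>C. \<forall>x\<in>cball 0 \<rho>. \<forall>y\<in>cball 0 \<rho>.
        dist (f x *\<^sub>R g x) (f y *\<^sub>R g y) \<le> C * dist x y powr \<alpha>"
      by blast
  qed
next
  case (Suc m)
  have D: "(f has_derivative frechet_derivative f (at x)) (at x)"
    "(g has_derivative frechet_derivative g (at x)) (at x)" for x
    using CH_differentiable[OF Suc.prems(1)] CH_differentiable[OF Suc.prems(2)]
      frechet_derivative_works by blast+
  show ?case
  proof (rule CH_SucI)
    show "((\<lambda>x. f x *\<^sub>R g x) has_derivative
        (\<lambda>v. f x *\<^sub>R frechet_derivative g (at x) v + frechet_derivative f (at x) v *\<^sub>R g x)) (at x)" for x
      using D by (intro has_derivative_scaleR)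
    show "CH \<alpha> m (\<lambda>x. f x *\<^sub>R frechet_derivative g (at x) b + frechet_derivative f (at x) b *\<^sub>R g x)"
      if "b \<in> Basis" for b
      using CH_add[OF Suc.IH[OF CH_Suc_imp[OF Suc.prems(1)] CH_Suc_pd[OF Suc.prems(2) that]]
        Suc.IH[OF CH_Suc_pd[OF Suc.prems(1) that] CH_Suc_imp[OF Suc.prems(2)]]]
      by (simp add: partial_deriv_def)
  qed
qed

lemma CH_mult:
  fixes f g :: "'a::euclidean_space \<Rightarrow> real"
  shows "CH \<alpha> m f \<Longrightarrow> CH \<alpha> m g \<Longrightarrow> CH \<alpha> m (\<lambda>x. f x * g x)"
  using CH_scaleR[of m f g] by simp

text \<open>Composing two \<alpha>-Hoelder maps would only give the exponent \<alpha>^2. The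
  condition \<open>i + j = Suc 0\<close> says that one of the two maps is locally Lipschitz, which
  preserves \<alpha>. Both cases occur: \<open>j = 1\<close> in the chain rule below,
  \<open>i = 1\<close> where the gradient of the ansatz, so far only Hoelder, is inserted into
  \<open>a\<close>.\<close>

lemma CH_0_compose:
  fixes g :: "'a::euclidean_space \<Rightarrow> 'c::euclidean_space" and f :: "'c \<Rightarrow> 'b::real_normed_vector"
  assumes "CH \<alpha> i f" "CH \<alpha> j g" "i + j = Suc 0"
  shows "CH \<alpha> 0 (\<lambda>x. f (g x))"
  unfolding CH_0
proof (rule locally_holderI)
  fix \<rho> :: real
  obtain \<sigma> where \<sigma>: "\<And>x. x \<in> cball 0 \<rho> \<Longrightarrow> g x \<in> cball 0 \<sigma>"
    using CH_bounded_on_cball[OF assms(2)] by (metis mem_cball_0)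
  consider "i = 0" "j = Suc 0" | "i = Suc 0" "j = 0" using assms(3) by linarith
  then show "\<exists>C. \<forall>x\<in>cball 0 \<rho>. \<forall>y\<in>cball 0 \<rho>. dist (f (g x)) (f (g y)) \<le> C * dist x y powr \<alpha>"
  proof cases
    case 1
    obtain C where C: "C \<ge> 0" "\<And>x y. x \<in> cball 0 \<sigma> \<Longrightarrow> y \<in> cball 0 \<sigma> \<Longrightarrow>
        dist (f x) (f y) \<le> C * dist x y powr \<alpha>"
      using locally_holder_cball assms(1) 1 CH_0 by metis
    obtain L where L: "\<And>x y. x \<in> cball 0 \<rho> \<Longrightarrow> y \<in> cball 0 \<rho> \<Longrightarrow> dist (g x) (g y) \<le> L * dist x y"
      using CH_Suc_lipschitz assms(2) 1 by metis
    have "dist (f (g x)) (f (g y)) \<le> (C * \<bar>L\<bar> powr \<alpha>) * dist x y powr \<alpha>"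
      if "x \<in> cball 0 \<rho>" "y \<in> cball 0 \<rho>" for x y
    proof -
      have "dist (g x) (g y) \<le> \<bar>L\<bar> * dist x y"
        using L[OF that] by (meson abs_ge_self mult_right_mono order_trans zero_le_dist)
      then have "dist (g x) (g y) powr \<alpha> \<le> (\<bar>L\<bar> * dist x y) powr \<alpha>"
        using \<alpha> by (intro powr_mono2) auto
      then have "C * dist (g x) (g y) powr \<alpha> \<le> C * (\<bar>L\<bar> powr \<alpha> * dist x y powr \<alpha>)"
        using C(1) by (intro mult_left_mono) (auto simp: powr_mult)
      then show ?thesis using C(2)[OF \<sigma>[OF that(1)] \<sigma>[OF that(2)]] by (simp add: mult.assoc)
    qed
    then show ?thesis by blast
  next
    case 2
    obtain C where C: "C \<ge> 0" "\<And>x y. x \<in> cball 0 \<rho> \<Longrightarrow> y \<in> cball 0 \<rho> \<Longrightarrow>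
        dist (g x) (g y) \<le> C * dist x y powr \<alpha>"
      using locally_holder_cball assms(2) 2 CH_0 by metis
    obtain L where L: "\<And>x y. x \<in> cball 0 \<sigma> \<Longrightarrow> y \<in> cball 0 \<sigma> \<Longrightarrow> dist (f x) (f y) \<le> L * dist x y"
      using CH_Suc_lipschitz assms(1) 2 by metis
    have "dist (f (g x)) (f (g y)) \<le> (\<bar>L\<bar> * C) * dist x y powr \<alpha>"
      if "x \<in> cball 0 \<rho>" "y \<in> cball 0 \<rho>" for x y
    proof -
      have "dist (f (g x)) (f (g y)) \<le> \<bar>L\<bar> * dist (g x) (g y)"
        using L[OF \<sigma>[OF that(1)] \<sigma>[OF that(2)]]
        by (meson abs_ge_self mult_right_mono order_trans zero_le_dist)
      also have "\<dots> \<le> \<bar>L\<bar> * (C * dist x y powr \<alpha>)"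
        using C(2)[OF that] by (intro mult_left_mono) auto
      finally show ?thesis by (simp add: mult.assoc)
    qed
    then show ?thesis by blast
  qed
qed

text \<open>Chain rule and product rule. The order \<open>max 1 m\<close> of the inner map differs
  from \<open>m\<close> only at \<open>m = 0\<close>, where the inner map has to be
  Lipschitz.\<close>

lemma CH_compose:
  fixes g :: "'a::euclidean_space \<Rightarrow> 'c::euclidean_space" and f :: "'c \<Rightarrow> 'b::real_normed_vector"
  shows "CH \<alpha> m f \<Longrightarrow> CH \<alpha> (max 1 m) g \<Longrightarrow> CH \<alpha> m (\<lambda>x. f (g x))"
proof (induction m arbitrary: f)
  case 0
  then show ?case by (intro CH_0_compose[of 0 f "Suc 0" g]) auto
next
  case (Suc m)
  have g: "CH \<alpha> (Suc m) g" using Suc.prems(2) by (simp add: max_def split: if_splits)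
  have Dg: "(g has_derivative frechet_derivative g (at x)) (at x)" for x
    using CH_differentiable[OF g] frechet_derivative_works by blast
  show ?case
  proof (rule CH_SucI)
    show "((\<lambda>x. f (g x)) has_derivative
       (\<lambda>v. \<Sum>c\<in>Basis. (frechet_derivative g (at x) v \<bullet> c) *\<^sub>R pd c f (g x))) (at x)" for x
      using has_derivative_compose[OF Dg CH_Suc_has_derivative[OF Suc.prems(1)]] .
    fix b :: 'a assume b: "b \<in> Basis"
    have "CH \<alpha> m (\<lambda>x. (pd b g x \<bullet> c) *\<^sub>R pd c f (g x))" if "c \<in> Basis" for c
    proof (rule CH_scaleR)
      show "CH \<alpha> m (\<lambda>x. pd b g x \<bullet> c)"
        by (rule CH_bounded_linear[OF bounded_linear_inner_left CH_Suc_pd[OF g b]])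
      show "CH \<alpha> m (\<lambda>x. pd c f (g x))"
        by (rule Suc.IH[OF CH_Suc_pd[OF Suc.prems(1) that] CH_mono[OF Suc.prems(2)]]) auto
    qed
    then show "CH \<alpha> m (\<lambda>x. \<Sum>c\<in>Basis. (frechet_derivative g (at x) b \<bullet> c) *\<^sub>R pd c f (g x))"
      using CH_sum[of Basis m "\<lambda>c x. (pd b g x \<bullet> c) *\<^sub>R pd c f (g x)"]
      by (simp add: partial_deriv_def)
  qed
qed

lemma CH_Pair:
  assumes "CH \<alpha> m f" "CH \<alpha> m g"
  shows "CH \<alpha> m (\<lambda>x. (f x, g x))"
proof -
  have "bounded_linear (\<lambda>v. (v, 0))" "bounded_linear (\<lambda>w. (0, w))"
    by (intro bounded_linear_Pair bounded_linear_ident bounded_linear_zero)+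
  from CH_add[OF CH_bounded_linear[OF this(1) assms(1)] CH_bounded_linear[OF this(2) assms(2)]]
  show ?thesis by simp
qed

end

section \<open>Derivatives within a ball, cutoff functions and the dyadic kernel\<close>

text \<open>By convexity the segment from \<open>x\<close> to any point \<open>w\<close> of an
  interior ball stays in \<open>S\<close>, and differentiating \<open>f\<close> along it shows that
  both derivatives agree on \<open>w - x\<close>. Differences of such vectors point in every
  direction.\<close>

lemma has_derivative_unique_within_convex:
  fixes f :: "'a::euclidean_space \<Rightarrow> 'b::real_normed_vector"
  assumes "convex S" "interior S \<noteq> {}" "x \<in> S"
    and D1: "(f has_derivative D1) (at x within S)" and D2: "(f has_derivative D2) (at x within S)"
  shows "D1 = D2"
proof
  fix u
  obtain y \<epsilon> where y: "\<epsilon> > 0" "ball y \<epsilon> \<subseteq> S"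
    using assms(2) by (metis equals0I mem_interior)
  have lin: "linear D1" "linear D2" using D1 D2 has_derivative_linear by auto
  have eq: "D1 (w - x) = D2 (w - x)" if "w \<in> ball y \<epsilon>" for w
  proof -
    define \<gamma> where "\<gamma> = (\<lambda>s::real. x + s *\<^sub>R (w - x))"
    have "\<gamma> s = (1 - s) *\<^sub>R x + s *\<^sub>R w" for s by (simp add: \<gamma>_def algebra_simps)
    then have \<gamma>S: "\<gamma> ` {0..1} \<subseteq> S"
      using that y(2) assms(1,3) by (auto simp: convex_alt)
    have D\<gamma>: "(\<gamma> has_derivative (\<lambda>s. s *\<^sub>R (w - x))) (at 0 within {0..1})"
      unfolding \<gamma>_def by (auto intro!: derivative_eq_intros)
    have \<gamma>0: "\<gamma> 0 = x" by (simp add: \<gamma>_def)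
    have "((\<lambda>s. f (\<gamma> s)) has_derivative (\<lambda>s. D (s *\<^sub>R (w - x)))) (at 0 within {0..1})"
      if "(f has_derivative D) (at x within S)" for D
      using has_derivative_in_compose[OF D\<gamma>] has_derivative_subset[OF that \<gamma>S] by (simp add: \<gamma>0)
    from this[OF D1] this[OF D2]
    have "((\<lambda>s. f (\<gamma> s)) has_vector_derivative D1 (w - x)) (at 0 within {0..1})"
      "((\<lambda>s. f (\<gamma> s)) has_vector_derivative D2 (w - x)) (at 0 within {0..1})"
      by (simp_all add: has_vector_derivative_def linear_cmul[OF lin(1)] linear_cmul[OF lin(2)])
    then show ?thesis
      using vector_derivative_unique_within_closed_interval[of 0 1 0] by auto
  qed
  show "D1 u = D2 u"
  proof (cases "u = 0")
    case True
    then show ?thesis by (simp add: linear_0 lin)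
  next
    case False
    define s where "s = \<epsilon> / (2 * norm u)"
    have s: "s > 0" using False y(1) by (simp add: s_def)
    have "y + s *\<^sub>R u \<in> ball y \<epsilon>"
      using False y(1) by (simp add: dist_norm s_def)
    from eq[OF this] eq[of y] have "D1 (y + s *\<^sub>R u - x) - D1 (y - x) = D2 (y + s *\<^sub>R u - x) - D2 (y - x)"
      using y(1) by simp
    then have "s *\<^sub>R D1 u = s *\<^sub>R D2 u"
      by (simp add: linear_diff[symmetric] linear_cmul[symmetric] lin)
    then show ?thesis using s by simp
  qed
qed

text \<open>The solutions are restrictions of functions on the whole space; up to and including the
  boundary sphere, their derivatives within the ball are the ordinary derivatives of the
  extension.\<close>

lemma frechet_derivative_within_cball:
  fixes f :: "'a::euclidean_space \<Rightarrow> 'b::real_normed_vector"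
  assumes "0 < R" "x \<in> cball 0 R" "\<And>y. y \<in> cball 0 R \<Longrightarrow> f y = F y" "F differentiable at x"
  shows "f differentiable (at x within cball 0 R)"
    and "frechet_derivative f (at x within cball 0 R) = frechet_derivative F (at x)"
proof -
  have "(F has_derivative frechet_derivative F (at x)) (at x within cball 0 R)"
    using assms(4) frechet_derivative_works has_derivative_at_withinI by blast
  then have D: "(f has_derivative frechet_derivative F (at x)) (at x within cball 0 R)"
    using assms(2,3) by (rule has_derivative_transform[rotated 2]) 
  then show diff: "f differentiable (at x within cball 0 R)" by (rule differentiableI)
  show "frechet_derivative f (at x within cball 0 R) = frechet_derivative F (at x)"
    using assms(1,2) D diff frechet_derivative_works
    by (intro has_derivative_unique_within_convex[of "cball 0 R" x f]) (auto simp: interior_cball)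
qed

text \<open>The predicate \<open>P\<close> is left open because the target class asks for Hoelder
  continuity when \<open>k\<close> is finite and for continuity when
  \<open>k = \<infinity>\<close>.\<close>

lemma partials_upto_cball:
  fixes f :: "'a::euclidean_space \<Rightarrow> 'b::real_normed_vector"
  assumes R: "0 < R" and \<alpha>: "0 < \<alpha>" "\<alpha> \<le> 1"
    and P: "\<And>(g :: 'a \<Rightarrow> 'b) G. CH \<alpha> 0 G \<Longrightarrow> \<forall>x\<in>cball 0 R. g x = G x \<Longrightarrow> P g"
  shows "CH \<alpha> m F \<Longrightarrow> \<forall>x\<in>cball 0 R. f x = F x \<Longrightarrow> partials_upto P (cball 0 R) m f"
proof (induction m arbitrary: f F)
  case (Suc m)
  have d: "F differentiable at x" for x using Suc.prems CH_differentiable \<alpha> by blast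
  note D = frechet_derivative_within_cball[OF R _ Suc.prems(2)[rule_format] d]
  have "partials_upto P (cball 0 R) m (partial_deriv (cball 0 R) b f)" if "b \<in> Basis" for b
    using D(2) by (intro Suc.IH[OF CH_Suc_pd[OF Suc.prems(1) that]]) (auto simp: partial_deriv_def)
  then show ?case using D(1) by (auto simp: differentiable_on_def)
qed (use P in simp)

lemma laplacian_cball:
  fixes f :: "'a::euclidean_space \<Rightarrow> 'b::real_normed_vector"
  assumes R: "0 < R" and \<alpha>: "0 < \<alpha>" "\<alpha> \<le> 1" and F: "CH \<alpha> 2 F"
    and eq: "\<forall>x\<in>cball 0 R. f x = F x" and x: "x \<in> cball 0 R"
  shows "laplacian (cball 0 R) f x = (\<Sum>b\<in>Basis. pd b (pd b F) x)"
  unfolding laplacian_def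
proof (rule sum.cong)
  fix b :: 'a assume b: "b \<in> Basis"
  have F2: "CH \<alpha> (Suc (Suc 0)) F" using F by (simp add: numeral_2_eq_2)
  have "\<And>y. y \<in> cball 0 R \<Longrightarrow> partial_deriv (cball 0 R) b f y = pd b F y"
    using frechet_derivative_within_cball(2)[OF R _ eq[rule_format] CH_differentiable[OF \<alpha> F2]]
    by (simp add: partial_deriv_def)
  from frechet_derivative_within_cball(2)[OF R x this CH_differentiable[OF \<alpha> CH_Suc_pd[OF F2 b]]]
  show "partial_deriv (cball 0 R) b (partial_deriv (cball 0 R) b f) x = pd b (pd b F) x"
    by (simp only: partial_deriv_def[of _ _ "partial_deriv (cball 0 R) b f"]
        partial_deriv_def[of _ _ "pd b F"])
qed auto

section \<open>Smooth functions of one real variable, primitives and auxiliary integrals\<close>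

lemma CH_real_SucI:
  fixes f :: "real \<Rightarrow> real"
  assumes "0 < \<alpha>" "\<alpha> \<le> 1" "\<And>x. (f has_real_derivative f' x) (at x)" "CH \<alpha> m f'"
  shows "CH \<alpha> (Suc m) f"
  using assms(3) by (intro CH_SucI[where f' = "\<lambda>x v. f' x * v"])
    (auto simp: assms(4) has_field_derivative_def)

lemma pd_real_eq:
  fixes f :: "real \<Rightarrow> real"
  shows "(f has_real_derivative f') (at x) \<Longrightarrow> pd 1 f x = f'"
  using pd_eqI[of f "(*) f'" x 1] by (simp add: has_field_derivative_def)

lemma CH_real_0I:
  fixes f :: "real \<Rightarrow> real"
  assumes "0 < \<alpha>" "\<alpha> \<le> 1" "\<And>x. (f has_real_derivative f' x) (at x)" "continuous_on UNIV f'"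
  shows "CH \<alpha> 0 f"
proof (rule CH_C1[OF assms(1,2)])
  show "f differentiable_on UNIV"
    using assms(3) by (metis differentiable_at_imp_differentiable_on real_differentiable_def)
  have "pd 1 f = f'" using pd_real_eq[OF assms(3)] by blast
  then show "continuous_on UNIV (pd b f)" if "b \<in> Basis" for b
    using assms(4) that by simp
qed

lemma DERIV_zero_below:
  fixes f :: "real \<Rightarrow> real"
  assumes "s < \<delta>" "\<And>t. t < \<delta> \<Longrightarrow> f t = 0"
  shows "(f has_real_derivative 0) (at s)"
proof (rule has_field_derivative_transform_within_open[of "\<lambda>_. 0" 0 s "{..<\<delta>}"])
  show "0 = f t" if "t \<in> {..<\<delta>}" for t using assms(2)[of t] that by simp
qed (use assms(1) in auto)

text \<open>The usual flat function is the case \<open>k = 0\<close>. The powers of 1/s are included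
  because the derivative of a member is a linear combination of members, so that one induction gives
  the smoothness of all of them.\<close>

definition exp_recip :: "nat \<Rightarrow> real \<Rightarrow> real" where
  "exp_recip k s = (if s > 0 then exp (- inverse s) * inverse s ^ k else 0)"

lemma exp_recip_deriv:
  "(exp_recip k has_real_derivative exp_recip (k + 2) s - k * exp_recip (k + 1) s) (at s)"
proof -
  consider "s > 0" | "s < 0" | "s = 0" by linarith
  then show ?thesis
  proof cases
    case 1
    have d: "(inverse has_real_derivative - (inverse s ^ 2)) (at s)"
      using DERIV_inverse[of s] 1 by (simp add: power2_eq_square)
    have e: "((\<lambda>s. exp (- inverse s)) has_real_derivative exp (- inverse s) * inverse s ^ 2) (at s)"
      using DERIV_chain2[OF DERIV_exp DERIV_minus[OF d]] by simp
    have p: "((\<lambda>s. inverse s ^ k) has_real_derivative - (k * inverse s ^ (k + 1))) (at s)"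
    proof (cases k)
      case (Suc l)
      have *: "real k * (- (inverse s ^ 2) * inverse s ^ (k - Suc 0)) = - (k * inverse s ^ (k + 1))"
        by (simp add: Suc power2_eq_square)
      show ?thesis using DERIV_power[OF d, of k] unfolding * .
    qed simp
    have "exp (- inverse s) * inverse s ^ 2 * inverse s ^ k + - (k * inverse s ^ (k + 1)) * exp (- inverse s)
        = exp_recip (k + 2) s - k * exp_recip (k + 1) s"
      using 1 by (simp add: exp_recip_def power_add power2_eq_square mult_ac)
    with DERIV_mult[OF e p] have "((\<lambda>s. exp (- inverse s) * inverse s ^ k) has_real_derivative
        exp_recip (k + 2) s - k * exp_recip (k + 1) s) (at s)" by simp
    then show ?thesis
      using 1 by (rule has_field_derivative_transform_within[of _ _ _ _ s]) (auto simp: exp_recip_def dist_real_def)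
  next
    case 2
    then show ?thesis
      using DERIV_zero_below[of s 0 "exp_recip k"] by (simp add: exp_recip_def)
  next
    case 3
    \<comment> \<open>With y = 1/h this is the difference quotient at 0 from the right; from the
      left the quotient is identically 0.\<close>
    have "((\<lambda>y::real. y ^ (k + 1) / exp y) \<longlongrightarrow> 0) at_top" by (rule tendsto_power_div_exp_0)
    from filterlim_compose[OF this filterlim_inverse_at_top_right]
    have "((\<lambda>h. inverse h ^ (k + 1) / exp (inverse h)) \<longlongrightarrow> (0::real)) (at_right 0)" .
    moreover have "\<forall>\<^sub>F h in at_right 0. inverse h ^ (k + 1) / exp (inverse h) = exp_recip k h / h"
      using eventually_at_right_less[of 0]
      by eventually_elim (simp add: exp_recip_def exp_minus divide_inverse)
    ultimately have "((\<lambda>h. exp_recip k h / h) \<longlongrightarrow> 0) (at_right 0)"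
      by (rule Lim_transform_eventually)
    moreover have "((\<lambda>h. exp_recip k h / h) \<longlongrightarrow> 0) (at_left 0)"
      by (rule Lim_transform_eventually[OF tendsto_const[of 0]])
        (auto intro!: eventually_at_leftI[of "-1"] simp: exp_recip_def)
    ultimately have "((\<lambda>h. exp_recip k h / h) \<longlongrightarrow> 0) (at 0)"
      by (simp add: filterlim_at_split)
    then show ?thesis using 3 by (simp add: DERIV_def exp_recip_def)
  qed
qed

lemma real_antiderivative:
  fixes f :: "real \<Rightarrow> real"
  assumes "continuous_on UNIV f"
  obtains F where "\<And>x. (F has_real_derivative f x) (at x)"
proof -
  have "\<exists>F. \<forall>x :: real. -\<infinity> < ereal x \<longrightarrow> ereal x < \<infinity> \<longrightarrow> (F has_vector_derivative f x) (at x)"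
    using assms by (intro einterval_antiderivative) (auto simp: continuous_on_eq_continuous_at)
  then show ?thesis using that by (auto simp: has_real_derivative_iff_has_vector_derivative)
qed

lemma DERIV_zero_eq:
  fixes F :: "real \<Rightarrow> real"
  assumes "\<And>x. (F has_real_derivative f x) (at x)" "s \<le> t" "\<And>x. s < x \<Longrightarrow> x < t \<Longrightarrow> f x = 0"
  shows "F s = F t"
proof (cases "s = t")
  case False
  with assms(2) have "s < t" by simp
  have "\<exists>z>s. z < t \<and> F t - F s = (t - s) * f z"
    by (rule MVT2[OF \<open>s < t\<close> assms(1)])
  then obtain z where "s < z" "z < t" "F t - F s = (t - s) * f z" by blast
  then show ?thesis using assms(3) by simp
qed auto

lemma radial_profile:
  assumes g: "\<And>x. (h has_real_derivative k x) (at x)"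
  shows "((\<lambda>x::'a::euclidean_space. h (x \<bullet> x)) has_derivative (\<lambda>v. 2 * k (x \<bullet> x) * (x \<bullet> v))) (at x)"
proof -
  have "((\<lambda>x::'a. x \<bullet> x) has_derivative (\<lambda>v. 2 * (x \<bullet> v))) (at x)"
    by (auto intro!: derivative_eq_intros simp: inner_commute)
  from has_derivative_compose[OF this g[unfolded has_field_derivative_def]]
  show ?thesis by (simp add: mult.assoc mult.left_commute)
qed

lemma positive_integral_of_bump:
  fixes f :: "'a::euclidean_space \<Rightarrow> real"
  assumes "continuous_on UNIV f" "integrable lborel f" "\<And>x. f x \<ge> 0" "f a > 0"
  shows "integral\<^sup>L lborel f > 0"
proof -
  have "isCont f a" using assms(1) by (simp add: continuous_on_eq_continuous_at)
  then obtain d where d: "d > 0" "\<And>x. dist x a < d \<Longrightarrow> dist (f x) (f a) < f a / 2"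
    using assms(4) unfolding continuous_at_eps_delta by (metis half_gt_zero)
  have low: "f a / 2 * indicator (ball a d) x \<le> f x" for x
  proof (cases "x \<in> ball a d")
    case True
    then have "\<bar>f x - f a\<bar> < f a / 2" using d(2)[of x] by (simp add: dist_commute dist_real_def abs_minus_commute)
    then have "f a / 2 \<le> f x" by linarith
    then show ?thesis using True by simp
  qed (use assms(3) in simp)
  have "0 < f a / 2 * measure lborel (ball a d)"
    using assms(4) d(1) content_ball_pos[of d a] by (simp add: content_ball_pos)
  also have "\<dots> = (\<integral>x. f a / 2 * indicator (ball a d) x \<partial>lborel)"
    by simp
  also have "\<dots> \<le> integral\<^sup>L lborel f"
    using low assms(2) emeasure_lborel_ball_finite[of a d]
    by (intro integral_mono integrable_mult_right integrable_real_indicator) (auto simp: top.not_eq_extremum)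
  finally show ?thesis .
qed

lemma integrable_continuous_compact_support:
  fixes g :: "'a::euclidean_space \<Rightarrow> 'b::euclidean_space"
  assumes "continuous_on UNIV g" "\<And>x. norm x \<ge> \<rho> \<Longrightarrow> g x = 0"
  shows "integrable lborel g"
proof -
  have "integrable lborel (\<lambda>x. indicator (cball 0 \<rho>) x *\<^sub>R g x)"
    by (rule borel_integrable_compact[OF compact_cball continuous_on_subset[OF assms(1)]]) simp
  moreover have "(\<lambda>x. indicator (cball 0 \<rho>) x *\<^sub>R g x) = g"
    using assms(2) by (auto simp: indicator_def fun_eq_iff)
  ultimately show ?thesis by simp
qed

context
  fixes \<alpha> :: real
  assumes \<alpha>: "0 < \<alpha>" "\<alpha> \<le> 1"
begin

lemma CH_exp_recip: "CH \<alpha> m (exp_recip k)"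
proof (induction m arbitrary: k)
  case 0
  have "continuous_on UNIV (exp_recip j)" for j
    using exp_recip_deriv DERIV_isCont continuous_at_imp_continuous_on by blast
  then show ?case
    by (intro CH_real_0I[OF \<alpha> exp_recip_deriv] continuous_on_diff continuous_on_mult continuous_on_const)
next
  case (Suc m)
  show ?case
    using CH_diff[OF \<alpha> Suc CH_cmult[OF \<alpha> Suc], of "k + 2" k "k + 1"]
    by (intro CH_real_SucI[OF \<alpha> exp_recip_deriv]) simp
qed

text \<open>As \<open>g\<close> vanishes to the left of \<delta> > 0, the singularity of
  \<open>s powr p\<close> at 0 is never met, whatever the exponent.\<close>

lemma
  fixes g :: "real \<Rightarrow> real"
  assumes "0 < \<delta>" and g: "\<And>m. CH \<alpha> m g" and g0: "\<And>s. s < \<delta> \<Longrightarrow> g s = 0"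
  shows pd_vanishing_left: "s < \<delta> \<Longrightarrow> pd 1 g s = 0"
    and powr_mult_deriv: "((\<lambda>s. s powr p * g s) has_real_derivative
        s powr p * pd 1 g s + p * s powr (p - 1) * g s) (at s)"
proof -
  have gd: "(g has_real_derivative pd 1 g s) (at s)" for s
  proof -
    have "(g has_derivative (\<lambda>v. v * pd 1 g s)) (at s)"
      using CH_Suc_has_derivative[OF g, of s] by simp
    moreover have "(\<lambda>v. v * pd 1 g s) = (*) (pd 1 g s)" by (auto simp: mult.commute)
    ultimately show ?thesis by (simp add: has_field_derivative_def)
  qed
  show z: "pd 1 g s = 0" if "s < \<delta>" for s
    by (rule pd_real_eq[OF DERIV_zero_below[of s \<delta>]]) (use that g0 in auto)
  show "((\<lambda>s. s powr p * g s) has_real_derivative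
      s powr p * pd 1 g s + p * s powr (p - 1) * g s) (at s)"
  proof (cases "s < \<delta>")
    case True
    have "((\<lambda>s. s powr p * g s) has_real_derivative 0) (at s)"
      by (rule DERIV_zero_below[OF True]) (simp add: g0)
    then show ?thesis by (simp add: z[OF True] g0[OF True])
  next
    case False
    then have "s > 0" using assms(1) by simp
    from DERIV_mult[OF has_real_derivative_powr[OF this] gd]
    show ?thesis by (simp add: add.commute mult.commute mult.left_commute)
  qed
qed

text \<open>The derivative consists of two functions of the same form, one with the derivative of
  \<open>g\<close> and one with the exponent \<open>p - 1\<close>; hence the induction over all
  \<open>g\<close> and \<open>p\<close>.\<close>

lemma CH_powr_mult:
  fixes g :: "real \<Rightarrow> real"
  assumes "0 < \<delta>" and g: "\<And>m. CH \<alpha> m g" and g0: "\<And>s. s < \<delta> \<Longrightarrow> g s = 0"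
  shows "CH \<alpha> m (\<lambda>s. s powr p * g s)"
  using g g0
proof (induction m arbitrary: g p)
  case 0
  have pdg: "CH \<alpha> m (pd 1 g)" for m
    using 0(1)[of "Suc m"] by (simp add: CH_Suc)
  note z = pd_vanishing_left[OF assms(1) 0]
  have cont: "continuous_on UNIV (\<lambda>s. s powr p * g s)"
    if "\<And>m. CH \<alpha> m g" "\<And>s. s < \<delta> \<Longrightarrow> g s = 0" for p and g :: "real \<Rightarrow> real"
    using powr_mult_deriv[OF assms(1) that] DERIV_isCont continuous_at_imp_continuous_on by blast
  have "continuous_on UNIV (\<lambda>s. p * (s powr (p - 1) * g s))"
    using cont[OF 0] continuous_on_mult_left by blast
  then have "continuous_on UNIV (\<lambda>s. s powr p * pd 1 g s + p * s powr (p - 1) * g s)"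
    using cont[OF pdg z] by (simp add: continuous_on_add mult.assoc)
  with powr_mult_deriv[OF assms(1) 0] show ?case
    using CH_real_0I[OF \<alpha>, of "\<lambda>s. s powr p * g s" "\<lambda>s. s powr p * pd 1 g s + p * s powr (p - 1) * g s"]
    by blast
next
  case (Suc m)
  have pdg: "CH \<alpha> m (pd 1 g)" for m
    using Suc.prems(1)[of "Suc m"] by (simp add: CH_Suc)
  note z = pd_vanishing_left[OF assms(1) Suc.prems]
  have "CH \<alpha> m (\<lambda>s. s powr p * pd 1 g s + p *\<^sub>R (s powr (p - 1) * g s))"
    by (rule CH_add[OF \<alpha> Suc.IH[OF pdg z] CH_cmult[OF \<alpha> Suc.IH[OF Suc.prems]]])
  then have "CH \<alpha> m (\<lambda>s. s powr p * pd 1 g s + p * s powr (p - 1) * g s)"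
    by (simp add: mult.assoc)
  with powr_mult_deriv[OF assms(1) Suc.prems] show ?case
    using CH_real_SucI[OF \<alpha>, of "\<lambda>s. s powr p * g s" "\<lambda>s. s powr p * pd 1 g s + p * s powr (p - 1) * g s"]
    by blast
qed

text \<open>\<rho> is the flat function applied to (s - 1/4)(1 - s) and normalised, \<eta> its
  primitive. The interval from 1/4 to 1 is made for s = |x|^2 on an annulus whose radii have ratio
  2, so that doubling x moves s exactly one such interval further.\<close>

lemma smooth_step_exists:
  obtains \<rho> \<eta> :: "real \<Rightarrow> real" where "\<And>m. CH \<alpha> m \<rho>" "\<And>m. CH \<alpha> m \<eta>"
    "\<And>s. (\<eta> has_real_derivative \<rho> s) (at s)" "\<And>s. \<rho> s \<ge> 0" "\<And>s. \<rho> s > 0 \<longleftrightarrow> 1/4 < s \<and> s < 1"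
    "\<And>s. s \<le> 1/4 \<Longrightarrow> \<eta> s = 0" "\<And>s. s \<ge> 1 \<Longrightarrow> \<eta> s = 1" "\<And>s. 0 \<le> \<eta> s \<and> \<eta> s \<le> 1"
proof -
  define \<rho>0 where "\<rho>0 = (\<lambda>s. exp_recip 0 ((s - 1/4) * (1 - s)))"
  have "CH \<alpha> m (\<lambda>s::real. (s - 1/4) * (1 - s))" for m
    by (intro CH_mult[OF \<alpha>] CH_diff[OF \<alpha>] CH_ident[OF \<alpha>] CH_const[OF \<alpha>])
  then have "CH \<alpha> m \<rho>0" for m
    unfolding \<rho>0_def by (rule CH_compose[OF \<alpha> CH_exp_recip])
  note \<rho>0 = this
  have pos: "\<rho>0 s > 0 \<longleftrightarrow> 1/4 < s \<and> s < 1" for s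
    by (auto simp: \<rho>0_def exp_recip_def zero_less_mult_iff)
  have nn: "\<rho>0 s \<ge> 0" for s by (simp add: \<rho>0_def exp_recip_def)
  have zero: "\<rho>0 s = 0" if "s \<le> 1/4 \<or> s \<ge> 1" for s
    using pos[of s] nn[of s] that by linarith
  obtain F where F: "\<And>x. (F has_real_derivative \<rho>0 x) (at x)"
    using real_antiderivative[OF CH_continuous[OF \<alpha> \<rho>0]] by blast
  define c where "c = F 1 - F (1/4)"
  have "\<exists>z>1/4. z < 1 \<and> F 1 - F (1/4) = (1 - 1/4) * \<rho>0 z"
    by (rule MVT2[OF _ F]) simp
  then obtain z where "1/4 < z" "z < 1" "F 1 - F (1/4) = (1 - 1/4) * \<rho>0 z" by blast
  moreover from this have "\<rho>0 z > 0" using pos by blast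
  ultimately have c: "c > 0" by (simp add: c_def)
  have mono: "F s \<le> F t" if "s \<le> t" for s t
    using DERIV_nonneg_imp_nondecreasing[OF that, of F] F nn by blast
  define \<rho> \<eta> where "\<rho> = (\<lambda>s. \<rho>0 s / c)" and "\<eta> = (\<lambda>s. (F s - F (1/4)) / c)"
  have \<eta>d: "(\<eta> has_real_derivative \<rho> s) (at s)" for s
    unfolding \<eta>_def \<rho>_def using F c by (auto intro!: derivative_eq_intros)
  have \<rho>: "CH \<alpha> m \<rho>" for m
    using CH_cmult[OF \<alpha> \<rho>0, of _ "1/c"] by (simp add: \<rho>_def)
  have \<eta>: "CH \<alpha> m \<eta>" for m
    using CH_Suc_imp[OF \<alpha> CH_real_SucI[OF \<alpha> \<eta>d \<rho>]] .
  have \<eta>0: "\<eta> s = 0" if "s \<le> 1/4" for s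
    using DERIV_zero_eq[OF F that] zero by (simp add: \<eta>_def)
  have \<eta>1: "\<eta> s = 1" if "s \<ge> 1" for s
    using DERIV_zero_eq[OF F that] zero c by (simp add: \<eta>_def c_def)
  have \<eta>01: "0 \<le> \<eta> s \<and> \<eta> s \<le> 1" for s
  proof -
    consider "s \<le> 1/4" | "1/4 \<le> s" "s \<le> 1" | "s \<ge> 1" by linarith
    then show ?thesis
    proof cases
      case 2
      then show ?thesis using mono[of "1/4" s] mono[of s 1] c
        by (simp add: \<eta>_def field_simps c_def)
    qed (auto simp: \<eta>0 \<eta>1)
  qed
  show ?thesis
    by (rule that[OF \<rho> \<eta> \<eta>d _ _ \<eta>0 \<eta>1 \<eta>01]) (use nn pos c in \<open>auto simp: \<rho>_def zero_less_divide_iff\<close>)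
qed

lemma CH_norm_sq: "CH \<alpha> m (\<lambda>x::'a::euclidean_space. x \<bullet> x)"
proof -
  have "CH \<alpha> m (\<lambda>x::'a. \<Sum>b\<in>Basis. (x \<bullet> b) * (x \<bullet> b))"
    by (intro CH_sum[OF \<alpha>] CH_mult[OF \<alpha>] CH_linear[OF \<alpha>] bounded_linear_inner_left)
  then show ?thesis by (simp add: euclidean_inner[symmetric])
qed

lemma cutoff_exists:
  assumes "0 < R"
  obtains \<zeta> :: "'a::euclidean_space \<Rightarrow> real" where "\<And>m. CH \<alpha> m \<zeta>"
    "\<And>x. norm x \<le> R \<Longrightarrow> \<zeta> x = 1" "\<And>x. norm x \<ge> 2 * R \<Longrightarrow> \<zeta> x = 0" "\<And>x. 0 \<le> \<zeta> x \<and> \<zeta> x \<le> 1"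
proof -
  obtain \<eta> :: "real \<Rightarrow> real" where \<eta>: "\<And>m. CH \<alpha> m \<eta>"
    "\<And>s. s \<le> 1/4 \<Longrightarrow> \<eta> s = 0" "\<And>s. s \<ge> 1 \<Longrightarrow> \<eta> s = 1" "\<And>s. 0 \<le> \<eta> s \<and> \<eta> s \<le> 1"
    using smooth_step_exists by metis
  \<comment> \<open>The factor 1 / (4 R^2) sends |x| = R to 1/4 and |x| = 2R to 1, the ends of the
    step.\<close>
  define \<zeta> where "\<zeta> = (\<lambda>x::'a. 1 - \<eta> ((1 / (4 * R\<^sup>2)) * (x \<bullet> x)))"
  have CH\<zeta>: "CH \<alpha> m \<zeta>" for m
    unfolding \<zeta>_def
    by (intro CH_diff[OF \<alpha> CH_const[OF \<alpha>]] CH_compose[OF \<alpha> \<eta>(1)]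
        CH_mult[OF \<alpha> CH_const[OF \<alpha>] CH_norm_sq])
  show ?thesis
  proof (rule that[OF CH\<zeta>])
    fix x :: 'a
    show "\<zeta> x = 1" if "norm x \<le> R"
    proof -
      have "(norm x)\<^sup>2 \<le> R\<^sup>2" using power_mono[OF that, of 2] by simp
      then have "(1 / (4 * R\<^sup>2)) * (x \<bullet> x) \<le> 1/4"
        using assms by (simp add: power2_norm_eq_inner divide_simps)
      from \<eta>(2)[OF this] show ?thesis by (simp add: \<zeta>_def)
    qed
    show "\<zeta> x = 0" if "norm x \<ge> 2 * R"
    proof -
      have "(2 * R)\<^sup>2 \<le> (norm x)\<^sup>2" using power_mono[OF that, of 2] assms by simp
      then have "(1 / (4 * R\<^sup>2)) * (x \<bullet> x) \<ge> 1"
        using assms by (simp add: power2_norm_eq_inner divide_simps power_mult_distrib)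
      from \<eta>(3)[OF this] show ?thesis by (simp add: \<zeta>_def)
    qed
    show "0 \<le> \<zeta> x \<and> \<zeta> x \<le> 1"
      using \<eta>(4) by (simp add: \<zeta>_def)
  qed
qed

text \<open>
  The dyadic decomposition of the Newton potential: the dilates \<open>2\<^sup>j\<^sup>(\<^sup>n\<^sup>-\<^sup>2\<^sup>) \<psi>(2\<^sup>j x)\<close> sum to
  a fundamental solution up to a smooth error, because their Laplacians telescope.
\<close>

lemma dyadic_kernel_exists:
  obtains \<psi> \<phi> :: "'a::euclidean_space \<Rightarrow> real" where "\<And>m. CH \<alpha> m \<psi>" "\<And>m. CH \<alpha> m \<phi>"
    "\<And>x. norm x \<ge> 1 \<Longrightarrow> \<psi> x = 0" "\<And>x. norm x \<ge> 1 \<Longrightarrow> \<phi> x = 0"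
    "\<And>x. (\<Sum>b\<in>Basis. pd b (pd b \<psi>) x) = 2 ^ DIM('a) * \<phi> (2 *\<^sub>R x) - \<phi> x"
    "integral\<^sup>L lborel \<phi> = 1"
proof -
  obtain \<rho> \<eta> :: "real \<Rightarrow> real" where \<rho>: "\<And>m. CH \<alpha> m \<rho>" and \<eta>: "\<And>m. CH \<alpha> m \<eta>"
    and \<eta>d: "\<And>s. (\<eta> has_real_derivative \<rho> s) (at s)"
    and nn: "\<And>s. \<rho> s \<ge> 0" and pos: "\<And>s. \<rho> s > 0 \<longleftrightarrow> 1/4 < s \<and> s < 1"
    and \<eta>0: "\<And>s. s \<le> 1/4 \<Longrightarrow> \<eta> s = 0" and \<eta>1: "\<And>s. s \<ge> 1 \<Longrightarrow> \<eta> s = 1"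
    using smooth_step_exists by metis
  have zero: "\<rho> s = 0" if "s \<le> 1/4 \<or> s \<ge> 1" for s
    using pos[of s] nn[of s] that by linarith
  define n where "n = real DIM('a)"
  \<comment> \<open>Both steps are 1 for s >= 1 and both are 0 for s < 1/16, so \<open>g\<close> is
    supported in an annulus away from the origin.\<close>
  define g where "g = (\<lambda>s. \<eta> (4 * s) - \<eta> s)"
  have gd: "(g has_real_derivative 4 * \<rho> (4 * s) - \<rho> s) (at s)" for s
  proof -
    have "((\<lambda>s. 4 * s) has_real_derivative 4) (at s)"
      by (auto intro!: derivative_eq_intros)
    from DERIV_diff[OF DERIV_chain2[OF \<eta>d this] \<eta>d]
    show ?thesis by (simp add: g_def mult.commute)
  qed
  have CHg: "CH \<alpha> m g" for m
    unfolding g_def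
    by (rule CH_diff[OF \<alpha> CH_compose[OF \<alpha> \<eta> CH_mult[OF \<alpha> CH_const[OF \<alpha>] CH_ident[OF \<alpha>]]] \<eta>])
  have g0: "g s = 0" if "s < 1/16" for s using that \<eta>0 by (simp add: g_def)
  have g1: "g s = 0" if "s \<ge> 1" for s using that \<eta>1 by (simp add: g_def)
  \<comment> \<open>The field |x|^(-n) x is, up to a factor, the gradient of the fundamental
    solution and has no divergence away from 0. With the gradient \<kappa>(|x|^2) x, the Laplacian n
    \<kappa> + 2 s \<kappa>' of \<psi> therefore reduces to 2 s^(1 - n/2) g'(s).\<close>
  define \<kappa> where "\<kappa> = (\<lambda>s. s powr (- n / 2) * g s)"
  have CH\<kappa>: "CH \<alpha> m \<kappa>" for m
    unfolding \<kappa>_def by (rule CH_powr_mult[of "1/16", OF _ CHg g0]) auto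
  have \<kappa>d: "(\<kappa> has_real_derivative pd 1 \<kappa> s) (at s)"
    and \<kappa>': "pd 1 \<kappa> s = s powr (- n / 2) * (4 * \<rho> (4 * s) - \<rho> s) - n / 2 * s powr (- n / 2 - 1) * g s" for s
  proof -
    have D: "(\<kappa> has_real_derivative
        s powr (- n / 2) * pd 1 g s + (- n / 2) * s powr (- n / 2 - 1) * g s) (at s)"
      unfolding \<kappa>_def by (rule powr_mult_deriv[of "1/16", OF _ CHg g0]) auto
    from D show "(\<kappa> has_real_derivative pd 1 \<kappa> s) (at s)"
      using pd_real_eq[OF D] by simp
    from pd_real_eq[OF D] show "pd 1 \<kappa> s = s powr (- n / 2) * (4 * \<rho> (4 * s) - \<rho> s) - n / 2 * s powr (- n / 2 - 1) * g s"
      using pd_real_eq[OF gd] by simp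
  qed
  have CH2: "CH \<alpha> m (\<lambda>s. \<kappa> s / 2)" for m
    using CH_cmult[OF \<alpha> CH\<kappa>, of _ "1/2"] by simp
  obtain F where F: "\<And>x. (F has_real_derivative \<kappa> x / 2) (at x)"
    using real_antiderivative[OF CH_continuous[OF \<alpha> CH2]] by blast
  \<comment> \<open>The gradient of \<Psi>(|x|^2) is 2 \<Psi>' x, hence the primitive of \<kappa> /
    2. Subtracting the value at 1 makes it vanish outside the unit ball.\<close>
  define \<Psi> where "\<Psi> = (\<lambda>s. F s - F 1)"
  have \<Psi>d: "(\<Psi> has_real_derivative \<kappa> x / 2) (at x)" for x
    unfolding \<Psi>_def using F by (auto intro!: derivative_eq_intros)
  have CH\<Psi>: "CH \<alpha> m \<Psi>" for m
    using CH_Suc_imp[OF \<alpha> CH_real_SucI[OF \<alpha> \<Psi>d CH2]] .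
  have \<Psi>1: "\<Psi> s = 0" if "s \<ge> 1" for s
    using DERIV_zero_eq[OF F that] g1 by (simp add: \<Psi>_def \<kappa>_def)
  define \<psi> where "\<psi> = (\<lambda>x::'a. \<Psi> (x \<bullet> x))"
  \<comment> \<open>Replacing s by 4s in the power gives 4^(1 - n/2) = 4 / 2^n, so the two terms of
    g'(s) = 4 \<rho>(4s) - \<rho>(s) become 2^n \<phi>(2x) and \<phi>(x).\<close>
  define \<phi> where "\<phi> = (\<lambda>x::'a. 2 * ((x \<bullet> x) powr (1 - n / 2) * \<rho> (x \<bullet> x)))"
  have sq: "norm x \<ge> 1 \<Longrightarrow> x \<bullet> x \<ge> 1" for x :: 'a
    by (metis one_le_power power2_norm_eq_inner)
  have CH\<psi>: "CH \<alpha> m \<psi>" for m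
    unfolding \<psi>_def by (rule CH_compose[OF \<alpha> CH\<Psi> CH_norm_sq])
  have "CH \<alpha> m (\<lambda>s. s powr (1 - n / 2) * \<rho> s)" for m
    using zero by (intro CH_powr_mult[of "1/4", OF _ \<rho>]) auto
  from CH_mult[OF \<alpha> CH_const[OF \<alpha>] CH_compose[OF \<alpha> this CH_norm_sq]]
  have CH\<phi>: "CH \<alpha> m \<phi>" for m
    unfolding \<phi>_def .
  have \<psi>1: "\<psi> x = 0" if "norm x \<ge> 1" for x
    using \<Psi>1[OF sq[OF that]] by (simp add: \<psi>_def)
  have \<phi>1: "\<phi> x = 0" if "norm x \<ge> 1" for x
    using zero sq[OF that] by (simp add: \<phi>_def)
  have pd\<psi>: "pd b \<psi> = (\<lambda>x. \<kappa> (x \<bullet> x) * (x \<bullet> b))" for b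
  proof
    show "pd b \<psi> x = \<kappa> (x \<bullet> x) * (x \<bullet> b)" for x
      using pd_eqI[OF radial_profile[OF \<Psi>d]] by (simp add: \<psi>_def)
  qed
  have pd2: "pd b (pd b \<psi>) x = \<kappa> (x \<bullet> x) + 2 * pd 1 \<kappa> (x \<bullet> x) * (x \<bullet> b)\<^sup>2" if "b \<in> Basis" for b x
  proof -
    have "((\<lambda>x. \<kappa> (x \<bullet> x) * (x \<bullet> b)) has_derivative
        (\<lambda>v. \<kappa> (x \<bullet> x) * (v \<bullet> b) + 2 * pd 1 \<kappa> (x \<bullet> x) * (x \<bullet> v) * (x \<bullet> b))) (at x)"
      by (intro has_derivative_mult radial_profile \<kappa>d has_derivative_inner_left has_derivative_ident)
    from pd_eqI[OF this, of b] show ?thesis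
      using that by (simp add: pd\<psi> power2_eq_square)
  qed
  have lap: "(\<Sum>b\<in>Basis. pd b (pd b \<psi>) x) = 2 ^ DIM('a) * \<phi> (2 *\<^sub>R x) - \<phi> x" for x
  proof -
    define s where "s = x \<bullet> x"
    have s: "s \<ge> 0" by (simp add: s_def)
    have "(\<Sum>b\<in>Basis. pd b (pd b \<psi>) x) = n * \<kappa> s + 2 * pd 1 \<kappa> s * (\<Sum>b\<in>Basis. (x \<bullet> b)\<^sup>2)"
      by (simp add: pd2 sum.distrib n_def s_def sum_distrib_left)
    also have "(\<Sum>b\<in>Basis. (x \<bullet> b)\<^sup>2) = s"
      by (simp add: s_def euclidean_inner[of x x] power2_eq_square)
    also have "n * \<kappa> s + 2 * pd 1 \<kappa> s * s = 2 * s powr (1 - n / 2) * (4 * \<rho> (4 * s) - \<rho> s)"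
    proof (cases "s = 0")
      case False
      then have "s > 0" using s by simp
      then have "s * s powr (- n / 2 - 1) = s powr (- n / 2)" "s * s powr (- n / 2) = s powr (1 - n / 2)"
        using powr_add[of s 1 "- n / 2 - 1"] powr_add[of s 1 "- n / 2"] by simp_all
      moreover have "n * \<kappa> s + 2 * pd 1 \<kappa> s * s
         = n * s powr (- n / 2) * g s + 2 * (s * s powr (- n / 2)) * (4 * \<rho> (4 * s) - \<rho> s)
           - n * (s * s powr (- n / 2 - 1)) * g s"
        by (subst \<kappa>') (simp add: \<kappa>_def algebra_simps)
      ultimately show ?thesis by simp
    qed (simp add: \<kappa>_def)
    also have "\<dots> = 2 ^ DIM('a) * \<phi> (2 *\<^sub>R x) - \<phi> x"
    proof -
      have "(4::real) powr (n / 2) = 2 ^ DIM('a)"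
        using powr_powr[of 2 2 "n / 2"] by (simp add: n_def powr_realpow)
      then have "2 ^ DIM('a) * 4 powr (1 - n / 2) = 4"
        by (simp add: powr_diff)
      then have "2 ^ DIM('a) * (4 * s) powr (1 - n / 2) = 4 * s powr (1 - n / 2)"
        by (simp add: powr_mult s)
      then show ?thesis
        by (simp add: \<phi>_def s_def[symmetric] algebra_simps)
    qed
    finally show ?thesis .
  qed
  have int: "integrable lborel \<phi>"
    using integrable_continuous_compact_support[OF CH_continuous[OF \<alpha> CH\<phi>] \<phi>1] .
  define c where "c = integral\<^sup>L lborel \<phi>"
  obtain b :: 'a where b: "b \<in> Basis" using nonempty_Basis by blast
  have "c > 0" unfolding c_def
  proof (rule positive_integral_of_bump[OF CH_continuous[OF \<alpha> CH\<phi>] int])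
    show "\<phi> x \<ge> 0" for x by (simp add: \<phi>_def nn)
    \<comment> \<open>A point of norm 3/4 has square 9/16, inside the interval where \<rho> is
      positive.\<close>
    have "\<rho> (9/16) > 0" using pos by simp
    then show "\<phi> ((3/4) *\<^sub>R b) > 0" using b by (simp add: \<phi>_def)
  qed
  have "pd b (\<lambda>x. \<psi> x / c) = (\<lambda>x. pd b \<psi> x / c)" if "b \<in> Basis" "\<And>m. CH \<alpha> m \<psi>" for b and \<psi> :: "'a \<Rightarrow> real"
  proof
    fix x
    have "((\<lambda>x. \<psi> x / c) has_derivative (\<lambda>v. (\<Sum>b\<in>Basis. (v \<bullet> b) *\<^sub>R pd b \<psi> x) / c)) (at x)"
      by (rule bounded_linear.has_derivative[OF bounded_linear_divide CH_Suc_has_derivative[OF that(2)]])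
    from pd_eqI[OF this, of b] show "pd b (\<lambda>x. \<psi> x / c) x = pd b \<psi> x / c"
      using that(1) by (simp add: inner_Basis if_distrib if_distribR sum.delta cong: if_cong)
  qed
  note pdc = this
  have CHc: "\<And>m. CH \<alpha> m (\<lambda>x. f x / c)" if "\<And>m. CH \<alpha> m f" for f :: "'a \<Rightarrow> real"
    using CH_cmult[OF \<alpha> that, of _ "1 / c"] by simp
  show ?thesis
  proof (rule that[OF CHc[OF CH\<psi>] CHc[OF CH\<phi>]])
    show "(\<Sum>b\<in>Basis. pd b (pd b (\<lambda>x. \<psi> x / c)) x) = 2 ^ DIM('a) * (\<phi> (2 *\<^sub>R x) / c) - \<phi> x / c" for x
    proof -
      have "pd b (pd b (\<lambda>x. \<psi> x / c)) x = pd b (pd b \<psi>) x / c" if "b \<in> Basis" for b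
        using pdc[OF that CH\<psi>] pdc[OF that, of "pd b \<psi>"] CH_Suc_pd[OF CH\<psi> that] by simp
      then have "(\<Sum>b\<in>Basis. pd b (pd b (\<lambda>x. \<psi> x / c)) x) = (\<Sum>b\<in>Basis. pd b (pd b \<psi>) x) / c"
        by (simp add: sum_divide_distrib)
      then show ?thesis by (simp add: lap diff_divide_distrib)
    qed
    show "integral\<^sup>L lborel (\<lambda>x. \<phi> x / c) = 1"
      using \<open>c > 0\<close> by (simp add: c_def)
  qed (auto simp: \<psi>1 \<phi>1)
qed

end

section \<open>Convolution with dilated kernels\<close>

lemma lborel_integral_shift:
  fixes h :: "'a::euclidean_space \<Rightarrow> 'b::euclidean_space"
  assumes "h \<in> borel_measurable borel"
  shows "(\<integral>z. h (z + c) \<partial>lborel) = (\<integral>z. h z \<partial>lborel)"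
proof -
  have "(\<integral>z. h z \<partial>lborel) = (\<integral>z. h z \<partial>(distr lborel borel ((+) c)))"
    by (simp add: lborel_distr_plus)
  also have "\<dots> = (\<integral>z. h (c + z) \<partial>lborel)"
    by (rule integral_distr) (use assms in auto)
  finally show ?thesis by (simp add: add.commute)
qed

lemma lborel_integral_dilate:
  fixes h :: "'a::euclidean_space \<Rightarrow> 'b::euclidean_space"
  assumes "h \<in> borel_measurable borel" "0 < c"
  shows "(\<integral>z. c ^ DIM('a) *\<^sub>R h (c *\<^sub>R z) \<partial>lborel) = (\<integral>z. h z \<partial>lborel)"
proof -
  have "(\<integral>z. h z \<partial>lborel)
      = (\<integral>z. h z \<partial>(density (distr lborel borel (\<lambda>x. 0 + c *\<^sub>R x)) (\<lambda>_. ennreal (\<bar>c\<bar> ^ DIM('a)))))"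
    using lborel_affine[of c "0::'a"] assms(2) by (simp add: ennreal_power)
  also have "\<dots> = (\<integral>z. \<bar>c\<bar> ^ DIM('a) *\<^sub>R h z \<partial>(distr lborel borel (\<lambda>x. 0 + c *\<^sub>R x)))"
    by (rule integral_density) (use assms in auto)
  also have "\<dots> = (\<integral>z. \<bar>c\<bar> ^ DIM('a) *\<^sub>R h (0 + c *\<^sub>R z) \<partial>lborel)"
    by (rule integral_distr) (use assms in auto)
  finally show ?thesis using assms(2) by simp
qed

lemma norm_integral_le_on_cball:
  fixes g :: "'a::euclidean_space \<Rightarrow> 'b::euclidean_space"
  assumes "continuous_on UNIV g" "\<And>x. norm x > \<rho> \<Longrightarrow> g x = 0" "\<And>x. norm (g x) \<le> B"
  shows "norm (\<integral>x. g x \<partial>lborel) \<le> B * measure lborel (cball 0 \<rho> :: 'a set)"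
proof -
  have "norm (\<integral>x. g x \<partial>lborel) \<le> (\<integral>x. norm (g x) \<partial>lborel)"
    by (rule integral_norm_bound)
  also have "\<dots> \<le> (\<integral>x. B * indicator (cball (0::'a) \<rho>) x \<partial>lborel)"
  proof (rule integral_mono)
    show "integrable lborel (\<lambda>x. norm (g x))"
      using integrable_continuous_compact_support[OF assms(1), of "\<rho> + 1"] assms(2) by auto
    show "integrable lborel (\<lambda>x. B * indicator (cball (0::'a) \<rho>) x :: real)"
      using emeasure_lborel_cball_finite[of "0::'a" \<rho>]
      by (intro integrable_mult_right integrable_real_indicator) (auto simp: top.not_eq_extremum)
    show "norm (g x) \<le> B * indicator (cball 0 \<rho>) x" for x
      using assms(2)[of x] assms(3)[of x] by (auto simp: indicator_def)
  qed
  finally show ?thesis by simp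
qed

section \<open>Functions of bounded support: global Hoelder bounds, Taylor remainders, integrals of
  derivatives\<close>

lemma pd_vanish:
  assumes "\<And>x. norm x > \<rho> \<Longrightarrow> f x = 0" "norm x > \<rho>"
  shows "pd b f x = 0"
proof -
  have "(f has_derivative (\<lambda>_. 0)) (at x)"
  proof (rule has_derivative_transform_within_open[of "\<lambda>_. 0" _ _ _ "- cball 0 \<rho>"])
    show "open (- cball 0 \<rho> :: 'a set)" by (simp add: open_Compl)
  qed (use assms in auto)
  from pd_eqI[OF this] show ?thesis .
qed

context
  fixes \<alpha> :: real
  assumes \<alpha>: "0 < \<alpha>" "\<alpha> \<le> 1"
begin

lemma CH_bounded_if_vanishing:
  assumes "CH \<alpha> m f" "\<And>x. norm x > \<rho> \<Longrightarrow> f x = 0"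
  shows "\<exists>M\<ge>0. \<forall>x. norm (f x) \<le> M"
proof -
  obtain M where M: "M \<ge> 0" "\<And>x. x \<in> cball 0 \<rho> \<Longrightarrow> norm (f x) \<le> M"
    using CH_bounded_on_cball[OF \<alpha> assms(1)] by blast
  have "norm (f x) \<le> M" for x
    using M assms(2)[of x] by (cases "norm x > \<rho>") auto
  with M show ?thesis by blast
qed

text \<open>Points at distance at least 1 are handled by the sup bound. Closer points either both
  lie where \<open>f\<close> vanishes or both lie in the ball of radius \<rho> + 1.\<close>

lemma global_holder_if_vanishing:
  assumes f: "CH \<alpha> m f" and v: "\<And>x. norm x > \<rho> \<Longrightarrow> f x = 0"
  shows "\<exists>C\<ge>0. \<forall>x y. norm (f x - f y) \<le> C * norm (x - y) powr \<alpha>"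
proof -
  obtain M where M: "M \<ge> 0" "\<And>x. norm (f x) \<le> M"
    using CH_bounded_if_vanishing[OF f v] by blast
  have "locally_holder_on \<alpha> UNIV f" using CH_mono[OF \<alpha> f, of 0] by (simp add: CH_0)
  then obtain C where C: "C \<ge> 0" "\<And>x y. x \<in> cball 0 (\<rho> + 1) \<Longrightarrow> y \<in> cball 0 (\<rho> + 1) \<Longrightarrow>
      dist (f x) (f y) \<le> C * dist x y powr \<alpha>"
    by (rule locally_holder_cball[of \<alpha> f "\<rho> + 1"]) blast
  have "norm (f x - f y) \<le> (C + 2 * M) * norm (x - y) powr \<alpha>" for x y
  proof (cases "norm (x - y) \<ge> 1")
    case True
    then have "1 \<le> norm (x - y) powr \<alpha>" using \<alpha> by (simp add: ge_one_powr_ge_zero)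
    then have "(C + 2 * M) * 1 \<le> (C + 2 * M) * norm (x - y) powr \<alpha>"
      using C M by (intro mult_left_mono) auto
    moreover have "norm (f x - f y) \<le> (C + 2 * M) * 1"
      using M(2)[of x] M(2)[of y] norm_triangle_ineq4[of "f x" "f y"] C(1) by simp
    ultimately show ?thesis by (rule order_trans[rotated])
  next
    case False
    show ?thesis
    proof (cases "norm x > \<rho> \<and> norm y > \<rho>")
      case True
      then show ?thesis using v C M by simp
    next
      case nf: False
      have "norm x \<le> norm y + norm (x - y)" "norm y \<le> norm x + norm (x - y)"
        using norm_triangle_ineq[of y "x - y"] norm_triangle_ineq[of x "y - x"]
        by (simp_all add: norm_minus_commute)
      then have "x \<in> cball 0 (\<rho> + 1)" "y \<in> cball 0 (\<rho> + 1)"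
        using nf False by auto
      from C(2)[OF this] have "norm (f x - f y) \<le> C * norm (x - y) powr \<alpha>"
        by (simp add: dist_norm)
      moreover have "0 \<le> 2 * M * norm (x - y) powr \<alpha>" using M by simp
      ultimately show ?thesis by (simp add: distrib_right)
    qed
  qed
  then show ?thesis using C(1) M(1) by (intro exI[of _ "C + 2 * M"]) auto
qed

text \<open>The partial derivatives vanish far out and are thus globally Hoelder, which makes the
  remainder of order 1 + \<alpha> uniform in the base point. This uniformity allows integration of
  the expansion over z.\<close>

lemma taylor_if_vanishing:
  fixes g :: "'a::euclidean_space \<Rightarrow> 'b::real_normed_vector"
  assumes g: "CH \<alpha> (Suc m) g" and v: "\<And>x. norm x > \<rho> \<Longrightarrow> g x = 0"
  obtains K where "K \<ge> 0" "\<And>z u. norm (g (z + u) - g z - (\<Sum>b\<in>Basis. (u \<bullet> b) *\<^sub>R pd b g z))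
      \<le> norm u * (K * norm u powr \<alpha>)"
proof -
  have "\<exists>C\<ge>0. \<forall>x y. norm (pd b g x - pd b g y) \<le> C * norm (x - y) powr \<alpha>"
    if "b \<in> Basis" for b
  proof -
    have "norm x > \<rho> \<Longrightarrow> pd b g x = 0" for x using pd_vanish[of \<rho> g x b] v by blast
    from global_holder_if_vanishing[OF CH_Suc_pd[OF g that] this] show ?thesis .
  qed
  then obtain C where C: "\<And>b. b \<in> Basis \<Longrightarrow> C b \<ge> 0"
      "\<And>b x y. b \<in> Basis \<Longrightarrow> norm (pd b g x - pd b g y) \<le> C b * norm (x - y) powr \<alpha>"
    by metis
  define K where "K = (\<Sum>b\<in>Basis. C b)"
  have K: "K \<ge> 0" unfolding K_def by (rule sum_nonneg) (rule C(1))
  have "norm (g (z + u) - g z - (\<Sum>b\<in>Basis. (u \<bullet> b) *\<^sub>R pd b g z)) \<le> norm u * (K * norm u powr \<alpha>)" for z u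
  proof -
    let ?S = "cball z (norm u)"
    have "norm (g (z + u) - g z - (\<Sum>b\<in>Basis. ((z + u - z) \<bullet> b) *\<^sub>R pd b g z)) \<le> norm (z + u - z) * (K * norm u powr \<alpha>)"
    proof (rule differentiable_bound_linearization[where S = ?S and f' = "\<lambda>x v. \<Sum>b\<in>Basis. (v \<bullet> b) *\<^sub>R pd b g x"])
      show "z + t *\<^sub>R (z + u - z) \<in> ?S" if "t \<in> {0..1}" for t
        using that by (auto simp: dist_norm mult_left_le_one_le)
      show "(g has_derivative (\<lambda>v. \<Sum>b\<in>Basis. (v \<bullet> b) *\<^sub>R pd b g x)) (at x within ?S)" for x
        using CH_Suc_has_derivative[OF g] has_derivative_at_withinI by blast
      show "onorm ((\<lambda>v. \<Sum>b\<in>Basis. (v \<bullet> b) *\<^sub>R pd b g x) - (\<lambda>v. \<Sum>b\<in>Basis. (v \<bullet> b) *\<^sub>R pd b g z)) \<le> K * norm u powr \<alpha>"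
        if x: "x \<in> ?S" for x
      proof (rule onorm_le)
        fix v
        have "norm ((\<Sum>b\<in>Basis. (v \<bullet> b) *\<^sub>R pd b g x) - (\<Sum>b\<in>Basis. (v \<bullet> b) *\<^sub>R pd b g z))
            = norm (\<Sum>b\<in>Basis. (v \<bullet> b) *\<^sub>R (pd b g x - pd b g z))"
          by (simp add: sum_subtractf scaleR_diff_right)
        also have "\<dots> \<le> (\<Sum>b\<in>Basis. norm (pd b g x - pd b g z)) * norm v"
          by (rule norm_sum_Basis_le)
        also have "\<dots> \<le> (K * norm u powr \<alpha>) * norm v"
        proof (rule mult_right_mono)
          have "norm (pd b g x - pd b g z) \<le> C b * norm u powr \<alpha>" if "b \<in> Basis" for b
          proof -
            have "norm (x - z) powr \<alpha> \<le> norm u powr \<alpha>"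
              using x \<alpha> by (intro powr_mono2) (auto simp: dist_norm norm_minus_commute)
            then show ?thesis
              using C(2)[OF that, of x z] mult_left_mono[OF _ C(1)[OF that]] order_trans by blast
          qed
          then show "(\<Sum>b\<in>Basis. norm (pd b g x - pd b g z)) \<le> K * norm u powr \<alpha>"
            unfolding K_def sum_distrib_right by (rule sum_mono)
        qed auto
        finally show "norm (((\<lambda>v. \<Sum>b\<in>Basis. (v \<bullet> b) *\<^sub>R pd b g x) - (\<lambda>v. \<Sum>b\<in>Basis. (v \<bullet> b) *\<^sub>R pd b g z)) v)
            \<le> K * norm u powr \<alpha> * norm v" by simp
      qed
    qed auto
    then show ?thesis by simp
  qed
  with K show ?thesis using that by blast
qed

text \<open>Translation leaves the integral of \<open>g\<close> unchanged, so the first order Taylor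
  remainder with step t along \<open>b\<close> integrates to -t times the integral of the
  derivative. The remainder is O(t^(1+\<alpha>)); dividing by t and letting t tend to 0 gives the
  claim without iterated integrals.\<close>

lemma integral_pd_eq_0:
  fixes g :: "'a::euclidean_space \<Rightarrow> 'b::euclidean_space"
  assumes g: "CH \<alpha> (Suc m) g" and v: "\<And>x. norm x > \<rho> \<Longrightarrow> g x = 0" and b: "b \<in> Basis"
  shows "(\<integral>z. pd b g z \<partial>lborel) = 0"
proof -
  define I where "I = (\<integral>z. pd b g z \<partial>lborel)"
  obtain K where K: "K \<ge> 0" "\<And>z u. norm (g (z + u) - g z - (\<Sum>b\<in>Basis. (u \<bullet> b) *\<^sub>R pd b g z))
      \<le> norm u * (K * norm u powr \<alpha>)"
    using taylor_if_vanishing[OF g v] by blast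
  have gc: "continuous_on UNIV g" and pc: "continuous_on UNIV (pd b g)"
    using CH_continuous[OF \<alpha>] g CH_Suc_pd[OF g b] by blast+
  have gs: "continuous_on UNIV (\<lambda>z. g (z + c))" for c
    using gc by (intro continuous_on_compose2[OF gc]) (auto intro!: continuous_intros)
  define V where "V = measure lborel (cball 0 (\<rho> + 1) :: 'a set)"
  have bound: "norm I \<le> K * V * t powr \<alpha>" if t: "0 < t" "t \<le> 1" for t
  proof -
    have far: "norm (z + t *\<^sub>R b) > \<rho>" if "norm z > \<rho> + 1" for z
      using that t b norm_triangle_ineq4[of "z + t *\<^sub>R b" "t *\<^sub>R b"] by simp
    define h where "h = (\<lambda>z. g (z + t *\<^sub>R b) - g z - t *\<^sub>R pd b g z)"
    have "integrable lborel g" "integrable lborel (pd b g)" "integrable lborel (\<lambda>z. g (z + t *\<^sub>R b))"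
      using v pd_vanish[of \<rho> g, OF v] far
      by (intro integrable_continuous_compact_support[where \<rho> = "\<rho> + 2"] gc pc gs; force)+
    then have "(\<integral>z. h z \<partial>lborel) = (\<integral>z. g (z + t *\<^sub>R b) \<partial>lborel) - (\<integral>z. g z \<partial>lborel) - t *\<^sub>R I"
      unfolding h_def I_def by simp
    also have "(\<integral>z. g (z + t *\<^sub>R b) \<partial>lborel) = (\<integral>z. g z \<partial>lborel)"
      using gc by (intro lborel_integral_shift) (rule borel_measurable_continuous_onI)
    finally have "norm (t *\<^sub>R I) = norm (\<integral>z. h z \<partial>lborel)" by simp
    also have "\<dots> \<le> (t * (K * t powr \<alpha>)) * V"
      unfolding V_def
    proof (rule norm_integral_le_on_cball)
      show "continuous_on UNIV h"
        unfolding h_def by (intro continuous_intros gc pc gs)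
      show "h z = 0" if "norm z > \<rho> + 1" for z
        unfolding h_def using v[OF far[OF that]] v[of z] pd_vanish[of \<rho> g z b, OF v] that by simp
      show "norm (h z) \<le> t * (K * t powr \<alpha>)" for z
        using K(2)[of z "t *\<^sub>R b"] t b
        by (simp add: h_def inner_Basis if_distrib if_distribR sum.delta cong: if_cong)
    qed
    finally have "t * norm I \<le> t * (K * V * t powr \<alpha>)" using t by (simp add: mult_ac)
    then show ?thesis using t by simp
  qed
  have "((\<lambda>t. K * V * t powr \<alpha>) \<longlongrightarrow> K * V * 0 powr \<alpha>) (at_right 0)"
    using \<alpha> by (intro tendsto_intros) (auto simp: eventually_at_right_less[THEN eventually_mono])
  then have "((\<lambda>t. K * V * t powr \<alpha>) \<longlongrightarrow> 0) (at_right 0)" by simp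
  then have "norm I \<le> 0"
    by (rule tendsto_lowerbound)
      (use bound in \<open>auto simp: eventually_at_right_field intro!: exI[of _ 1]\<close>)
  then show ?thesis by (simp add: I_def)
qed

end

text \<open>Convolution of \<open>f\<close> with the dilated kernel r^(-n) w(x/r), after the
  substitution that keeps the kernel fixed and moves the scale into the argument of
  \<open>f\<close>. All kernel constants are thereby independent of r.\<close>

definition smear :: "('a::euclidean_space \<Rightarrow> real) \<Rightarrow> real \<Rightarrow> ('a \<Rightarrow> 'b::euclidean_space) \<Rightarrow> 'a \<Rightarrow> 'b" where
  "smear w r f x = (\<integral>z. w z *\<^sub>R f (x - r *\<^sub>R z) \<partial>lborel)"

text \<open>The bound \<open>K\<close> is monotone, so that one constant serves a finite family of kernels.\<close>

definition bump_kernel :: "real \<Rightarrow> ('a::euclidean_space \<Rightarrow> real) \<Rightarrow> real \<Rightarrow> bool" where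
  "bump_kernel \<alpha> w K \<longleftrightarrow> (\<forall>m. CH \<alpha> m w) \<and> (\<forall>z. norm z > 1 \<longrightarrow> w z = 0) \<and>
     (\<integral>z. \<bar>w z\<bar> \<partial>lborel) \<le> K \<and> (\<forall>x y. \<bar>w x - w y\<bar> \<le> K * norm (x - y))"

lemma bump_kernel_mono: "bump_kernel \<alpha> w K \<Longrightarrow> K \<le> K' \<Longrightarrow> bump_kernel \<alpha> w K'"
  unfolding bump_kernel_def by (meson mult_right_mono norm_ge_zero order_trans)

lemma bump_kernel_nonneg: "bump_kernel \<alpha> w K \<Longrightarrow> K \<ge> 0"
  unfolding bump_kernel_def by (meson Bochner_Integration.integral_nonneg abs_ge_zero order_trans)

lemma bump_kernel_CH: "bump_kernel \<alpha> w K \<Longrightarrow> CH \<alpha> m w"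
  and bump_kernel_vanish: "bump_kernel \<alpha> w K \<Longrightarrow> norm z > 1 \<Longrightarrow> w z = 0"
  and bump_kernel_lipschitz: "bump_kernel \<alpha> w K \<Longrightarrow> \<bar>w x - w y\<bar> \<le> K * norm (x - y)"
  by (simp_all add: bump_kernel_def)

context
  fixes \<alpha> :: real
  assumes \<alpha>: "0 < \<alpha>" "\<alpha> \<le> 1"
begin

lemma bump_kernel_continuous: "bump_kernel \<alpha> w K \<Longrightarrow> continuous_on UNIV w"
  using bump_kernel_CH CH_continuous[OF \<alpha>] by blast

lemma bump_kernelI:
  fixes w :: "'a::euclidean_space \<Rightarrow> real"
  assumes "\<And>m. CH \<alpha> m w" "\<And>z. norm z > 1 \<Longrightarrow> w z = 0"
  shows "\<exists>K. bump_kernel \<alpha> w K"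
proof -
  have "\<exists>M\<ge>0. \<forall>x. norm (pd b w x) \<le> M" if "b \<in> Basis" for b
    by (rule CH_bounded_if_vanishing[OF \<alpha> CH_Suc_pd[OF assms(1) that]])
      (rule pd_vanish[of 1 w, OF assms(2)])
  then obtain M where M: "\<And>b. b \<in> Basis \<Longrightarrow> M b \<ge> 0" "\<And>b x. b \<in> Basis \<Longrightarrow> norm (pd b w x) \<le> M b"
    by metis
  have le: "norm (pd b w x) \<le> sum M Basis" if "b \<in> Basis" for b x
    using M(2)[OF that] member_le_sum[of b Basis M] M(1) that by (meson finite_Basis order_trans DiffD1)
  have "norm (w x - w y) \<le> DIM('a) * sum M Basis * norm (x - y)" for x y
    using CH_differentiable[OF \<alpha> assms(1)] le by (intro lipschitz_if_pd_bounded[of UNIV]) auto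
  moreover define K where "K = max (\<integral>z. \<bar>w z\<bar> \<partial>lborel) (DIM('a) * sum M Basis)"
  ultimately have "\<bar>w x - w y\<bar> \<le> K * norm (x - y)" for x y
    by (smt (verit, best) mult_right_mono norm_ge_zero real_norm_def)
  then have "bump_kernel \<alpha> w K"
    using assms unfolding bump_kernel_def K_def by auto
  then show ?thesis by blast
qed

end

lemma continuous_on_affine_arg:
  fixes f :: "'a::euclidean_space \<Rightarrow> 'b::topological_space"
  shows "continuous_on UNIV f \<Longrightarrow> continuous_on UNIV (\<lambda>z. f (x - r *\<^sub>R z))"
  by (rule continuous_on_compose2[of UNIV f]) (auto intro!: continuous_intros)

lemma continuous_on_shift_arg:
  fixes f :: "'a::euclidean_space \<Rightarrow> 'b::topological_space"
  shows "continuous_on UNIV f \<Longrightarrow> continuous_on UNIV (\<lambda>z. f (z + c))"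
  by (rule continuous_on_compose2[of UNIV f]) (auto intro!: continuous_intros)

lemma integrable_smear:
  fixes f :: "'a::euclidean_space \<Rightarrow> 'b::euclidean_space"
  assumes "continuous_on UNIV w" "\<And>z. norm z > \<rho> \<Longrightarrow> w z = 0" "continuous_on UNIV f"
  shows "integrable lborel (\<lambda>z. w z *\<^sub>R f (x - r *\<^sub>R z))"
  by (rule integrable_continuous_compact_support[where \<rho> = "\<rho> + 1"])
    (use assms in \<open>auto intro!: continuous_on_scaleR continuous_on_affine_arg\<close>)

text \<open>The displacement moves from \<open>f\<close> to the kernel, where it is measured in
  units of r. Smoothness in x can then be read off the kernel even if \<open>f\<close> is merely
  continuous.\<close>

lemma smear_shift:
  fixes f :: "'a::euclidean_space \<Rightarrow> 'b::euclidean_space"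
  assumes w: "continuous_on UNIV w" and f: "continuous_on UNIV f" and r: "r > 0"
  shows "smear w r f (x + v) = (\<integral>z. w (z + (1 / r) *\<^sub>R v) *\<^sub>R f (x - r *\<^sub>R z) \<partial>lborel)"
proof -
  define H where "H = (\<lambda>z. w z *\<^sub>R f (x + v - r *\<^sub>R z))"
  have "continuous_on UNIV H"
    unfolding H_def by (intro continuous_on_scaleR continuous_on_affine_arg w f)
  then have "(\<integral>z. H (z + (1 / r) *\<^sub>R v) \<partial>lborel) = (\<integral>z. H z \<partial>lborel)"
    by (intro lborel_integral_shift borel_measurable_continuous_onI)
  then show ?thesis
    using r by (simp add: H_def smear_def algebra_simps)
qed

lemma smear_diff_const:
  fixes f :: "'a::euclidean_space \<Rightarrow> 'b::euclidean_space"
  assumes "continuous_on UNIV w" "\<And>z. norm z > \<rho> \<Longrightarrow> w z = 0" "continuous_on UNIV f"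
  shows "(\<integral>z. w z *\<^sub>R (f (x - r *\<^sub>R z) - c) \<partial>lborel)
    = (\<integral>z. w z *\<^sub>R f (x - r *\<^sub>R z) \<partial>lborel) - (\<integral>z. w z \<partial>lborel) *\<^sub>R c"
proof -
  have "integrable lborel w"
    by (rule integrable_continuous_compact_support[OF assms(1), where \<rho> = "\<rho> + 1"]) (use assms(2) in auto)
  then have "integrable lborel (\<lambda>z. w z *\<^sub>R c)" and "(\<integral>z. w z *\<^sub>R c \<partial>lborel) = (\<integral>z. w z \<partial>lborel) *\<^sub>R c"
    by auto
  then show ?thesis
    using integrable_smear[OF assms, where x = x and r = r] by (simp add: scaleR_diff_right)
qed

lemma shifted_vanish:
  assumes "\<And>z. norm (z::'a::euclidean_space) > 1 \<Longrightarrow> w z = 0" "norm u \<le> 1" "norm z > 2"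
  shows "w (z + u) = 0"
  using assms norm_triangle_ineq4[of "z + u" u] by simp

context
  fixes \<alpha> :: real
  assumes \<alpha>: "0 < \<alpha>" "\<alpha> \<le> 1"
begin

text \<open>The bound on \<open>f\<close> is only asked for within distance r of x, so that it can
  also be used for the oscillation of a Hoelder function.\<close>

lemma smear_bound:
  fixes f :: "'a::euclidean_space \<Rightarrow> 'b::euclidean_space"
  assumes w: "bump_kernel \<alpha> w K" and f: "continuous_on UNIV f"
    and M: "\<And>z. norm z \<le> 1 \<Longrightarrow> norm (f (x - r *\<^sub>R z)) \<le> M"
  shows "norm (smear w r f x) \<le> K * M"
proof -
  note wc = bump_kernel_continuous[OF \<alpha> w] and wv = bump_kernel_vanish[OF w]
  have "M \<ge> 0" using order_trans[OF norm_ge_zero M[of 0]] by simp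
  have "norm (smear w r f x) \<le> (\<integral>z. norm (w z *\<^sub>R f (x - r *\<^sub>R z)) \<partial>lborel)"
    unfolding smear_def by (rule integral_norm_bound)
  also have "\<dots> \<le> (\<integral>z. \<bar>w z\<bar> * M \<partial>lborel)"
  proof (rule integral_mono)
    show "integrable lborel (\<lambda>z. norm (w z *\<^sub>R f (x - r *\<^sub>R z)))"
      by (rule integrable_norm[OF integrable_smear[OF wc wv f]])
    have "integrable lborel w"
      by (rule integrable_continuous_compact_support[OF wc, where \<rho> = 2]) (simp add: wv)
    then show "integrable lborel (\<lambda>z. \<bar>w z\<bar> * M)"
      by (intro integrable_mult_left integrable_abs)
    show "norm (w z *\<^sub>R f (x - r *\<^sub>R z)) \<le> \<bar>w z\<bar> * M" for z
      using M[of z] wv[of z] by (cases "norm z \<le> 1") (auto intro: mult_left_mono)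
  qed
  also have "\<dots> = (\<integral>z. \<bar>w z\<bar> \<partial>lborel) * M" by simp
  also have "\<dots> \<le> K * M"
    using w \<open>M \<ge> 0\<close> by (intro mult_right_mono) (auto simp: bump_kernel_def)
  finally show ?thesis .
qed

text \<open>The increment of a kernel integrates to \<open>0\<close>, so any constant may be subtracted from \<open>f\<close>.\<close>

lemma smear_lipschitz:
  fixes f :: "'a::euclidean_space \<Rightarrow> 'b::euclidean_space"
  assumes w: "bump_kernel \<alpha> w K" and f: "continuous_on UNIV f" and r: "0 < r" "norm v \<le> r"
    and B: "\<And>z. norm z \<le> 2 \<Longrightarrow> norm (f (x - r *\<^sub>R z) - c) \<le> B"
  shows "norm (smear w r f (x + v) - smear w r f x)
    \<le> K * measure lborel (cball 0 2 :: 'a set) * B * (norm v / r)"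
proof -
  note wc = bump_kernel_continuous[OF \<alpha> w] and wv = bump_kernel_vanish[OF w]
  define u where "u = (1 / r) *\<^sub>R v"
  have u: "norm u = norm v / r" "norm u \<le> 1" using r by (auto simp: u_def)
  have ws: "continuous_on UNIV (\<lambda>z. w (z + u))" by (rule continuous_on_shift_arg[OF wc])
  \<comment> \<open>As |v| <= r, the shifted kernel still lives in the ball of radius 2, whose
    volume enters the constant.\<close>
  have wsv: "w (z + u) = 0" "w z = 0" if "norm z > 2" for z
    using shifted_vanish[of w, OF wv u(2) that] wv that by auto
  define d where "d = (\<lambda>z. w (z + u) - w z)"
  have dc: "continuous_on UNIV d" unfolding d_def by (intro continuous_on_diff ws wc)
  have dv: "d z = 0" if "norm z > 2" for z using wsv[OF that] by (simp add: d_def)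
  have "(\<integral>z. w (z + u) \<partial>lborel) = (\<integral>z. w z \<partial>lborel)"
    by (rule lborel_integral_shift) (rule borel_measurable_continuous_onI[OF wc])
  moreover have "integrable lborel w" "integrable lborel (\<lambda>z. w (z + u))"
    using wsv by (auto intro!: integrable_continuous_compact_support[where \<rho> = "3"] wc ws)
  ultimately have d0: "(\<integral>z. d z \<partial>lborel) = 0" by (simp add: d_def)
  have "smear w r f (x + v) - smear w r f x = (\<integral>z. d z *\<^sub>R f (x - r *\<^sub>R z) \<partial>lborel)"
    using integrable_smear[OF ws wsv(1) f, where x = x and r = r] integrable_smear[OF wc wv f, where x = x and r = r]
    by (simp add: smear_shift[OF wc f r(1)] u_def[symmetric] d_def scaleR_diff_left smear_def[of _ _ _ x])
  also have "\<dots> = (\<integral>z. d z *\<^sub>R (f (x - r *\<^sub>R z) - c) \<partial>lborel)"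
    by (simp add: smear_diff_const[OF dc dv f] d0)
  also have "norm \<dots> \<le> (K * norm u * B) * measure lborel (cball 0 2 :: 'a set)"
  proof (rule norm_integral_le_on_cball)
    show "continuous_on UNIV (\<lambda>z. d z *\<^sub>R (f (x - r *\<^sub>R z) - c))"
      by (intro continuous_intros dc continuous_on_affine_arg f)
    show "d z *\<^sub>R (f (x - r *\<^sub>R z) - c) = 0" if "norm z > 2" for z
      using dv[OF that] by simp
    show "norm (d z *\<^sub>R (f (x - r *\<^sub>R z) - c)) \<le> K * norm u * B" for z
    proof (cases "norm z \<le> 2")
      case True
      have "\<bar>d z\<bar> \<le> K * norm u"
        using bump_kernel_lipschitz[OF w, of "z + u" z] by (simp add: d_def)
      then show ?thesis
        using B[OF True] bump_kernel_nonneg[OF w] by (auto intro!: mult_mono)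
    next
      case False
      moreover have "B \<ge> 0" using order_trans[OF norm_ge_zero B[of 0]] by simp
      ultimately show ?thesis using dv bump_kernel_nonneg[OF w] by simp
    qed
  qed
  finally show ?thesis by (simp add: u mult_ac)
qed

text \<open>The derivative falls on the kernel, at the price of a factor 1/r. The uniform Taylor
  remainder of \<open>w\<close>, integrated against a bounded \<open>f\<close>, is o(|v|).\<close>

lemma smear_has_derivative:
  fixes f :: "'a::euclidean_space \<Rightarrow> 'b::euclidean_space"
  assumes w: "bump_kernel \<alpha> w K" and f: "continuous_on UNIV f" and r: "0 < r"
    and M: "\<And>x. norm (f x) \<le> M"
  shows "(smear w r f has_derivative (\<lambda>v. \<Sum>b\<in>Basis. (v \<bullet> b) *\<^sub>R ((1 / r) *\<^sub>R smear (pd b w) r f x))) (at x)"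
    (is "(_ has_derivative ?D) _")
proof -
  note wc = bump_kernel_continuous[OF \<alpha> w] and wv = bump_kernel_vanish[OF w]
    and wCH = bump_kernel_CH[OF w]
  have pc: "continuous_on UNIV (pd b w)" and pv: "norm z > 1 \<Longrightarrow> pd b w z = 0" if "b \<in> Basis" for b z
    using CH_continuous[OF \<alpha> CH_Suc_pd[OF wCH that]] pd_vanish[of 1 w z b] wv by auto
  have M0: "M \<ge> 0" using order_trans[OF norm_ge_zero M[of 0]] .
  obtain T where T: "T \<ge> 0" "\<And>z u. norm (w (z + u) - w z - (\<Sum>b\<in>Basis. (u \<bullet> b) *\<^sub>R pd b w z))
      \<le> norm u * (T * norm u powr \<alpha>)"
    using taylor_if_vanishing[OF \<alpha> wCH wv] by blast
  define V where "V = measure lborel (cball 0 2 :: 'a set)"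
  have V: "V \<ge> 0" by (simp add: V_def)
  have main: "norm (smear w r f (x + v) - smear w r f x - ?D v)
      \<le> T * M * V / r * (norm v / r) powr \<alpha> * norm v" if v: "norm v \<le> r" for v
  proof -
    define u where "u = (1 / r) *\<^sub>R v"
    have u: "norm u = norm v / r" "norm u \<le> 1" using r v by (auto simp: u_def)
    have ws: "continuous_on UNIV (\<lambda>z. w (z + u))" by (rule continuous_on_shift_arg[OF wc])
    have wsv: "w (z + u) = 0" "w z = 0" if "norm z > 2" for z
      using shifted_vanish[of w, OF wv u(2) that] wv that by auto
    define d where "d = (\<lambda>z. w (z + u) - w z - (\<Sum>b\<in>Basis. (u \<bullet> b) *\<^sub>R pd b w z))"
    have dc: "continuous_on UNIV d" unfolding d_def
      by (intro continuous_on_diff ws wc continuous_on_sum continuous_on_scaleR continuous_on_const pc)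
    have dv: "d z = 0" if "norm z > 2" for z using wsv[OF that] pv that by (simp add: d_def)
    have I: "integrable lborel (\<lambda>z. pd b w z *\<^sub>R f (x - r *\<^sub>R z))" if "b \<in> Basis" for b
      by (rule integrable_smear[OF pc[OF that] pv[OF that] f])
    have D: "?D v = (\<integral>z. (\<Sum>b\<in>Basis. (u \<bullet> b) *\<^sub>R (pd b w z *\<^sub>R f (x - r *\<^sub>R z))) \<partial>lborel)"
    proof -
      have "(\<integral>z. (\<Sum>b\<in>Basis. (u \<bullet> b) *\<^sub>R (pd b w z *\<^sub>R f (x - r *\<^sub>R z))) \<partial>lborel)
          = (\<Sum>b\<in>Basis. \<integral>z. (u \<bullet> b) *\<^sub>R (pd b w z *\<^sub>R f (x - r *\<^sub>R z)) \<partial>lborel)"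
        by (rule Bochner_Integration.integral_sum) (intro integrable_scaleR_right I)
      also have "\<dots> = (\<Sum>b\<in>Basis. (u \<bullet> b) *\<^sub>R smear (pd b w) r f x)"
        unfolding smear_def by (intro sum.cong refl Bochner_Integration.integral_scaleR_right I)
      finally show ?thesis by (simp add: u_def)
    qed
    define A B E where "A = (\<lambda>z. w (z + u) *\<^sub>R f (x - r *\<^sub>R z))" and "B = (\<lambda>z. w z *\<^sub>R f (x - r *\<^sub>R z))"
      and "E = (\<lambda>z. \<Sum>b\<in>Basis. (u \<bullet> b) *\<^sub>R (pd b w z *\<^sub>R f (x - r *\<^sub>R z)))"
    have ABE: "integrable lborel A" "integrable lborel B" "integrable lborel E"
      unfolding A_def B_def E_def
      by (rule integrable_smear[OF ws wsv(1) f] integrable_smear[OF wc wv f]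
          Bochner_Integration.integrable_sum integrable_scaleR_right I | assumption)+
    have "smear w r f (x + v) - smear w r f x - ?D v
        = (\<integral>z. A z \<partial>lborel) - (\<integral>z. B z \<partial>lborel) - (\<integral>z. E z \<partial>lborel)"
      unfolding D smear_shift[OF wc f r] by (simp only: A_def B_def E_def u_def smear_def)
    also have "\<dots> = (\<integral>z. A z - B z - E z \<partial>lborel)"
      using ABE by simp
    also have "\<dots> = (\<integral>z. d z *\<^sub>R f (x - r *\<^sub>R z) \<partial>lborel)"
      by (rule Bochner_Integration.integral_cong[OF refl]) (simp add: A_def B_def E_def d_def scaleR_diff_left scaleR_sum_left fun_eq_iff)
    also have "norm \<dots> \<le> (norm u * (T * norm u powr \<alpha>) * M) * V"
      unfolding V_def
    proof (rule norm_integral_le_on_cball)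
      show "continuous_on UNIV (\<lambda>z. d z *\<^sub>R f (x - r *\<^sub>R z))"
        by (intro continuous_intros dc continuous_on_affine_arg f)
      show "d z *\<^sub>R f (x - r *\<^sub>R z) = 0" if "norm z > 2" for z
        using dv[OF that] by simp
      have "\<bar>d z\<bar> \<le> norm u * (T * norm u powr \<alpha>)" for z
        using T(2)[of z u] by (simp add: d_def)
      then show "norm (d z *\<^sub>R f (x - r *\<^sub>R z)) \<le> norm u * (T * norm u powr \<alpha>) * M" for z
        using M T(1) by (auto intro!: mult_mono)
    qed
    finally show ?thesis by (simp add: u mult_ac)
  qed
  have bl: "bounded_linear ?D"
    by (intro bounded_linear_sum bounded_linear_compose[OF bounded_linear_scaleR_left bounded_linear_inner_left])
  have lim: "((\<lambda>y. T * M * V / r * (norm (y - x) / r) powr \<alpha>) \<longlongrightarrow> 0) (at x)"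
  proof -
    have "((\<lambda>y. T * M * V / r * (norm (y - x) / r) powr \<alpha>) \<longlongrightarrow> T * M * V / r * (norm (x - x) / r) powr \<alpha>) (at x)"
      using \<alpha> r by (intro tendsto_intros) auto
    then show ?thesis by simp
  qed
  have "((\<lambda>y. norm (smear w r f y - smear w r f x - ?D (y - x)) / norm (y - x)) \<longlongrightarrow> 0) (at x)"
  proof (rule tendsto_sandwich[OF _ _ tendsto_const lim])
    have "\<forall>\<^sub>F y in at x. y \<in> ball x r - {x}"
      using r by (intro eventually_at_in_open) auto
    then show "\<forall>\<^sub>F y in at x. norm (smear w r f y - smear w r f x - ?D (y - x)) / norm (y - x)
        \<le> T * M * V / r * (norm (y - x) / r) powr \<alpha>"
    proof eventually_elim
      case (elim y)
      then have "norm (y - x) \<le> r" "norm (y - x) > 0" by (auto simp: dist_norm norm_minus_commute)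
      with main[of "y - x"] show ?case by (simp add: pos_divide_le_eq)
    qed
  qed auto
  with bl show ?thesis
    unfolding has_derivative_iff_norm by blast
qed

text \<open>The derivative of z \<mapsto> w(z) f(x - r z) integrates to 0; the factor r comes from
  the inner derivative. It cancels the 1/r lost when differentiating the kernel, so all higher
  derivatives can be put on \<open>f\<close>.\<close>

lemma smear_by_parts:
  fixes f :: "'a::euclidean_space \<Rightarrow> 'b::euclidean_space"
  assumes w: "bump_kernel \<alpha> w K" and f: "CH \<alpha> (Suc m) f" and r: "0 < r" and b: "b \<in> Basis"
  shows "smear (pd b w) r f x = r *\<^sub>R smear w r (pd b f) x"
proof -
  note wc = bump_kernel_continuous[OF \<alpha> w] and wv = bump_kernel_vanish[OF w]
    and wCH = bump_kernel_CH[OF w]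
  have pc: "continuous_on UNIV (pd b w)" and pv: "norm z > 1 \<Longrightarrow> pd b w z = 0" for z
    using CH_continuous[OF \<alpha> CH_Suc_pd[OF wCH b]] pd_vanish[of 1 w z b] wv by auto
  define g where "g = (\<lambda>z. w z *\<^sub>R f (x - r *\<^sub>R z))"
  have "CH \<alpha> (max 1 (Suc m)) (\<lambda>z. x - r *\<^sub>R z)"
    by (intro CH_diff[OF \<alpha>] CH_const[OF \<alpha>] CH_cmult[OF \<alpha>] CH_ident[OF \<alpha>])
  from CH_scaleR[OF \<alpha> wCH CH_compose[OF \<alpha> f this]]
  have gCH: "CH \<alpha> (Suc m) g" unfolding g_def .
  have "pd b g z = pd b w z *\<^sub>R f (x - r *\<^sub>R z) - r *\<^sub>R (w z *\<^sub>R pd b f (x - r *\<^sub>R z))" for z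
  proof -
    have "((\<lambda>z. x - r *\<^sub>R z) has_derivative (\<lambda>v. - (r *\<^sub>R v))) (at z)"
      by (auto intro!: derivative_eq_intros)
    from has_derivative_scaleR[OF CH_Suc_has_derivative[OF wCH] has_derivative_compose[OF this CH_Suc_has_derivative[OF f]]]
    have "(g has_derivative (\<lambda>v. w z *\<^sub>R (\<Sum>b\<in>Basis. (- (r *\<^sub>R v) \<bullet> b) *\<^sub>R pd b f (x - r *\<^sub>R z))
        + (\<Sum>b\<in>Basis. (v \<bullet> b) *\<^sub>R pd b w z) *\<^sub>R f (x - r *\<^sub>R z))) (at z)"
      unfolding g_def .
    from pd_eqI[OF this, of b] show ?thesis
      using b by (simp add: inner_Basis if_distrib if_distribR sum.delta sum_negf cong: if_cong)
  qed
  then have "(\<integral>z. pd b w z *\<^sub>R f (x - r *\<^sub>R z) - r *\<^sub>R (w z *\<^sub>R pd b f (x - r *\<^sub>R z)) \<partial>lborel) = 0"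
    using integral_pd_eq_0[OF \<alpha> gCH, of 1 b] wv b by (simp add: g_def)
  moreover have "integrable lborel (\<lambda>z. pd b w z *\<^sub>R f (x - r *\<^sub>R z))"
    by (rule integrable_smear[OF pc pv CH_continuous[OF \<alpha> f]])
  moreover have "integrable lborel (\<lambda>z. w z *\<^sub>R pd b f (x - r *\<^sub>R z))"
    by (rule integrable_smear[OF wc wv CH_continuous[OF \<alpha> CH_Suc_pd[OF f b]]])
  ultimately have "smear (pd b w) r f x
      - (\<integral>z. r *\<^sub>R (w z *\<^sub>R pd b f (x - r *\<^sub>R z)) \<partial>lborel) = 0"
    unfolding smear_def
    by (subst Bochner_Integration.integral_diff[symmetric]) (auto intro: integrable_scaleR_right simp del: scaleR_scaleR)
  moreover have "(\<integral>z. r *\<^sub>R (w z *\<^sub>R pd b f (x - r *\<^sub>R z)) \<partial>lborel) = r *\<^sub>R smear w r (pd b f) x"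
    unfolding smear_def by (rule Bochner_Integration.integral_scaleR_right)
  ultimately show ?thesis by simp
qed

end

section \<open>Sums over dyadic scales\<close>

lemma half_powr: "(r / 2) powr a = r powr a * 2 powr - a" for r a :: real
  by (simp add: powr_divide powr_minus_divide)

text \<open>
  The potential \<open>P\<close> turns the sum over scales into a telescoping one: it jumps by at least
  \<open>d\<^sup>\<alpha>\<close> at the critical scale \<open>d\<close>, grows like \<open>r\<^sup>\<alpha>\<close> below it and saturates above it.
\<close>

lemma dyadic_interpolation_sum:
  fixes \<alpha> :: real
  assumes \<alpha>: "0 < \<alpha>" "\<alpha> < 1"
  shows "\<exists>C\<ge>0. \<forall>r0>0. \<forall>d>0. \<forall>n.
    (\<Sum>j<n. min ((r0 / 2 ^ j) powr \<alpha>) ((r0 / 2 ^ j) powr (\<alpha> - 1) * d)) \<le> C * d powr \<alpha>"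
proof -
  \<comment> \<open>\<open>c\<close> and \<open>c'\<close> invert the geometric factors between
    neighbouring scales: a step of c r^\<alpha> from r to r/2 is exactly r^\<alpha>, and likewise
    for \<open>c'\<close> and r^(\<alpha>-1).\<close>
  define c where "c = 1 / (1 - 2 powr - \<alpha>)"
  define c' where "c' = 1 / (2 powr (1 - \<alpha>) - 1)"
  have "2 powr - \<alpha> < (2::real) powr 0" using \<alpha> by (intro powr_less_mono) auto
  then have c: "c > 0" "c * (1 - 2 powr - \<alpha>) = 1" by (auto simp: c_def)
  have "(2::real) powr 0 < 2 powr (1 - \<alpha>)" using \<alpha> by (intro powr_less_mono) auto
  then have c': "c' > 0" "c' * (2 powr (1 - \<alpha>) - 1) = 1" by (auto simp: c'_def)
  \<comment> \<open>When the critical scale d is crossed, the summands \<open>c'\<close> and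
    \<open>c\<close> absorb the values of the two branches of the potential, and the 1 is the jump
    that pays for the term at this scale.\<close>
  define C where "C = c' + c + 1"
  have "(\<Sum>j<n. min ((r0 / 2 ^ j) powr \<alpha>) ((r0 / 2 ^ j) powr (\<alpha> - 1) * d)) \<le> C * d powr \<alpha>"
    if r0: "r0 > 0" and d: "d > 0" for r0 d n
  proof -
    define P where "P = (\<lambda>r. if r \<le> d then c * r powr \<alpha> else C * d powr \<alpha> - c' * d * r powr (\<alpha> - 1))"
    have split: "s powr \<alpha> = s * s powr (\<alpha> - 1)" if "s > 0" for s :: real
      using powr_add[of s 1 "\<alpha> - 1"] that by simp
    have anti: "s powr (\<alpha> - 1) \<le> t powr (\<alpha> - 1)" if "0 < t" "t \<le> s" for s t :: real
      using that \<alpha> powr_mono2'[of "\<alpha> - 1" t s] by simp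
    have small: "d * r powr (\<alpha> - 1) \<le> d powr \<alpha>" if "r \<ge> d" for r
      using anti[OF d that] d split[OF d] by simp
    have step: "min (r powr \<alpha>) (r powr (\<alpha> - 1) * d) \<le> P r - P (r / 2)" if r: "r > 0" for r
    proof -
      consider "r \<le> d" | "r > d" "r / 2 \<le> d" | "r / 2 > d" by linarith
      then show ?thesis
      proof cases
        case 1
        then have "P r - P (r / 2) = c * (r powr \<alpha> - (r / 2) powr \<alpha>)"
          using r by (simp add: P_def right_diff_distrib)
        also have "(r / 2) powr \<alpha> = r powr \<alpha> * 2 powr - \<alpha>"
          by (rule half_powr)
        also have "c * (r powr \<alpha> - r powr \<alpha> * 2 powr - \<alpha>) = c * (1 - 2 powr - \<alpha>) * r powr \<alpha>"
          by (simp add: algebra_simps)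
        finally show ?thesis using c by simp
      next
        case 2
        have "(r / 2) powr \<alpha> \<le> d powr \<alpha>" using 2 r \<alpha> by (intro powr_mono2) auto
        then have "c * (r / 2) powr \<alpha> \<le> c * d powr \<alpha>" using c by simp
        moreover have "c' * (d * r powr (\<alpha> - 1)) \<le> c' * d powr \<alpha>"
          using small[of r] 2 c' by (intro mult_left_mono) auto
        moreover have "P r - P (r / 2) = (c' + c + 1) * d powr \<alpha> - c' * (d * r powr (\<alpha> - 1)) - c * (r / 2) powr \<alpha>"
          using 2 by (simp add: P_def C_def)
        ultimately have "P r - P (r / 2) \<ge> d powr \<alpha>" by (simp add: distrib_right)
        then show ?thesis using small[of r] 2 by (simp add: mult.commute)
      next
        case 3
        then have "P r - P (r / 2) = c' * d * ((r / 2) powr (\<alpha> - 1) - r powr (\<alpha> - 1))"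
          using r by (simp add: P_def right_diff_distrib)
        also have "(r / 2) powr (\<alpha> - 1) = r powr (\<alpha> - 1) * 2 powr (1 - \<alpha>)"
          using half_powr[of r "\<alpha> - 1"] by simp
        also have "c' * d * (r powr (\<alpha> - 1) * 2 powr (1 - \<alpha>) - r powr (\<alpha> - 1))
            = c' * (2 powr (1 - \<alpha>) - 1) * (r powr (\<alpha> - 1) * d)"
          by (simp add: algebra_simps)
        finally show ?thesis using c' by simp
      qed
    qed
    have P0: "P r \<ge> 0" if "r > 0" for r
    proof (cases "r \<le> d")
      case False
      then have "c' * (d * r powr (\<alpha> - 1)) \<le> c' * d powr \<alpha>"
        using small[of r] c' by (intro mult_left_mono) auto
      also have "\<dots> \<le> C * d powr \<alpha>" using c by (intro mult_right_mono) (auto simp: C_def)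
      finally show ?thesis using False by (simp add: P_def mult.assoc)
    qed (use c in \<open>simp add: P_def\<close>)
    have P1: "P r \<le> C * d powr \<alpha>" if "r > 0" for r
    proof (cases "r \<le> d")
      case True
      have "c * r powr \<alpha> \<le> C * d powr \<alpha>"
        using True that \<alpha> c c' by (intro mult_mono powr_mono2) (auto simp: C_def)
      then show ?thesis using True by (simp add: P_def)
    next
      case False
      then show ?thesis using c' d by (simp add: P_def)
    qed
    have "(\<Sum>j<n. min ((r0 / 2 ^ j) powr \<alpha>) ((r0 / 2 ^ j) powr (\<alpha> - 1) * d))
        \<le> (\<Sum>j<n. P (r0 / 2 ^ j) - P (r0 / 2 ^ Suc j))"
    proof (rule sum_mono)
      fix j
      show "min ((r0 / 2 ^ j) powr \<alpha>) ((r0 / 2 ^ j) powr (\<alpha> - 1) * d) \<le> P (r0 / 2 ^ j) - P (r0 / 2 ^ Suc j)"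
        using step[of "r0 / 2 ^ j"] r0 by (simp add: mult.commute)
    qed
    also have "\<dots> = P r0 - P (r0 / 2 ^ n)"
      using sum_lessThan_telescope'[of "\<lambda>j. P (r0 / 2 ^ j)" n] by simp
    also have "\<dots> \<le> C * d powr \<alpha>"
      using P1[OF r0] P0[of "r0 / 2 ^ n"] r0 by simp
    finally show ?thesis .
  qed
  moreover have "C \<ge> 0" using c c' by (simp add: C_def)
  ultimately show ?thesis by blast
qed

lemma norm_suminf_le_partial:
  fixes f :: "nat \<Rightarrow> 'b::real_normed_vector"
  assumes "summable f" "\<And>n. norm (sum f {..<n}) \<le> B"
  shows "norm (suminf f) \<le> B"
  using assms(2) tendsto_norm[OF summable_LIMSEQ[OF assms(1)]] by (intro LIMSEQ_le_const2) auto

lemma dyadic_powr: "(r0 / 2 ^ j) powr a = r0 powr a * (2 powr - a) ^ j" for r0 a :: real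
proof (induction j)
  case (Suc j)
  have "(r0 / 2 ^ Suc j) powr a = (r0 / 2 ^ j) powr a * 2 powr - a"
    using half_powr[of "r0 / 2 ^ j" a] by (simp add: mult.commute)
  then show ?case by (simp add: Suc)
qed simp

lemma summable_dyadic_powr:
  fixes \<alpha> :: real
  assumes "0 < \<alpha>" "0 < r0"
  shows "summable (\<lambda>j. A * (r0 / 2 ^ j) powr \<alpha>)"
proof -
  have "2 powr - \<alpha> < (2::real) powr 0" using assms by (intro powr_less_mono) auto
  then show ?thesis
    unfolding dyadic_powr mult.assoc[symmetric] by (intro summable_mult summable_geometric) auto
qed

text \<open>For two points at distance d, the scales above d are summed with the Lipschitz bound and
  those below d with the size bound. Both geometric sums are dominated by their terms at scale d,
  which are d^\<alpha>.\<close>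

lemma dyadic_holder:
  fixes g :: "nat \<Rightarrow> 'a::real_normed_vector \<Rightarrow> 'b::banach"
  assumes \<alpha>: "0 < \<alpha>" "\<alpha> < 1" and r0: "0 < r0" and A: "A \<ge> 0"
    and bd: "\<And>j x. norm (g j x) \<le> A * (r0 / 2 ^ j) powr \<alpha>"
    and lip: "\<And>j x v. norm v \<le> r0 / 2 ^ j \<Longrightarrow>
      norm (g j (x + v) - g j x) \<le> A * (r0 / 2 ^ j) powr (\<alpha> - 1) * norm v"
  shows "\<exists>C\<ge>0. \<forall>x y. norm ((\<Sum>j. g j x) - (\<Sum>j. g j y)) \<le> C * norm (x - y) powr \<alpha>"
proof -
  obtain C where C: "C \<ge> 0" "\<forall>r0>0. \<forall>d>0. \<forall>n.
    (\<Sum>j<n. min ((r0 / 2 ^ j) powr \<alpha>) ((r0 / 2 ^ j) powr (\<alpha> - 1) * d)) \<le> C * d powr \<alpha>"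
    using dyadic_interpolation_sum[OF \<alpha>] by blast
  have sm: "summable (\<lambda>j. g j x)" for x
    by (rule summable_comparison_test'[OF summable_dyadic_powr[OF \<alpha>(1) r0, of A]]) (rule bd)
  have "norm ((\<Sum>j. g j x) - (\<Sum>j. g j y)) \<le> 2 * A * C * norm (x - y) powr \<alpha>" for x y
  proof (cases "x = y")
    case False
    define d where "d = norm (x - y)"
    have d: "d > 0" using False by (simp add: d_def)
    have tm: "norm (g j x - g j y) \<le> 2 * A * min ((r0 / 2 ^ j) powr \<alpha>) ((r0 / 2 ^ j) powr (\<alpha> - 1) * d)" for j
    proof -
      define r where "r = r0 / 2 ^ j"
      have r: "r > 0" using r0 by (simp add: r_def)
      have split: "r powr \<alpha> = r powr (\<alpha> - 1) * r"
        using powr_add[of r 1 "\<alpha> - 1"] r by simp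
      have 1: "norm (g j x - g j y) \<le> 2 * A * r powr \<alpha>"
        using norm_triangle_ineq4[of "g j x" "g j y"] bd[of j x] bd[of j y] by (simp add: r_def)
      have 2: "norm (g j x - g j y) \<le> 2 * A * (r powr (\<alpha> - 1) * d)"
      proof (cases "d \<le> r")
        case True
        then have "norm (g j x - g j y) \<le> A * r powr (\<alpha> - 1) * d"
          using lip[of "x - y" j y] by (simp add: d_def r_def)
        also have "\<dots> \<le> 2 * A * (r powr (\<alpha> - 1) * d)"
          using A d by (simp add: mult.assoc)
        finally show ?thesis .
      next
        case False
        \<comment> \<open>The increment exceeds the scale, so \<open>lip\<close> does not apply, but
          here the size bound is already the smaller of the two.\<close>
        then have "r powr \<alpha> \<le> r powr (\<alpha> - 1) * d"
          unfolding split by (intro mult_left_mono) auto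
        then have "2 * A * r powr \<alpha> \<le> 2 * A * (r powr (\<alpha> - 1) * d)"
          using A by (intro mult_left_mono) auto
        with 1 show ?thesis by linarith
      qed
      from 1 2 show ?thesis by (simp add: min_def r_def)
    qed
    have "norm (\<Sum>j. g j x - g j y) \<le> 2 * A * (C * d powr \<alpha>)"
    proof (rule norm_suminf_le_partial)
      show "summable (\<lambda>j. g j x - g j y)" by (intro summable_diff sm)
      fix n
      have "norm (\<Sum>j<n. g j x - g j y)
          \<le> (\<Sum>j<n. 2 * A * min ((r0 / 2 ^ j) powr \<alpha>) ((r0 / 2 ^ j) powr (\<alpha> - 1) * d))"
        by (rule sum_norm_le) (rule tm)
      also have "\<dots> = 2 * A * (\<Sum>j<n. min ((r0 / 2 ^ j) powr \<alpha>) ((r0 / 2 ^ j) powr (\<alpha> - 1) * d))"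
        by (simp add: sum_distrib_left)
      also have "\<dots> \<le> 2 * A * (C * d powr \<alpha>)"
        using C(2) r0 d A by (intro mult_left_mono) auto
      finally show "norm (\<Sum>j<n. g j x - g j y) \<le> 2 * A * (C * d powr \<alpha>)" .
    qed
    then show ?thesis by (simp add: suminf_diff[OF sm sm] d_def mult.assoc)
  qed simp
  then show ?thesis using A C(1) by (intro exI[of _ "2 * A * C"]) auto
qed

text \<open>The tails of the differentiated series are bounded by those of \<open>B\<close>,
  uniformly in x, which is the uniform convergence that termwise differentiation asks for.\<close>

lemma series_has_derivative:
  fixes g :: "nat \<Rightarrow> 'a::euclidean_space \<Rightarrow> 'b::banach"
  assumes d: "\<And>j x. (g j has_derivative (\<lambda>v. \<Sum>b\<in>Basis. (v \<bullet> b) *\<^sub>R G b j x)) (at x)"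
    and bd: "\<And>b j x. b \<in> Basis \<Longrightarrow> norm (G b j x) \<le> B j" and B: "summable B"
    and sm: "\<And>x. summable (\<lambda>j. g j x)"
  shows "((\<lambda>x. \<Sum>j. g j x) has_derivative (\<lambda>v. \<Sum>b\<in>Basis. (v \<bullet> b) *\<^sub>R (\<Sum>j. G b j x))) (at x)"
proof -
  have smG: "summable (\<lambda>j. G b j x)" if "b \<in> Basis" for b x
    by (rule summable_comparison_test'[OF B]) (rule bd[OF that])
  have tail: "norm ((\<Sum>j<n. G b j x) - (\<Sum>j. G b j x)) \<le> suminf B - sum B {..<n}" if "b \<in> Basis" for b n x
  proof -
    have smt: "summable (\<lambda>j. G b (j + n) x)" "summable (\<lambda>j. B (j + n))"
      by (rule summable_ignore_initial_segment[OF smG[OF that]] summable_ignore_initial_segment[OF B])+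
    have "norm ((\<Sum>j<n. G b j x) - (\<Sum>j. G b j x)) = norm (\<Sum>j. G b (j + n) x)"
      using suminf_minus_initial_segment[OF smG[OF that], of n] by (simp add: norm_minus_commute)
    also have "\<dots> \<le> (\<Sum>j. B (j + n))"
      by (rule norm_suminf_le[OF bd[OF that] smt(2)])
    also have "\<dots> = suminf B - sum B {..<n}"
      by (rule suminf_minus_initial_segment[OF B])
    finally show ?thesis .
  qed
  have lim: "(\<lambda>n. suminf B - sum B {..<n}) \<longlonglongrightarrow> 0"
    using tendsto_diff[OF tendsto_const[of "suminf B"] summable_LIMSEQ[OF B]] by simp
  have unif: "\<forall>\<^sub>F n in sequentially. \<forall>x\<in>UNIV. \<forall>h. norm ((\<Sum>j<n. \<Sum>b\<in>Basis. (h \<bullet> b) *\<^sub>R G b j x)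
      - (\<Sum>b\<in>Basis. (h \<bullet> b) *\<^sub>R (\<Sum>j. G b j x))) \<le> e * norm h" if e: "e > 0" for e
  proof -
    have "e / DIM('a) > 0" using e by simp
    from order_tendstoD(2)[OF lim this]
    show ?thesis
    proof eventually_elim
      case (elim n)
      show ?case
      proof (intro ballI allI)
        fix x h :: 'a
        have eq: "(\<Sum>j<n. \<Sum>b\<in>Basis. (h \<bullet> b) *\<^sub>R G b j x) - (\<Sum>b\<in>Basis. (h \<bullet> b) *\<^sub>R (\<Sum>j. G b j x))
          = (\<Sum>b\<in>Basis. (h \<bullet> b) *\<^sub>R ((\<Sum>j<n. G b j x) - (\<Sum>j. G b j x)))"
          by (subst sum.swap) (simp add: scaleR_sum_right scaleR_diff_right sum_subtractf)
        have "norm ((\<Sum>j<n. \<Sum>b\<in>Basis. (h \<bullet> b) *\<^sub>R G b j x) - (\<Sum>b\<in>Basis. (h \<bullet> b) *\<^sub>R (\<Sum>j. G b j x)))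
          \<le> (\<Sum>b\<in>Basis. norm ((\<Sum>j<n. G b j x) - (\<Sum>j. G b j x))) * norm h"
          unfolding eq by (rule norm_sum_Basis_le)
        also have "\<dots> \<le> (\<Sum>b\<in>(Basis::'a set). e / DIM('a)) * norm h"
          by (intro mult_right_mono sum_mono order_trans[OF tail less_imp_le[OF elim]]) auto
        also have "\<dots> = e * norm h" by simp
        finally show "norm ((\<Sum>j<n. \<Sum>b\<in>Basis. (h \<bullet> b) *\<^sub>R G b j x) - (\<Sum>b\<in>Basis. (h \<bullet> b) *\<^sub>R (\<Sum>j. G b j x))) \<le> e * norm h" .
      qed
    qed
  qed
  have "\<exists>G'. \<forall>x\<in>UNIV. (\<lambda>j. g j x) sums G' x \<and>
      (G' has_derivative (\<lambda>v. \<Sum>b\<in>Basis. (v \<bullet> b) *\<^sub>R (\<Sum>j. G b j x))) (at x within UNIV)"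
    by (rule has_derivative_series[OF convex_UNIV _ unif _ summable_sums[OF sm]]) (auto intro: d)
  then obtain G' where G': "\<And>x. (\<lambda>j. g j x) sums G' x"
    "\<And>x. (G' has_derivative (\<lambda>v. \<Sum>b\<in>Basis. (v \<bullet> b) *\<^sub>R (\<Sum>j. G b j x))) (at x)" by auto
  have "G' = (\<lambda>x. \<Sum>j. g j x)" using G'(1) sums_unique by blast
  with G'(2) show ?thesis by simp
qed

text \<open>With kernel \<psi> and \<open>p = 2\<close> this is the local Newton potential. Each
  derivative replaces the kernel by its partial derivative and lowers \<open>p\<close> by one, so
  \<open>p = 1\<close> is the gradient and \<open>p = 0\<close> the Hessian, where no decay in the
  scale is left.\<close>

definition dyadic_sum ::
    "nat \<Rightarrow> ('a::euclidean_space \<Rightarrow> real) \<Rightarrow> real \<Rightarrow> ('a \<Rightarrow> 'b::euclidean_space) \<Rightarrow> 'a \<Rightarrow> 'b" where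
  "dyadic_sum p w r0 f x = (\<Sum>j. (r0 / 2 ^ j) ^ p *\<^sub>R smear w (r0 / 2 ^ j) f x)"

lemma smear_diff:
  fixes f g :: "'a::euclidean_space \<Rightarrow> 'b::euclidean_space"
  assumes w: "bump_kernel \<alpha> w K" and \<alpha>: "0 < \<alpha>" "\<alpha> \<le> 1" and "continuous_on UNIV f" "continuous_on UNIV g"
  shows "smear w r (\<lambda>y. f y - g y) x = smear w r f x - smear w r g x"
proof -
  have I: "integrable lborel (\<lambda>z. w z *\<^sub>R h (x - r *\<^sub>R z))" if "continuous_on UNIV h" for h :: "'a \<Rightarrow> 'b"
    by (rule integrable_smear[OF bump_kernel_continuous[OF \<alpha> w] bump_kernel_vanish[OF w] that])
  show ?thesis
    using Bochner_Integration.integral_diff[OF I[OF assms(4)] I[OF assms(5)]]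
    by (simp add: smear_def scaleR_diff_right)
qed

lemma sum_Basis_inner:
  "c \<in> Basis \<Longrightarrow> (\<Sum>b\<in>Basis. (c \<bullet> b) *\<^sub>R X b) = (X (c::'a::euclidean_space) :: 'b::real_vector)"
  by (simp add: inner_Basis if_distrib if_distribR sum.delta cong: if_cong)

text \<open>The shift moves the roles around: measured in units of r, the support of
  \<open>f\<close> is a ball of radius \<sigma>/r, and only its volume counts. For data on a ball
  much smaller than r this beats the bound by the integral of |w|.\<close>

lemma smear_small:
  fixes f :: "'a::euclidean_space \<Rightarrow> 'b::euclidean_space"
  assumes w: "continuous_on UNIV w" "\<And>z. \<bar>w z\<bar> \<le> S"
    and f: "continuous_on UNIV f" "\<And>x. norm (f x) \<le> M" "\<And>x. norm x > \<sigma> \<Longrightarrow> f x = 0" and r: "r > 0"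
  shows "norm (smear w r f x) \<le> S * M * measure lborel (cball 0 (\<sigma> / r) :: 'a set)"
proof -
  have "smear w r f (0 + x) = (\<integral>z. w (z + (1 / r) *\<^sub>R x) *\<^sub>R f (0 - r *\<^sub>R z) \<partial>lborel)"
    by (rule smear_shift[OF w(1) f(1) r])
  also have "norm \<dots> \<le> S * M * measure lborel (cball 0 (\<sigma> / r) :: 'a set)"
  proof (rule norm_integral_le_on_cball)
    show "continuous_on UNIV (\<lambda>z. w (z + (1 / r) *\<^sub>R x) *\<^sub>R f (0 - r *\<^sub>R z))"
      by (rule continuous_on_scaleR[OF continuous_on_shift_arg[OF w(1)] continuous_on_affine_arg[OF f(1)]])
    show "w (z + (1 / r) *\<^sub>R x) *\<^sub>R f (0 - r *\<^sub>R z) = 0" if "norm z > \<sigma> / r" for z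
      using f(3)[of "0 - r *\<^sub>R z"] that r by (simp add: pos_divide_less_eq mult.commute)
    have "S \<ge> 0" using order_trans[OF abs_ge_zero w(2)] .
    then show "norm (w (z + (1 / r) *\<^sub>R x) *\<^sub>R f (0 - r *\<^sub>R z)) \<le> S * M" for z
      using w(2) f(2) by (auto intro!: mult_mono)
  qed
  finally show ?thesis by simp
qed

section \<open>Estimates and derivatives of the dyadic sums\<close>

context
  fixes \<alpha> r0 :: real
  assumes \<alpha>: "0 < \<alpha>" "\<alpha> < 1" and r0: "0 < r0" "r0 \<le> 1"
begin

private lemma \<alpha>1: "\<alpha> \<le> 1" using \<alpha> by simp

lemma scale_pos: "0 < r0 / 2 ^ j" and scale_le1: "r0 / 2 ^ j \<le> 1"
proof -
  have "r0 / 2 ^ j \<le> r0 / 1" using r0 by (intro divide_left_mono) auto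
  then show "r0 / 2 ^ j \<le> 1" by (rule order_trans) (use r0 in simp)
qed (use r0 in simp)

text \<open>Subtracting f(x) under the integral leaves the oscillation of \<open>f\<close> at
  distance r. For kernels of mean 0 this is decay in r, for kernels of mean 1 the rate of
  convergence to \<open>f\<close>.\<close>

lemma smear_zero_mean:
  fixes f :: "'a::euclidean_space \<Rightarrow> 'b::euclidean_space"
  assumes w: "bump_kernel \<alpha> w K" and f: "continuous_on UNIV f" and r: "r > 0"
    and h: "\<And>x y. norm (f x - f y) \<le> C * norm (x - y) powr \<alpha>" "C \<ge> 0"
  shows "norm (smear w r f x - (\<integral>z. w z \<partial>lborel) *\<^sub>R f x) \<le> K * (C * r powr \<alpha>)"
proof -
  have "smear w r f x - (\<integral>z. w z \<partial>lborel) *\<^sub>R f x = smear w r (\<lambda>y. f y - f x) x"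
    using smear_diff_const[where \<rho> = 1, OF bump_kernel_continuous[OF \<alpha>(1) \<alpha>1 w] bump_kernel_vanish[OF w] f]
    by (simp add: smear_def)
  also have "norm \<dots> \<le> K * (C * r powr \<alpha>)"
  proof (rule smear_bound[OF \<alpha>(1) \<alpha>1 w])
    show "continuous_on UNIV (\<lambda>y. f y - f x)" by (intro continuous_intros f)
    fix z :: 'a assume "norm z \<le> 1"
    then have "norm (x - r *\<^sub>R z - x) powr \<alpha> \<le> r powr \<alpha>"
      using r \<alpha> by (intro powr_mono2) auto
    then show "norm (f (x - r *\<^sub>R z) - f x) \<le> C * r powr \<alpha>"
      using h(1)[of "x - r *\<^sub>R z" x] mult_left_mono[OF _ h(2)] order_trans by blast
  qed
  finally show ?thesis .
qed

lemma dyadic_term_bound: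
  fixes f :: "'a::euclidean_space \<Rightarrow> 'b::euclidean_space"
  assumes w: "bump_kernel \<alpha> w K" and f: "continuous_on UNIV f" and M: "\<And>x. norm (f x) \<le> M"
    and p: "p \<ge> 1"
  shows "norm ((r0 / 2 ^ j) ^ p *\<^sub>R smear w (r0 / 2 ^ j) f x) \<le> r0 * (K * M) * (1/2) ^ j"
proof -
  \<comment> \<open>The scales are at most 1, so the first power dominates every
    \<open>p \<ge> 1\<close>.\<close>
  have "(r0 / 2 ^ j) ^ p \<le> (r0 / 2 ^ j) ^ 1"
    using scale_pos[of j] scale_le1[of j] p by (intro power_decreasing) auto
  moreover have "norm (smear w (r0 / 2 ^ j) f x) \<le> K * M"
    by (rule smear_bound[OF \<alpha>(1) \<alpha>1 w f]) (rule M)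
  ultimately have "(r0 / 2 ^ j) ^ p * norm (smear w (r0 / 2 ^ j) f x) \<le> (r0 / 2 ^ j) * (K * M)"
    using scale_pos[of j] by (intro mult_mono) auto
  moreover have "norm ((r0 / 2 ^ j) ^ p *\<^sub>R smear w (r0 / 2 ^ j) f x)
      = (r0 / 2 ^ j) ^ p * norm (smear w (r0 / 2 ^ j) f x)"
    using zero_le_power[OF less_imp_le[OF scale_pos[of j]], of p] by (simp only: norm_scaleR abs_of_nonneg)
  moreover have "(r0 / 2 ^ j) * (K * M) = r0 * (K * M) * (1/2) ^ j"
    by (simp add: power_divide)
  ultimately show ?thesis by (simp only:)
qed

lemma summable_halves: "summable (\<lambda>j. A * (1/2::real) ^ j)"
  by (intro summable_mult summable_geometric) auto

lemma summable_dyadic_term: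
  fixes f :: "'a::euclidean_space \<Rightarrow> 'b::euclidean_space"
  assumes "bump_kernel \<alpha> w K" "continuous_on UNIV f" "\<And>x. norm (f x) \<le> M" "p \<ge> 1"
  shows "summable (\<lambda>j. (r0 / 2 ^ j) ^ p *\<^sub>R smear w (r0 / 2 ^ j) f x)"
  by (rule summable_comparison_test'[OF summable_halves]) (rule dyadic_term_bound[OF assms])

text \<open>A geometric series of ratio 1/2 starting at \<open>r0\<close>. The factor
  \<open>r0\<close> is the source of all smallness of the gradient of the potential relative to sup
  |f|.\<close>

lemma dyadic_sum_bound:
  fixes f :: "'a::euclidean_space \<Rightarrow> 'b::euclidean_space"
  assumes "bump_kernel \<alpha> w K" "continuous_on UNIV f" "\<And>x. norm (f x) \<le> M" "p \<ge> 1"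
  shows "norm (dyadic_sum p w r0 f x) \<le> 2 * r0 * K * M"
proof -
  have "norm (dyadic_sum p w r0 f x) \<le> (\<Sum>j. r0 * (K * M) * (1/2) ^ j)"
    unfolding dyadic_sum_def by (rule norm_suminf_le[OF dyadic_term_bound[OF assms] summable_halves])
  also have "\<dots> = 2 * r0 * K * M"
    by (subst suminf_mult) (auto simp: suminf_geometric)
  finally show ?thesis .
qed

lemma dyadic_sum_diff:
  fixes f g :: "'a::euclidean_space \<Rightarrow> 'b::euclidean_space"
  assumes "bump_kernel \<alpha> w K" "continuous_on UNIV f" "\<And>x. norm (f x) \<le> M" "p \<ge> 1"
    and "continuous_on UNIV g" "\<And>x. norm (g x) \<le> M'"
  shows "dyadic_sum p w r0 (\<lambda>y. f y - g y) x = dyadic_sum p w r0 f x - dyadic_sum p w r0 g x"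
  unfolding dyadic_sum_def
  by (subst suminf_diff[OF summable_dyadic_term[OF assms(1-4)] summable_dyadic_term[OF assms(1,5,6,4)]])
    (simp add: smear_diff[OF assms(1) \<alpha>(1) \<alpha>1 assms(2,5)] scaleR_diff_right)

text \<open>For bounded \<open>f\<close> the terms have size O(r) and a Lipschitz constant O(1) on
  increments up to r. Since r <= 1 and 0 < \<alpha> < 1, these are at most O(r^\<alpha>) and
  O(r^(\<alpha>-1)). It makes the gradient of the potential Hoelder although \<open>f\<close> is
  only continuous and bounded.\<close>

lemma dyadic_sum_1_holder:
  fixes f :: "'a::euclidean_space \<Rightarrow> 'b::euclidean_space"
  assumes w: "bump_kernel \<alpha> w K" and f: "continuous_on UNIV f" and M: "\<And>x. norm (f x) \<le> M"
  shows "\<exists>C\<ge>0. \<forall>x y. norm (dyadic_sum 1 w r0 f x - dyadic_sum 1 w r0 f y) \<le> C * norm (x - y) powr \<alpha>"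
  unfolding dyadic_sum_def
proof (rule dyadic_holder[OF \<alpha> r0(1)])
  define V where "V = measure lborel (cball 0 2 :: 'a set)"
  have nn: "V \<ge> 0" "K \<ge> 0" "M \<ge> 0"
    using bump_kernel_nonneg[OF w] order_trans[OF norm_ge_zero M] by (auto simp: V_def)
  show "K * M * (1 + V) \<ge> 0" using nn by simp
  fix j x
  define r where "r = r0 / 2 ^ j"
  have r: "0 < r" "r \<le> 1" using scale_pos scale_le1 by (auto simp: r_def)
  have "norm (smear w r f x) \<le> K * M"
    by (rule smear_bound[OF \<alpha>(1) \<alpha>1 w f]) (rule M)
  then have "r * norm (smear w r f x) \<le> r * (K * M)" using r by (intro mult_left_mono) auto
  also have "\<dots> \<le> r powr \<alpha> * (K * M)"
    using powr_mono'[of \<alpha> 1 r] \<alpha> r nn by (intro mult_right_mono) auto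
  also have "\<dots> \<le> r powr \<alpha> * (K * M * (1 + V))"
    using nn by (intro mult_left_mono) (auto simp: algebra_simps)
  finally show "norm ((r0 / 2 ^ j) ^ 1 *\<^sub>R smear w (r0 / 2 ^ j) f x) \<le> K * M * (1 + V) * (r0 / 2 ^ j) powr \<alpha>"
    using r by (simp add: r_def[symmetric] mult.commute)
  fix v :: 'a assume "norm v \<le> r0 / 2 ^ j"
  then have v: "norm v \<le> r" by (simp add: r_def)
  have "norm (smear w r f (x + v) - smear w r f x) \<le> K * V * M * (norm v / r)"
    unfolding V_def by (rule smear_lipschitz[OF \<alpha>(1) \<alpha>1 w f r(1) v, where c = 0]) (simp add: M)
  then have "r * norm (smear w r f (x + v) - smear w r f x) \<le> r * (K * V * M * (norm v / r))"
    using r by (intro mult_left_mono) auto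
  also have "\<dots> = (K * M * V) * 1 * norm v" using r by simp
  also have "\<dots> \<le> K * M * (1 + V) * r powr (\<alpha> - 1) * norm v"
    using powr_mono2'[of "\<alpha> - 1" r 1] r \<alpha> nn
    by (intro mult_right_mono mult_mono) (auto simp: algebra_simps)
  finally show "norm ((r0 / 2 ^ j) ^ 1 *\<^sub>R smear w (r0 / 2 ^ j) f (x + v) - (r0 / 2 ^ j) ^ 1 *\<^sub>R smear w (r0 / 2 ^ j) f x)
      \<le> K * M * (1 + V) * (r0 / 2 ^ j) powr (\<alpha> - 1) * norm v"
    using r by (simp add: r_def[symmetric] flip: scaleR_diff_right)
qed

text \<open>The Schauder estimate for second derivatives. No power of the scale is left, and the
  decay r^\<alpha> comes from the vanishing mean of the kernel together with the Hoelder bound of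
  \<open>f\<close>. The factor \<open>2 powr \<alpha>\<close> reflects the shifted kernel, which
  reaches distance 2r.\<close>

lemma dyadic_sum_0_holder:
  fixes f :: "'a::euclidean_space \<Rightarrow> 'b::euclidean_space"
  assumes w: "bump_kernel \<alpha> w K" and f: "continuous_on UNIV f" and w0: "(\<integral>z. w z \<partial>lborel) = 0"
    and h: "\<And>x y. norm (f x - f y) \<le> C * norm (x - y) powr \<alpha>" "C \<ge> 0"
  shows "\<exists>C\<ge>0. \<forall>x y. norm (dyadic_sum 0 w r0 f x - dyadic_sum 0 w r0 f y) \<le> C * norm (x - y) powr \<alpha>"
  unfolding dyadic_sum_def
proof (rule dyadic_holder[OF \<alpha> r0(1)])
  define V where "V = measure lborel (cball 0 2 :: 'a set)"
  have nn: "V \<ge> 0" "K \<ge> 0"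
    using bump_kernel_nonneg[OF w] by (auto simp: V_def)
  show "K * C * (1 + V * 2 powr \<alpha>) \<ge> 0" using nn h(2) by simp
  fix j x
  define r where "r = r0 / 2 ^ j"
  have r: "0 < r" "r \<le> 1" using scale_pos scale_le1 by (auto simp: r_def)
  have "norm (smear w r f x) \<le> K * (C * r powr \<alpha>)"
    using smear_zero_mean[OF w f r(1) h, of x] w0 by simp
  also have "\<dots> = K * C * 1 * r powr \<alpha>" by simp
  also have "\<dots> \<le> K * C * (1 + V * 2 powr \<alpha>) * r powr \<alpha>"
    using nn h(2) by (intro mult_right_mono mult_left_mono) auto
  finally show "norm ((r0 / 2 ^ j) ^ 0 *\<^sub>R smear w (r0 / 2 ^ j) f x)
      \<le> K * C * (1 + V * 2 powr \<alpha>) * (r0 / 2 ^ j) powr \<alpha>"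
    by (simp add: r_def)
  fix v :: 'a assume "norm v \<le> r0 / 2 ^ j"
  then have v: "norm v \<le> r" by (simp add: r_def)
  have "norm (smear w r f (x + v) - smear w r f x) \<le> K * V * (C * (2 * r) powr \<alpha>) * (norm v / r)"
    unfolding V_def
  proof (rule smear_lipschitz[OF \<alpha>(1) \<alpha>1 w f r(1) v, where c = "f x"])
    fix z :: 'a assume "norm z \<le> 2"
    then have "norm (x - r *\<^sub>R z - x) powr \<alpha> \<le> (2 * r) powr \<alpha>"
      using r \<alpha> by (intro powr_mono2) (auto simp: mult.commute)
    then show "norm (f (x - r *\<^sub>R z) - f x) \<le> C * (2 * r) powr \<alpha>"
      using h(1)[of "x - r *\<^sub>R z" x] mult_left_mono[OF _ h(2)] order_trans by blast
  qed
  also have "\<dots> = K * C * (V * 2 powr \<alpha>) * r powr (\<alpha> - 1) * norm v"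
    using r by (simp add: powr_mult powr_diff)
  also have "\<dots> \<le> K * C * (1 + V * 2 powr \<alpha>) * r powr (\<alpha> - 1) * norm v"
    using nn h(2) by (intro mult_right_mono mult_left_mono) auto
  finally show "norm ((r0 / 2 ^ j) ^ 0 *\<^sub>R smear w (r0 / 2 ^ j) f (x + v) - (r0 / 2 ^ j) ^ 0 *\<^sub>R smear w (r0 / 2 ^ j) f x)
      \<le> K * C * (1 + V * 2 powr \<alpha>) * (r0 / 2 ^ j) powr (\<alpha> - 1) * norm v"
    by (simp add: r_def)
qed

lemma bump_kernel_pd:
  assumes "bump_kernel \<alpha> w K" "b \<in> Basis"
  shows "\<exists>K'. bump_kernel \<alpha> (pd b w) K'"
  by (rule bump_kernelI[OF \<alpha>(1) \<alpha>1 CH_Suc_pd[OF bump_kernel_CH[OF assms(1)] assms(2)]])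
    (rule pd_vanish[of 1 w, OF bump_kernel_vanish[OF assms(1)]])

lemma bump_kernel_uniform:
  assumes "finite I" "\<And>i. i \<in> I \<Longrightarrow> \<exists>K. bump_kernel \<alpha> (w i) K"
  shows "\<exists>K\<ge>0. \<forall>i\<in>I. bump_kernel \<alpha> (w i) K"
proof -
  obtain K where K: "\<And>i. i \<in> I \<Longrightarrow> bump_kernel \<alpha> (w i) (K i)" using assms(2) by metis
  have "bump_kernel \<alpha> (w i) (sum K I)" if "i \<in> I" for i
  proof (rule bump_kernel_mono[OF K[OF that]])
    show "K i \<le> sum K I"
      by (rule member_le_sum[OF that _ assms(1)]) (rule bump_kernel_nonneg[OF K], simp)
  qed
  moreover have "sum K I \<ge> 0" by (rule sum_nonneg) (rule bump_kernel_nonneg[OF K])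
  ultimately show ?thesis by blast
qed

lemma dyadic_sum_2_has_derivative:
  fixes f :: "'a::euclidean_space \<Rightarrow> 'b::euclidean_space"
  assumes w: "bump_kernel \<alpha> w K" and f: "continuous_on UNIV f" and M: "\<And>x. norm (f x) \<le> M"
  shows "(dyadic_sum 2 w r0 f has_derivative
    (\<lambda>v. \<Sum>b\<in>Basis. (v \<bullet> b) *\<^sub>R dyadic_sum 1 (pd b w) r0 f x)) (at x)"
proof -
  obtain K' where K': "\<And>b. b \<in> Basis \<Longrightarrow> bump_kernel \<alpha> (pd b w) K'"
    using bump_kernel_uniform[OF finite_Basis, of "\<lambda>b. pd b w"] bump_kernel_pd[OF w] by blast
  show ?thesis unfolding dyadic_sum_def
  proof (rule series_has_derivative)
    fix j x
    define r where "r = r0 / 2 ^ j"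
    have r: "r > 0" using scale_pos by (simp add: r_def)
    have "((\<lambda>x. r ^ 2 *\<^sub>R smear w r f x) has_derivative
        (\<lambda>v. r ^ 2 *\<^sub>R (\<Sum>b\<in>Basis. (v \<bullet> b) *\<^sub>R ((1 / r) *\<^sub>R smear (pd b w) r f x)))) (at x)"
      by (intro has_derivative_scaleR_right smear_has_derivative[OF \<alpha>(1) \<alpha>1 w f r M])
    moreover have "r ^ 2 *\<^sub>R (\<Sum>b\<in>Basis. (v \<bullet> b) *\<^sub>R ((1 / r) *\<^sub>R smear (pd b w) r f x))
        = (\<Sum>b\<in>Basis. (v \<bullet> b) *\<^sub>R (r ^ 1 *\<^sub>R smear (pd b w) r f x))" for v
      using r by (simp add: scaleR_sum_right power2_eq_square mult_ac)
    ultimately show "((\<lambda>x. (r0 / 2 ^ j) ^ 2 *\<^sub>R smear w (r0 / 2 ^ j) f x) has_derivative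
        (\<lambda>v. \<Sum>b\<in>Basis. (v \<bullet> b) *\<^sub>R ((r0 / 2 ^ j) ^ 1 *\<^sub>R smear (pd b w) (r0 / 2 ^ j) f x))) (at x)"
      by (simp add: r_def)
  next
    show "norm ((r0 / 2 ^ j) ^ 1 *\<^sub>R smear (pd b w) (r0 / 2 ^ j) f x) \<le> r0 * (K' * M) * (1/2) ^ j"
      if "b \<in> Basis" for b j x
      by (rule dyadic_term_bound[OF K'[OF that] f M]) simp
  next
    show "summable (\<lambda>j. (r0 / 2 ^ j) ^ 2 *\<^sub>R smear w (r0 / 2 ^ j) f x)" for x
      by (rule summable_dyadic_term[OF w f M]) simp
  qed (rule summable_halves)
qed

text \<open>The differentiated terms carry no power of the scale; their series converges because
  partial derivatives of the kernel have mean 0 and \<open>f\<close> is Hoelder.\<close>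

lemma dyadic_sum_1_has_derivative:
  fixes f :: "'a::euclidean_space \<Rightarrow> 'b::euclidean_space"
  assumes w: "bump_kernel \<alpha> w K" and f: "continuous_on UNIV f" and M: "\<And>x. norm (f x) \<le> M"
    and h: "\<And>x y. norm (f x - f y) \<le> C * norm (x - y) powr \<alpha>" "C \<ge> 0"
  shows "(dyadic_sum 1 w r0 f has_derivative
    (\<lambda>v. \<Sum>b\<in>Basis. (v \<bullet> b) *\<^sub>R dyadic_sum 0 (pd b w) r0 f x)) (at x)"
proof -
  obtain K' where K': "\<And>b. b \<in> Basis \<Longrightarrow> bump_kernel \<alpha> (pd b w) K'"
    using bump_kernel_uniform[OF finite_Basis, of "\<lambda>b. pd b w"] bump_kernel_pd[OF w] by blast
  have w0: "(\<integral>z. pd b w z \<partial>lborel) = 0" if "b \<in> Basis" for b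
    by (rule integral_pd_eq_0[OF \<alpha>(1) \<alpha>1 bump_kernel_CH[OF w] bump_kernel_vanish[OF w] that])
  show ?thesis unfolding dyadic_sum_def
  proof (rule series_has_derivative)
    fix j x
    define r where "r = r0 / 2 ^ j"
    have r: "r > 0" using scale_pos by (simp add: r_def)
    have "((\<lambda>x. r ^ 1 *\<^sub>R smear w r f x) has_derivative
        (\<lambda>v. r ^ 1 *\<^sub>R (\<Sum>b\<in>Basis. (v \<bullet> b) *\<^sub>R ((1 / r) *\<^sub>R smear (pd b w) r f x)))) (at x)"
      by (intro has_derivative_scaleR_right smear_has_derivative[OF \<alpha>(1) \<alpha>1 w f r M])
    moreover have "r ^ 1 *\<^sub>R (\<Sum>b\<in>Basis. (v \<bullet> b) *\<^sub>R ((1 / r) *\<^sub>R smear (pd b w) r f x))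
        = (\<Sum>b\<in>Basis. (v \<bullet> b) *\<^sub>R (r ^ 0 *\<^sub>R smear (pd b w) r f x))" for v
      using r by (simp add: scaleR_sum_right mult_ac)
    ultimately show "((\<lambda>x. (r0 / 2 ^ j) ^ 1 *\<^sub>R smear w (r0 / 2 ^ j) f x) has_derivative
        (\<lambda>v. \<Sum>b\<in>Basis. (v \<bullet> b) *\<^sub>R ((r0 / 2 ^ j) ^ 0 *\<^sub>R smear (pd b w) (r0 / 2 ^ j) f x))) (at x)"
      by (simp add: r_def)
  next
    show "norm ((r0 / 2 ^ j) ^ 0 *\<^sub>R smear (pd b w) (r0 / 2 ^ j) f x) \<le> K' * C * (r0 / 2 ^ j) powr \<alpha>"
      if "b \<in> Basis" for b j x
      using smear_zero_mean[OF K'[OF that] f scale_pos h, of j x] w0[OF that] by simp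
  next
    show "summable (\<lambda>j. (r0 / 2 ^ j) ^ 1 *\<^sub>R smear w (r0 / 2 ^ j) f x)" for x
      by (rule summable_dyadic_term[OF w f M]) simp
  qed (rule summable_dyadic_powr[OF \<alpha>(1) r0(1)])
qed

section \<open>The Laplacian and the regularity of the potential\<close>

lemma holder_CH_0:
  assumes "\<exists>C\<ge>0. \<forall>x y. norm (f x - f y) \<le> C * norm (x - y) powr \<alpha>"
  shows "CH \<alpha> 0 f"
  using assms unfolding CH_0 by (intro locally_holderI) (auto simp: dist_norm)

lemma smear_CH_0:
  fixes f :: "'a::euclidean_space \<Rightarrow> 'b::euclidean_space"
  assumes w: "bump_kernel \<alpha> w K" and f: "continuous_on UNIV f" and M: "\<And>x. norm (f x) \<le> M" and r: "r > 0"
  shows "CH \<alpha> 0 (smear w r f)"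
  unfolding CH_0
proof (rule locally_lipschitz_imp_locally_holder)
  define V where "V = measure lborel (cball 0 2 :: 'a set)"
  have nn: "K \<ge> 0" "M \<ge> 0" "V \<ge> 0"
    using bump_kernel_nonneg[OF w] order_trans[OF norm_ge_zero M] by (auto simp: V_def)
  have "norm (smear w r f y - smear w r f x) \<le> (K * V * M + 2 * (K * M)) / r * norm (y - x)" for x y
  proof (cases "norm (y - x) \<le> r")
    case True
    have "norm (smear w r f (x + (y - x)) - smear w r f x) \<le> K * V * M * (norm (y - x) / r)"
      unfolding V_def
      by (rule smear_lipschitz[OF \<alpha>(1) \<alpha>1 w f r True, where c = 0]) (simp add: M)
    also have "\<dots> \<le> (K * V * M + 2 * (K * M)) * (norm (y - x) / r)"
      using nn r by (intro mult_right_mono) auto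
    finally show ?thesis by simp
  next
    case False
    have "norm (smear w r f z) \<le> K * M" for z by (rule smear_bound[OF \<alpha>(1) \<alpha>1 w f]) (rule M)
    from this[of x] this[of y] have "norm (smear w r f y - smear w r f x) \<le> 2 * (K * M) * 1"
      using norm_triangle_ineq4[of "smear w r f y" "smear w r f x"] by linarith
    also have "\<dots> \<le> (K * V * M + 2 * (K * M)) * (norm (y - x) / r)"
      using nn r False by (intro mult_mono) auto
    finally show ?thesis by simp
  qed
  then show "\<exists>L. \<forall>x\<in>cball 0 \<rho>. \<forall>y\<in>cball 0 \<rho>. dist (smear w r f x) (smear w r f y) \<le> L * dist x y" for \<rho>
    unfolding dist_norm by blast
qed (use \<alpha> in auto)

lemma smear_CH_1:
  fixes f :: "'a::euclidean_space \<Rightarrow> 'b::euclidean_space"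
  assumes w: "bump_kernel \<alpha> w K" and f: "continuous_on UNIV f" and M: "\<And>x. norm (f x) \<le> M" and r: "r > 0"
  shows "CH \<alpha> (Suc 0) (smear w r f)"
proof (rule CH_SucI)
  show "(smear w r f has_derivative (\<lambda>v. \<Sum>b\<in>Basis. (v \<bullet> b) *\<^sub>R ((1 / r) *\<^sub>R smear (pd b w) r f x))) (at x)" for x
    by (rule smear_has_derivative[OF \<alpha>(1) \<alpha>1 w f r M])
  fix c :: 'a assume c: "c \<in> Basis"
  obtain K' where K': "bump_kernel \<alpha> (pd c w) K'" using bump_kernel_pd[OF w c] by blast
  show "CH \<alpha> 0 (\<lambda>x. \<Sum>b\<in>Basis. (c \<bullet> b) *\<^sub>R ((1 / r) *\<^sub>R smear (pd b w) r f x))"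
    unfolding sum_Basis_inner[OF c]
    by (rule CH_cmult[OF \<alpha>(1) \<alpha>1 smear_CH_0[OF K' f M r]])
qed

text \<open>The last derivative falls on the kernel and gains one order; all the others are put on
  \<open>f\<close> by parts.\<close>

lemma smear_CH:
  fixes f :: "'a::euclidean_space \<Rightarrow> 'b::euclidean_space"
  assumes w: "bump_kernel \<alpha> w K" and r: "r > 0"
  shows "CH \<alpha> m f \<Longrightarrow> (\<And>x. norm x > \<rho> \<Longrightarrow> f x = 0) \<Longrightarrow> CH \<alpha> (Suc m) (smear w r f)"
proof (induction m arbitrary: f)
  case 0
  obtain M where "\<And>x. norm (f x) \<le> M" using CH_bounded_if_vanishing[OF \<alpha>(1) \<alpha>1 0] by blast
  then show ?case by (rule smear_CH_1[OF w CH_continuous[OF \<alpha>(1) \<alpha>1 0(1)] _ r])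
next
  case (Suc m)
  obtain M where M: "\<And>x. norm (f x) \<le> M" using CH_bounded_if_vanishing[OF \<alpha>(1) \<alpha>1 Suc.prems] by blast
  show ?case
  proof (rule CH_SucI)
    show "(smear w r f has_derivative (\<lambda>v. \<Sum>b\<in>Basis. (v \<bullet> b) *\<^sub>R ((1 / r) *\<^sub>R smear (pd b w) r f x))) (at x)" for x
      by (rule smear_has_derivative[OF \<alpha>(1) \<alpha>1 w CH_continuous[OF \<alpha>(1) \<alpha>1 Suc.prems(1)] r M])
    fix c :: 'a assume c: "c \<in> Basis"
    have "(1 / r) *\<^sub>R smear (pd c w) r f x = smear w r (pd c f) x" for x
      using smear_by_parts[OF \<alpha>(1) \<alpha>1 w Suc.prems(1) r c, of x] r by simp
    then show "CH \<alpha> (Suc m) (\<lambda>x. \<Sum>b\<in>Basis. (c \<bullet> b) *\<^sub>R ((1 / r) *\<^sub>R smear (pd b w) r f x))"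
      unfolding sum_Basis_inner[OF c]
      using Suc.IH[OF CH_Suc_pd[OF Suc.prems(1) c] pd_vanish[of \<rho> f, OF Suc.prems(2)]] by simp
  qed
qed

lemma dyadic_sum_CH_1:
  fixes f :: "'a::euclidean_space \<Rightarrow> 'b::euclidean_space"
  assumes w: "bump_kernel \<alpha> w K" and f: "continuous_on UNIV f" and M: "\<And>x. norm (f x) \<le> M"
  shows "CH \<alpha> (Suc 0) (dyadic_sum 2 w r0 f)"
proof (rule CH_SucI[OF dyadic_sum_2_has_derivative[OF w f M]])
  fix c :: 'a assume c: "c \<in> Basis"
  obtain K' where K': "bump_kernel \<alpha> (pd c w) K'" using bump_kernel_pd[OF w c] by blast
  show "CH \<alpha> 0 (\<lambda>x. \<Sum>b\<in>Basis. (c \<bullet> b) *\<^sub>R dyadic_sum 1 (pd b w) r0 f x)"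
    unfolding sum_Basis_inner[OF c]
    by (rule holder_CH_0[OF dyadic_sum_1_holder[OF K' f M]])
qed

lemma dyadic_sum_1_CH_1:
  fixes f :: "'a::euclidean_space \<Rightarrow> 'b::euclidean_space"
  assumes w: "bump_kernel \<alpha> w K" and f: "CH \<alpha> m f" "\<And>x. norm x > \<rho> \<Longrightarrow> f x = 0"
  shows "CH \<alpha> (Suc 0) (dyadic_sum 1 w r0 f)"
    and "b \<in> Basis \<Longrightarrow> pd b (dyadic_sum 1 w r0 f) x = dyadic_sum 0 (pd b w) r0 f x"
proof -
  note fc = CH_continuous[OF \<alpha>(1) \<alpha>1 f(1)]
  obtain M where M: "\<And>x. norm (f x) \<le> M" using CH_bounded_if_vanishing[OF \<alpha>(1) \<alpha>1 f] by blast
  obtain C where C: "C \<ge> 0" "\<And>x y. norm (f x - f y) \<le> C * norm (x - y) powr \<alpha>"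
    using global_holder_if_vanishing[OF \<alpha>(1) \<alpha>1 f] by blast
  note D = dyadic_sum_1_has_derivative[OF w fc M C(2) C(1)]
  show "CH \<alpha> (Suc 0) (dyadic_sum 1 w r0 f)"
  proof (rule CH_SucI[OF D])
    fix c :: 'a assume c: "c \<in> Basis"
    obtain K' where K': "bump_kernel \<alpha> (pd c w) K'" using bump_kernel_pd[OF w c] by blast
    have w0: "(\<integral>z. pd c w z \<partial>lborel) = 0"
      by (rule integral_pd_eq_0[OF \<alpha>(1) \<alpha>1 bump_kernel_CH[OF w] bump_kernel_vanish[OF w] c])
    show "CH \<alpha> 0 (\<lambda>x. \<Sum>b\<in>Basis. (c \<bullet> b) *\<^sub>R dyadic_sum 0 (pd b w) r0 f x)"
      unfolding sum_Basis_inner[OF c]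
      by (rule holder_CH_0[OF dyadic_sum_0_holder[OF K' fc w0 C(2) C(1)]])
  qed
  show "pd b (dyadic_sum 1 w r0 f) x = dyadic_sum 0 (pd b w) r0 f x" if b: "b \<in> Basis"
    using pd_eqI[OF D, of b x] unfolding sum_Basis_inner[OF b] .
qed

lemma pd_dyadic_sum_2:
  fixes f :: "'a::euclidean_space \<Rightarrow> 'b::euclidean_space"
  assumes w: "bump_kernel \<alpha> w K" and f: "continuous_on UNIV f" and M: "\<And>x. norm (f x) \<le> M" and b: "b \<in> Basis"
  shows "pd b (dyadic_sum 2 w r0 f) = dyadic_sum 1 (pd b w) r0 f"
proof
  show "pd b (dyadic_sum 2 w r0 f) x = dyadic_sum 1 (pd b w) r0 f x" for x
    using pd_eqI[OF dyadic_sum_2_has_derivative[OF w f M], of b x] unfolding sum_Basis_inner[OF b] .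
qed

text \<open>At order 0 this is the Schauder estimate. Above it, integration by parts turns the
  derivative of the potential of \<open>f\<close> into the potential of the derivative of
  \<open>f\<close> with the same kernel, so the gain of two orders is inherited.\<close>

lemma dyadic_sum_CH:
  fixes f :: "'a::euclidean_space \<Rightarrow> 'b::euclidean_space"
  assumes w: "bump_kernel \<alpha> w K"
  shows "CH \<alpha> m f \<Longrightarrow> (\<And>x. norm x > \<rho> \<Longrightarrow> f x = 0) \<Longrightarrow> CH \<alpha> (Suc (Suc m)) (dyadic_sum 2 w r0 f)"
proof (induction m arbitrary: f)
  case 0
  note fc = CH_continuous[OF \<alpha>(1) \<alpha>1 0(1)]
  obtain M where M: "\<And>x. norm (f x) \<le> M" using CH_bounded_if_vanishing[OF \<alpha>(1) \<alpha>1 0] by blast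
  show ?case
  proof (rule CH_SucI[OF dyadic_sum_2_has_derivative[OF w fc M]])
    fix c :: 'a assume c: "c \<in> Basis"
    obtain K' where K': "bump_kernel \<alpha> (pd c w) K'" using bump_kernel_pd[OF w c] by blast
    show "CH \<alpha> (Suc 0) (\<lambda>x. \<Sum>b\<in>Basis. (c \<bullet> b) *\<^sub>R dyadic_sum 1 (pd b w) r0 f x)"
      unfolding sum_Basis_inner[OF c] by (rule dyadic_sum_1_CH_1(1)[OF K' 0])
  qed
next
  case (Suc m)
  note fc = CH_continuous[OF \<alpha>(1) \<alpha>1 Suc.prems(1)]
  obtain M where M: "\<And>x. norm (f x) \<le> M" using CH_bounded_if_vanishing[OF \<alpha>(1) \<alpha>1 Suc.prems] by blast
  show ?case
  proof (rule CH_SucI[OF dyadic_sum_2_has_derivative[OF w fc M]])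
    fix c :: 'a assume c: "c \<in> Basis"
    have "(r0 / 2 ^ j) ^ 1 *\<^sub>R smear (pd c w) (r0 / 2 ^ j) f x
        = (r0 / 2 ^ j) ^ 2 *\<^sub>R smear w (r0 / 2 ^ j) (pd c f) x" for j x
      unfolding smear_by_parts[OF \<alpha>(1) \<alpha>1 w Suc.prems(1) scale_pos c]
      by (simp add: power2_eq_square)
    then have "dyadic_sum 1 (pd c w) r0 f x = dyadic_sum 2 w r0 (pd c f) x" for x
      unfolding dyadic_sum_def by (simp only:)
    then show "CH \<alpha> (Suc (Suc m)) (\<lambda>x. \<Sum>b\<in>Basis. (c \<bullet> b) *\<^sub>R dyadic_sum 1 (pd b w) r0 f x)"
      unfolding sum_Basis_inner[OF c]
      using Suc.IH[OF CH_Suc_pd[OF Suc.prems(1) c] pd_vanish[of \<rho> f, OF Suc.prems(2)]] by (simp only:)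
  qed
qed

text \<open>At scale r the Laplacian of a term is the difference of the \<phi>-averages of
  \<open>f\<close> at scales r/2 and r. The sum telescopes from the average at scale
  \<open>r0\<close> to the limit of vanishing scale, which is \<open>f\<close> because \<phi> has
  integral 1.\<close>

lemma laplacian_dyadic_sum:
  fixes f :: "'a::euclidean_space \<Rightarrow> 'b::euclidean_space"
  assumes \<psi>: "bump_kernel \<alpha> \<psi> K" and \<phi>: "bump_kernel \<alpha> \<phi> K"
    and lap: "\<And>x. (\<Sum>b\<in>Basis. pd b (pd b \<psi>) x) = 2 ^ DIM('a) * \<phi> (2 *\<^sub>R x) - \<phi> x"
    and one: "integral\<^sup>L lborel \<phi> = 1"
    and f: "CH \<alpha> m f" "\<And>x. norm x > \<rho> \<Longrightarrow> f x = 0"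
  shows "(\<Sum>b\<in>Basis. pd b (pd b (dyadic_sum 2 \<psi> r0 f)) x) = f x - smear \<phi> r0 f x"
proof -
  note fc = CH_continuous[OF \<alpha>(1) \<alpha>1 f(1)]
  obtain M where M: "\<And>x. norm (f x) \<le> M" using CH_bounded_if_vanishing[OF \<alpha>(1) \<alpha>1 f] by blast
  obtain C where C: "C \<ge> 0" "\<And>x y. norm (f x - f y) \<le> C * norm (x - y) powr \<alpha>"
    using global_holder_if_vanishing[OF \<alpha>(1) \<alpha>1 f] by blast
  have k1: "\<exists>K'. bump_kernel \<alpha> (pd b \<psi>) K'" if "b \<in> Basis" for b
    using bump_kernel_pd[OF \<psi> that] .
  have k2: "\<exists>K'. bump_kernel \<alpha> (pd b (pd b \<psi>)) K'" if "b \<in> Basis" for b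
    using k1[OF that] bump_kernel_pd[OF _ that] by blast
  have cont2: "continuous_on UNIV (pd b (pd b \<psi>))"
    and van2: "norm z > 1 \<Longrightarrow> pd b (pd b \<psi>) z = 0" if "b \<in> Basis" for b z
    using k2[OF that] bump_kernel_continuous[OF \<alpha>(1) \<alpha>1] bump_kernel_vanish by blast+
  have sums2: "(\<lambda>j. smear (pd b (pd b \<psi>)) (r0 / 2 ^ j) f x) sums pd b (pd b (dyadic_sum 2 \<psi> r0 f)) x"
    if b: "b \<in> Basis" for b
  proof -
    obtain K1 where K1: "bump_kernel \<alpha> (pd b \<psi>) K1" using k1[OF b] by blast
    obtain K2 where K2: "bump_kernel \<alpha> (pd b (pd b \<psi>)) K2" using k2[OF b] by blast
    have w0: "(\<integral>z. pd b (pd b \<psi>) z \<partial>lborel) = 0"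
      by (rule integral_pd_eq_0[OF \<alpha>(1) \<alpha>1 bump_kernel_CH[OF K1] bump_kernel_vanish[OF K1] b])
    have "summable (\<lambda>j. smear (pd b (pd b \<psi>)) (r0 / 2 ^ j) f x)"
    proof (rule summable_comparison_test'[OF summable_dyadic_powr[OF \<alpha>(1) r0(1), of "K2 * C"]])
      show "norm (smear (pd b (pd b \<psi>)) (r0 / 2 ^ j) f x) \<le> K2 * C * (r0 / 2 ^ j) powr \<alpha>" for j
        using smear_zero_mean[OF K2 fc scale_pos C(2) C(1), of j x] w0 by simp
    qed
    moreover have "pd b (pd b (dyadic_sum 2 \<psi> r0 f)) x = (\<Sum>j. smear (pd b (pd b \<psi>)) (r0 / 2 ^ j) f x)"
    proof -
      have "pd b (dyadic_sum 1 (pd b \<psi>) r0 f) x = dyadic_sum 0 (pd b (pd b \<psi>)) r0 f x"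
        by (rule dyadic_sum_1_CH_1(2)[OF K1 f b])
      then show ?thesis unfolding pd_dyadic_sum_2[OF \<psi> fc M b] by (simp add: dyadic_sum_def)
    qed
    ultimately show ?thesis by (simp add: summable_sums)
  qed
  have step: "(\<Sum>b\<in>Basis. smear (pd b (pd b \<psi>)) r f x) = smear \<phi> (r / 2) f x - smear \<phi> r f x" for r
  proof -
    \<comment> \<open>Substituting y = 2z turns the part of the kernel with \<phi>(2z) into an
      average at scale r/2 and uses up the factor 2^n.\<close>
    define H where "H = (\<lambda>y. \<phi> y *\<^sub>R f (x - (r / 2) *\<^sub>R y))"
    note \<phi>c = bump_kernel_continuous[OF \<alpha>(1) \<alpha>1 \<phi>]
    have Hc: "continuous_on UNIV H"
      unfolding H_def by (rule continuous_on_scaleR[OF \<phi>c continuous_on_affine_arg[OF fc]])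
    have I: "integrable lborel (\<lambda>z. \<phi> z *\<^sub>R f (x - r *\<^sub>R z))"
      by (rule integrable_smear[OF \<phi>c bump_kernel_vanish[OF \<phi>] fc])
    have I2: "integrable lborel (\<lambda>z. 2 ^ DIM('a) *\<^sub>R H (2 *\<^sub>R z))"
    proof (rule integrable_continuous_compact_support[where \<rho> = 1])
      show "continuous_on UNIV (\<lambda>z. 2 ^ DIM('a) *\<^sub>R H (2 *\<^sub>R z))"
        by (intro continuous_on_scaleR continuous_on_const continuous_on_compose2[OF Hc] continuous_on_id) auto
      show "2 ^ DIM('a) *\<^sub>R H (2 *\<^sub>R z) = 0" if "norm z \<ge> 1" for z
        using bump_kernel_vanish[OF \<phi>, of "2 *\<^sub>R z"] that by (simp add: H_def)
    qed
    have "(\<Sum>b\<in>Basis. smear (pd b (pd b \<psi>)) r f x)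
        = (\<integral>z. (\<Sum>b\<in>Basis. pd b (pd b \<psi>) z *\<^sub>R f (x - r *\<^sub>R z)) \<partial>lborel)"
      unfolding smear_def
      by (rule Bochner_Integration.integral_sum[symmetric]) (rule integrable_smear[OF cont2 van2 fc])
    also have "\<dots> = (\<integral>z. 2 ^ DIM('a) *\<^sub>R H (2 *\<^sub>R z) - \<phi> z *\<^sub>R f (x - r *\<^sub>R z) \<partial>lborel)"
      by (rule Bochner_Integration.integral_cong[OF refl])
        (simp add: H_def scaleR_sum_left[symmetric] lap scaleR_diff_left)
    also have "\<dots> = (\<integral>z. 2 ^ DIM('a) *\<^sub>R H (2 *\<^sub>R z) \<partial>lborel) - smear \<phi> r f x"
      unfolding smear_def by (rule Bochner_Integration.integral_diff[OF I2 I])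
    also have "(\<integral>z. 2 ^ DIM('a) *\<^sub>R H (2 *\<^sub>R z) \<partial>lborel) = (\<integral>z. H z \<partial>lborel)"
      by (rule lborel_integral_dilate[OF borel_measurable_continuous_onI[OF Hc]]) simp
    finally show ?thesis by (simp add: H_def smear_def)
  qed
  have "(\<lambda>j. \<Sum>b\<in>Basis. smear (pd b (pd b \<psi>)) (r0 / 2 ^ j) f x)
      sums (\<Sum>b\<in>Basis. pd b (pd b (dyadic_sum 2 \<psi> r0 f)) x)"
    by (rule sums_sum) (rule sums2)
  then have s1: "(\<lambda>j. smear \<phi> (r0 / 2 ^ Suc j) f x - smear \<phi> (r0 / 2 ^ j) f x)
      sums (\<Sum>b\<in>Basis. pd b (pd b (dyadic_sum 2 \<psi> r0 f)) x)"
    unfolding step by (simp add: mult.commute)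
  have "(\<lambda>j. smear \<phi> (r0 / 2 ^ j) f x - f x) \<longlonglongrightarrow> 0"
  proof (rule Lim_null_comparison)
    show "\<forall>\<^sub>F j in sequentially. norm (smear \<phi> (r0 / 2 ^ j) f x - f x) \<le> K * C * (r0 / 2 ^ j) powr \<alpha>"
      using smear_zero_mean[OF \<phi> fc scale_pos C(2) C(1), of _ x] one
      by (intro always_eventually) (simp add: mult.assoc)
    show "(\<lambda>j. K * C * (r0 / 2 ^ j) powr \<alpha>) \<longlonglongrightarrow> 0"
      by (rule summable_LIMSEQ_zero[OF summable_dyadic_powr[OF \<alpha>(1) r0(1)]])
  qed
  then have "(\<lambda>j. smear \<phi> (r0 / 2 ^ j) f x) \<longlonglongrightarrow> f x" by (rule LIM_zero_cancel)
  from telescope_sums[OF this] have s2: "(\<lambda>j. smear \<phi> (r0 / 2 ^ Suc j) f x - smear \<phi> (r0 / 2 ^ j) f x)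
      sums (f x - smear \<phi> r0 f x)" by simp
  show ?thesis using sums_unique2[OF s1 s2] .
qed

end

section \<open>The fixed point problem\<close>

definition admissible :: "real \<Rightarrow> real \<Rightarrow> ('a::euclidean_space \<Rightarrow> 'b::euclidean_space) \<Rightarrow> bool" where
  "admissible M \<rho> f \<longleftrightarrow>
     continuous_on UNIV f \<and> (\<forall>x. norm (f x) \<le> M) \<and> (\<forall>x. norm x > \<rho> \<longrightarrow> f x = 0)"

text \<open>Bound and support condition survive uniform limits, so the admissible functions form a
  closed set in the Banach space of bounded continuous functions, where the contraction principle
  applies.\<close>

lemma bounded_continuous_fixed_point:
  fixes F :: "('a::euclidean_space \<Rightarrow> 'b::euclidean_space) \<Rightarrow> 'a \<Rightarrow> 'b"
  assumes M: "M \<ge> 0" and FS: "\<And>f. admissible M \<rho> f \<Longrightarrow> admissible M \<rho> (F f)"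
    and contr: "\<And>f g \<delta> x. admissible M \<rho> f \<Longrightarrow> admissible M \<rho> g \<Longrightarrow> (\<And>x. norm (f x - g x) \<le> \<delta>) \<Longrightarrow> norm (F f x - F g x) \<le> \<delta> / 2"
  shows "\<exists>f. admissible M \<rho> f \<and> F f = f"
proof -
  define T where "T = {f :: 'a \<Rightarrow>\<^sub>C 'b. admissible M \<rho> (apply_bcontfun f)}"
  define G where "G = (\<lambda>f :: 'a \<Rightarrow>\<^sub>C 'b. Bcontfun (F (apply_bcontfun f)))"
  have bc: "f \<in> bcontfun" if "admissible M \<rho> f" for f
    using that unfolding admissible_def by (intro bcontfun_normI) auto
  have G: "apply_bcontfun (G f) = F (apply_bcontfun f)" if "f \<in> T" for f
    using Bcontfun_inverse[OF bc[OF FS]] that by (simp add: G_def T_def)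
  have "closed T"
    unfolding closed_sequential_limits
  proof (intro allI impI, elim conjE)
    fix fs :: "nat \<Rightarrow> 'a \<Rightarrow>\<^sub>C 'b" and f assume fs: "\<forall>n. fs n \<in> T" and lim: "fs \<longlonglongrightarrow> f"
    have pt: "(\<lambda>n. apply_bcontfun (fs n) x) \<longlonglongrightarrow> apply_bcontfun f x" for x
    proof (rule tendsto_dist_iff[THEN iffD2], rule tendsto_sandwich[OF _ _ tendsto_const])
      show "(\<lambda>n. dist (fs n) f) \<longlonglongrightarrow> 0" by (rule tendsto_dist_iff[THEN iffD1, OF lim])
    qed (auto simp: dist_bounded)
    have "norm (apply_bcontfun f x) \<le> M" for x
      by (rule LIMSEQ_le_const2[OF tendsto_norm[OF pt]]) (use fs in \<open>auto simp: T_def admissible_def\<close>)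
    moreover have "apply_bcontfun f x = 0" if "norm x > \<rho>" for x
    proof -
      have "(\<lambda>n. apply_bcontfun (fs n) x) = (\<lambda>n. 0)" using fs that by (auto simp: T_def admissible_def)
      then show ?thesis using pt[of x] by (metis LIMSEQ_const_iff)
    qed
    ultimately show "f \<in> T"
      unfolding T_def admissible_def using continuous_on_apply_bcontfun[of UNIV f] by blast
  qed
  then have "complete T" by (simp add: complete_eq_closed)
  moreover have "T \<noteq> {}"
  proof -
    have z: "admissible M \<rho> (\<lambda>_::'a. 0::'b)" using M by (simp add: admissible_def)
    have "Bcontfun (\<lambda>_. 0) \<in> T"
      unfolding T_def mem_Collect_eq Bcontfun_inverse[OF bc[OF z]] by (rule z)
    then show ?thesis by blast
  qed
  moreover have "G ` T \<subseteq> T"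
  proof
    fix g assume "g \<in> G ` T"
    then obtain f where f: "f \<in> T" "g = G f" by blast
    then show "g \<in> T" using FS[of "apply_bcontfun f"] G[OF f(1)] by (simp add: T_def)
  qed
  moreover have "dist (G f) (G g) \<le> 1/2 * dist f g" if "f \<in> T" "g \<in> T" for f g
  proof (rule dist_bound)
    fix x
    have "norm (apply_bcontfun f x - apply_bcontfun g x) \<le> dist f g" for x
      using dist_bounded[of f x g] by (simp add: dist_norm)
    then show "dist (apply_bcontfun (G f) x) (apply_bcontfun (G g) x) \<le> 1/2 * dist f g"
      using contr[of "apply_bcontfun f" "apply_bcontfun g" "dist f g" x] that
      by (simp add: G dist_norm T_def)
  qed
  ultimately have "\<exists>!f\<in>T. G f = f"
    by (intro Banach_fix[of T "1/2"]) auto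
  then obtain f where "f \<in> T" "G f = f" by blast
  then show ?thesis using G by (metis T_def mem_Collect_eq)
qed

text \<open>The hypothesis improves any uniform bound; applied to the supremum s it reads s <=
  \<beta> + s/2. The a priori bound \<open>D\<close> makes the supremum finite. It yields Lipschitz
  dependence of fixed points on a parameter.\<close>

lemma half_contraction_bound:
  fixes d :: "'a \<Rightarrow> real"
  assumes "\<And>x. d x \<le> D" "\<And>\<delta> x. (\<And>x. d x \<le> \<delta>) \<Longrightarrow> d x \<le> \<beta> + \<delta> / 2"
  shows "d x \<le> 2 * \<beta>"
proof -
  have bdd: "bdd_above (range d)" using assms(1) by (auto simp: bdd_above_def)
  have le: "d x \<le> (SUP x. d x)" for x by (rule cSUP_upper[OF _ bdd]) simp
  have "(SUP x. d x) \<le> \<beta> + (SUP x. d x) / 2"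
    by (rule cSUP_least) (use assms(2)[OF le] in auto)
  with le[of x] show ?thesis by linarith
qed

text \<open>The linear maps \<open>L b\<close> place the partial derivative in direction
  \<open>b\<close> into an abstract space of gradients. The analysis thus runs over arbitrary
  Euclidean spaces, and matrices appear only in the final instance.\<close>

definition jac :: "('a::euclidean_space \<Rightarrow> 'b::euclidean_space \<Rightarrow> 'q::euclidean_space) \<Rightarrow> ('a \<Rightarrow> 'b) \<Rightarrow> 'a \<Rightarrow> 'q" where
  "jac L U x = (\<Sum>b\<in>Basis. L b (pd b U x))"

text \<open>This functional kills affine maps and all radially symmetric maps, but not \<open>x\<^sub>1 x\<^sub>2\<close>.\<close>

definition probe :: "real \<Rightarrow> 'a::real_normed_vector \<Rightarrow> 'a \<Rightarrow> ('a \<Rightarrow> 'b::real_normed_vector) \<Rightarrow> 'b" where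
  "probe R b1 b2 u = u ((R / 2) *\<^sub>R (b1 + b2)) + u (- ((R / 2) *\<^sub>R (b1 + b2)))
     - u ((R / 2) *\<^sub>R (b1 - b2)) - u (- ((R / 2) *\<^sub>R (b1 - b2)))"

locale semilinear_ansatz =
  fixes \<alpha> r0 K :: real and \<psi> \<phi> :: "'a::euclidean_space \<Rightarrow> real"
    and L :: "'a \<Rightarrow> 'b::euclidean_space \<Rightarrow> 'q::euclidean_space"
    and c0 :: 'b and c1 :: "'a \<Rightarrow> 'b" and b1 b2 :: 'a and e :: 'b
  assumes \<alpha>: "0 < \<alpha>" "\<alpha> < 1" and r0: "0 < r0" "r0 \<le> 1"
    and \<psi>: "bump_kernel \<alpha> \<psi> K" and \<phi>: "bump_kernel \<alpha> \<phi> K"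
    and d\<psi>: "\<And>b. b \<in> Basis \<Longrightarrow> bump_kernel \<alpha> (pd b \<psi>) K"
    and lap: "\<And>x. (\<Sum>b\<in>Basis. pd b (pd b \<psi>) x) = 2 ^ DIM('a) * \<phi> (2 *\<^sub>R x) - \<phi> x"
    and one: "integral\<^sup>L lborel \<phi> = 1"
    and L: "\<And>b. bounded_linear (L b)"
    and b12: "b1 \<in> Basis" "b2 \<in> Basis" "b1 \<noteq> b2" and e: "norm e = 1"
begin

lemma \<alpha>1: "\<alpha> \<le> 1" using \<alpha> by simp

text \<open>A harmonic polynomial with vanishing value and gradient at 0: its multiples change
  neither the Laplacian of the ansatz nor the data at the origin.\<close>

definition harm :: "'a \<Rightarrow> 'b" where "harm x = ((x \<bullet> b1) * (x \<bullet> b2)) *\<^sub>R e"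

text \<open>The derivative of \<open>harm\<close> with the direction as first argument, so that
  \<open>dharm b\<close> is a partial derivative as a (linear) function of the point.\<close>

definition dharm :: "'a \<Rightarrow> 'a \<Rightarrow> 'b" where
  "dharm v x = ((v \<bullet> b1) * (x \<bullet> b2) + (x \<bullet> b1) * (v \<bullet> b2)) *\<^sub>R e"

definition N :: "('a \<Rightarrow> 'b) \<Rightarrow> 'a \<Rightarrow> 'b" where "N f = dyadic_sum 2 \<psi> r0 f"

definition DN :: "('a \<Rightarrow> 'b) \<Rightarrow> 'a \<Rightarrow> 'a \<Rightarrow> 'b" where "DN f b = dyadic_sum 1 (pd b \<psi>) r0 f"

definition sol :: "real \<Rightarrow> ('a \<Rightarrow> 'b) \<Rightarrow> 'a \<Rightarrow> 'b" where
  "sol t f x = c0 + (\<Sum>b\<in>Basis. (x \<bullet> b) *\<^sub>R c1 b) + t *\<^sub>R harm x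
    + (N f x - N f 0 - (\<Sum>b\<in>Basis. (x \<bullet> b) *\<^sub>R DN f b 0))"

lemma harm_deriv: "(harm has_derivative (\<lambda>v. dharm v x)) (at x)"
  unfolding harm_def dharm_def
  by (auto intro!: derivative_eq_intros simp: mult.commute add.commute)

lemma dharm_deriv: "(dharm b has_derivative dharm b) (at x)"
proof -
  have "bounded_linear (dharm b)"
    unfolding dharm_def
    by (intro bounded_linear_compose[OF bounded_linear_scaleR_left] bounded_linear_add
        bounded_linear_compose[OF bounded_linear_mult_right] bounded_linear_compose[OF bounded_linear_mult_left]
        bounded_linear_inner_left)
  then show ?thesis by (rule bounded_linear_imp_has_derivative)
qed

lemma dharm_Basis: "b \<in> Basis \<Longrightarrow> dharm b b = 0"
  using b12 by (auto simp: dharm_def inner_Basis)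

lemma dharm_bound:
  assumes "b \<in> Basis"
  shows "norm (dharm b x) \<le> 2 * norm x"
proof -
  have 1: "\<bar>b \<bullet> b'\<bar> \<le> 1" "\<bar>x \<bullet> b'\<bar> \<le> norm x" if "b' \<in> Basis" for b'
    using assms that Basis_le_norm[of b' x] by (auto simp: inner_Basis)
  have "\<bar>(b \<bullet> b1) * (x \<bullet> b2)\<bar> \<le> 1 * norm x" "\<bar>(x \<bullet> b1) * (b \<bullet> b2)\<bar> \<le> norm x * 1"
    unfolding abs_mult using 1 b12 by (intro mult_mono; simp)+
  then show ?thesis by (simp add: dharm_def e)
qed

lemma CH_harm: "CH \<alpha> m harm"
  unfolding harm_def
  by (intro CH_scaleR[OF \<alpha>(1) \<alpha>1] CH_mult[OF \<alpha>(1) \<alpha>1] CH_const[OF \<alpha>(1) \<alpha>1]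
      CH_linear[OF \<alpha>(1) \<alpha>1] bounded_linear_inner_left)

lemma CH_lin: "CH \<alpha> m (\<lambda>x::'a. \<Sum>b\<in>Basis. (x \<bullet> b) *\<^sub>R C b)"
  by (intro CH_sum[OF \<alpha>(1) \<alpha>1] CH_scaleR[OF \<alpha>(1) \<alpha>1] CH_const[OF \<alpha>(1) \<alpha>1]
      CH_linear[OF \<alpha>(1) \<alpha>1] bounded_linear_inner_left)

lemma lin_deriv: "((\<lambda>x::'a. \<Sum>b\<in>Basis. (x \<bullet> b) *\<^sub>R C b) has_derivative (\<lambda>v. \<Sum>b\<in>Basis. (v \<bullet> b) *\<^sub>R C b)) (at x)"
  by (rule bounded_linear_imp_has_derivative)
    (intro bounded_linear_sum bounded_linear_compose[OF bounded_linear_scaleR_left] bounded_linear_inner_left)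

lemma N_deriv:
  assumes "continuous_on UNIV f" "\<And>x. norm (f x) \<le> M"
  shows "(N f has_derivative (\<lambda>v. \<Sum>b\<in>Basis. (v \<bullet> b) *\<^sub>R DN f b x)) (at x)"
  unfolding N_def DN_def by (rule dyadic_sum_2_has_derivative[OF \<alpha> r0 \<psi> assms])

lemma sol_deriv:
  assumes "continuous_on UNIV f" "\<And>x. norm (f x) \<le> M"
  shows "(sol t f has_derivative (\<lambda>v. 0 + (\<Sum>b\<in>Basis. (v \<bullet> b) *\<^sub>R c1 b) + t *\<^sub>R dharm v x
    + ((\<Sum>b\<in>Basis. (v \<bullet> b) *\<^sub>R DN f b x) - 0 - (\<Sum>b\<in>Basis. (v \<bullet> b) *\<^sub>R DN f b 0)))) (at x)"
  unfolding sol_def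
  by (intro has_derivative_add has_derivative_diff has_derivative_const lin_deriv
      has_derivative_scaleR_right harm_deriv N_deriv[OF assms])

lemma pd_sol:
  assumes "continuous_on UNIV f" "\<And>x. norm (f x) \<le> M" "b \<in> Basis"
  shows "pd b (sol t f) x = c1 b + t *\<^sub>R dharm b x + (DN f b x - DN f b 0)"
  using pd_eqI[OF sol_deriv[OF assms(1,2)], where b = b and x = x and t1 = t]
  by (simp add: sum_Basis_inner[OF assms(3)])

lemma sol_differentiable:
  assumes "continuous_on UNIV f" "\<And>x. norm (f x) \<le> M"
  shows "sol t f differentiable at x"
  using sol_deriv[OF assms] differentiableI by blast

lemma sol_0: "sol t f 0 = c0"
  by (simp add: sol_def harm_def)

lemma pd_sol_0:
  assumes "continuous_on UNIV f" "\<And>x. norm (f x) \<le> M" "b \<in> Basis"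
  shows "pd b (sol t f) 0 = c1 b"
  by (simp add: pd_sol[OF assms] dharm_def)

lemma DN_bound:
  assumes "continuous_on UNIV f" "\<And>x. norm (f x) \<le> M" "b \<in> Basis"
  shows "norm (DN f b x) \<le> 2 * r0 * K * M"
  unfolding DN_def by (rule dyadic_sum_bound[OF \<alpha> r0 d\<psi>[OF assms(3)] assms(1,2)]) simp

lemma DN_diff:
  assumes "continuous_on UNIV f" "\<And>x. norm (f x) \<le> M" "continuous_on UNIV g" "\<And>x. norm (g x) \<le> M'"
    "b \<in> Basis"
  shows "DN (\<lambda>y. f y - g y) b x = DN f b x - DN g b x"
  unfolding DN_def by (rule dyadic_sum_diff[OF \<alpha> r0 d\<psi>[OF assms(5)] assms(1,2) _ assms(3,4)]) simp

lemma N_diff: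
  assumes "continuous_on UNIV f" "\<And>x. norm (f x) \<le> M" "continuous_on UNIV g" "\<And>x. norm (g x) \<le> M'"
  shows "N (\<lambda>y. f y - g y) x = N f x - N g x"
  unfolding N_def by (rule dyadic_sum_diff[OF \<alpha> r0 \<psi> assms(1,2) _ assms(3,4)]) simp

lemma N_lipschitz:
  assumes "continuous_on UNIV f" "\<And>x. norm (f x) \<le> M"
  shows "norm (N f x - N f y) \<le> DIM('a) * (2 * r0 * K * M) * norm (x - y)"
proof (rule lipschitz_if_pd_bounded[OF convex_UNIV])
  show "N f differentiable at z" for z using N_deriv[OF assms] differentiableI by blast
  show "norm (pd b (N f) z) \<le> 2 * r0 * K * M" if "b \<in> Basis" for b z
    using DN_bound[OF assms that] pd_eqI[OF N_deriv[OF assms], of b z] sum_Basis_inner[OF that] by metis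
qed auto

lemma CH_sol:
  assumes "CH \<alpha> m (N f)"
  shows "CH \<alpha> m (sol t f)"
  unfolding sol_def
  by (intro CH_add[OF \<alpha>(1) \<alpha>1] CH_diff[OF \<alpha>(1) \<alpha>1] CH_const[OF \<alpha>(1) \<alpha>1] CH_lin
      CH_cmult[OF \<alpha>(1) \<alpha>1] CH_harm assms)

lemma CH_jac:
  assumes "CH \<alpha> (Suc m) U"
  shows "CH \<alpha> m (jac L U)"
  unfolding jac_def
  by (intro CH_sum[OF \<alpha>(1) \<alpha>1] CH_bounded_linear[OF \<alpha>(1) \<alpha>1 L] CH_Suc_pd[OF assms])

lemma CH_sol_1:
  assumes "continuous_on UNIV f" "\<And>x. norm (f x) \<le> M"
  shows "CH \<alpha> (Suc 0) (sol t f)"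
  by (rule CH_sol) (unfold N_def, rule dyadic_sum_CH_1[OF \<alpha> r0 \<psi> assms])

lemma CH_sol_Suc_Suc:
  assumes "CH \<alpha> m f" "\<And>x. norm x > \<rho> \<Longrightarrow> f x = 0"
  shows "CH \<alpha> (Suc (Suc m)) (sol t f)"
  by (rule CH_sol) (unfold N_def, rule dyadic_sum_CH[OF \<alpha> r0 \<psi> assms])

text \<open>The affine terms drop out, and the quadratic term contributes
  \<open>dharm b b = 0\<close> in each direction. Only the potential remains.\<close>

lemma laplacian_sol:
  assumes f: "CH \<alpha> m f" "\<And>x. norm x > \<rho> \<Longrightarrow> f x = 0"
  shows "(\<Sum>b\<in>Basis. pd b (pd b (sol t f)) x) = f x - smear \<phi> r0 f x"
proof -
  note fc = CH_continuous[OF \<alpha>(1) \<alpha>1 f(1)]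
  obtain M where M: "\<And>x. norm (f x) \<le> M" using CH_bounded_if_vanishing[OF \<alpha>(1) \<alpha>1 f] by blast
  have "pd b (pd b (sol t f)) x = pd b (pd b (N f)) x" if b: "b \<in> Basis" for b
  proof -
    have DN: "pd b (N f) = DN f b"
      unfolding N_def DN_def by (rule pd_dyadic_sum_2[OF \<alpha> r0 \<psi> fc M b])
    have "CH \<alpha> (Suc 0) (DN f b)"
      unfolding DN_def by (rule dyadic_sum_1_CH_1(1)[OF \<alpha> r0 d\<psi>[OF b] f])
    from CH_Suc_has_derivative[OF this]
    have D: "(DN f b has_derivative (\<lambda>v. \<Sum>c\<in>Basis. (v \<bullet> c) *\<^sub>R pd c (DN f b) x)) (at x)" .
    have s: "pd b (sol t f) = (\<lambda>x. c1 b + t *\<^sub>R dharm b x + (DN f b x - DN f b 0))"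
      using pd_sol[OF fc M b] by blast
    have "(pd b (sol t f) has_derivative (\<lambda>v. 0 + t *\<^sub>R dharm b v
        + ((\<Sum>c\<in>Basis. (v \<bullet> c) *\<^sub>R pd c (DN f b) x) - 0))) (at x)"
      unfolding s by (intro has_derivative_add has_derivative_diff has_derivative_const
          has_derivative_scaleR_right dharm_deriv D)
    from pd_eqI[OF this, of b] show ?thesis
      by (simp add: sum_Basis_inner[OF b] dharm_Basis[OF b] DN)
  qed
  then have "(\<Sum>b\<in>Basis. pd b (pd b (sol t f)) x) = (\<Sum>b\<in>Basis. pd b (pd b (N f)) x)" by simp
  also have "\<dots> = f x - smear \<phi> r0 f x"
    unfolding N_def by (rule laplacian_dyadic_sum[OF \<alpha> r0 \<psi> \<phi> lap one f])
  finally show ?thesis .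
qed

end

text \<open>\<open>M0\<close> and \<open>LA\<close> are a bound and a Lipschitz constant of
  \<open>A\<close> within distance 1 of the prescribed 1-jet, and \<open>CL\<close> is the cost of
  assembling a gradient from its partial derivatives. Of the conditions in \<open>r0_small\<close>,
  the first two keep the potential from leaving this neighbourhood, the third makes the map
  contract, the fourth keeps the probe nonzero and the fifth makes it injective in \<tau>. \<tau>0
  and \<open>r0\<close> do not involve \<open>R\<close>.\<close>

locale semilinear_problem = semilinear_ansatz \<alpha> r0 K \<psi> \<phi> L c0 c1 b1 b2 e
  for \<alpha> r0 K and \<psi> \<phi> :: "'a::euclidean_space \<Rightarrow> real"
    and L :: "'a \<Rightarrow> 'b::euclidean_space \<Rightarrow> 'q::euclidean_space"
    and c0 c1 b1 b2 e +
  fixes A :: "'a \<times> 'b \<times> 'q \<Rightarrow> 'b" and k :: enat and CL LA M0 M C1 \<tau>0 R S :: real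
    and \<zeta> :: "'a \<Rightarrow> real"
  assumes CL: "CL \<ge> 0"
      "\<And>P B. (\<And>b. b \<in> Basis \<Longrightarrow> norm (P b) \<le> B) \<Longrightarrow> norm (\<Sum>b\<in>Basis. L b (P b)) \<le> CL * B"
    and A_CH: "\<And>m. enat m \<le> k \<Longrightarrow> CH \<alpha> m A" and k: "1 \<le> k"
    and A_bound: "\<And>x p q. norm x \<le> 1 \<Longrightarrow> norm (p - c0) \<le> 1 \<Longrightarrow>
      norm (q - (\<Sum>b\<in>Basis. L b (c1 b))) \<le> 1 \<Longrightarrow> norm (A (x, p, q)) \<le> M0"
    and LA: "LA \<ge> 0"
    and A_lipschitz: "\<And>x p q p' q'. norm x \<le> 1 \<Longrightarrow> norm (p - c0) \<le> 1 \<Longrightarrow>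
      norm (q - (\<Sum>b\<in>Basis. L b (c1 b))) \<le> 1 \<Longrightarrow> norm (p' - c0) \<le> 1 \<Longrightarrow>
      norm (q' - (\<Sum>b\<in>Basis. L b (c1 b))) \<le> 1 \<Longrightarrow>
      norm (A (x, p, q) - A (x, p', q')) \<le> LA * (norm (p - p') + norm (q - q'))"
    and M: "M0 \<ge> 0" "M = 2 * M0 + 1"
    and C1: "\<And>b. b \<in> Basis \<Longrightarrow> norm (c1 b) \<le> C1"
    and \<tau>0: "0 < \<tau>0" "8 * \<tau>0 \<le> 1 / 2" "CL * (8 * \<tau>0) \<le> 1 / 2"
    and r0_small: "4 * r0 * K * M \<le> 1 / 2" "CL * (4 * r0 * K * M) \<le> 1 / 2"
      "LA * (DIM('a) + CL) * (4 * r0 * K) \<le> 1 / 4"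
      "4 * DIM('a) * r0 * K * M < \<tau>0"
      "8 * DIM('a) * r0 * K * (4 * LA * (DIM('a) + CL)) < 1"
    and R: "0 < R" "2 * R \<le> 1" "DIM('a) * (C1 + 1) * (2 * R) \<le> 1"
    and S: "\<And>z. \<bar>\<phi> z\<bar> \<le> S" "S * measure lborel (cball 0 (2 * R / r0) :: 'a set) \<le> 1 / 4"
    and \<zeta>: "\<And>m. CH \<alpha> m \<zeta>" "\<And>x. norm x \<le> R \<Longrightarrow> \<zeta> x = 1" "\<And>x. norm x \<ge> 2 * R \<Longrightarrow> \<zeta> x = 0"
      "\<And>x. 0 \<le> \<zeta> x \<and> \<zeta> x \<le> 1"
begin

section \<open>Bounds for the ansatz on the ball of radius 2R\<close>

abbreviation adm :: "('a \<Rightarrow> 'b) \<Rightarrow> bool" where "adm \<equiv> admissible M (2 * R)"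

lemma
  assumes "adm f"
  shows adm_cont: "continuous_on UNIV f" and adm_bound: "norm (f x) \<le> M"
    and adm_vanish: "norm x > 2 * R \<Longrightarrow> f x = 0"
  using assms by (auto simp: admissible_def)

lemma M_pos: "M > 0" using M by simp
lemma K_nonneg: "K \<ge> 0" by (rule bump_kernel_nonneg[OF \<psi>])
lemma C1_nonneg: "C1 \<ge> 0" using order_trans[OF norm_ge_zero C1[OF b12(1)]] .

text \<open>The reason for dividing the amplitude by R: on the ball of radius 2R the gradient of the
  quadratic term is bounded independently of R.\<close>

lemma tdharm_bound:
  assumes "norm x \<le> 2 * R" "b \<in> Basis"
  shows "norm ((s / R) *\<^sub>R dharm b x) \<le> 4 * \<bar>s\<bar>"
proof -
  have "norm ((s / R) *\<^sub>R dharm b x) \<le> \<bar>s\<bar> / R * (2 * (2 * R))"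
    using dharm_bound[OF assms(2), of x] assms(1) R
    by (simp add: abs_divide del: times_divide_eq_left) (intro mult_left_mono, auto)
  then show ?thesis using R by simp
qed

text \<open>Half of the unit allowance for the gradient is granted to the quadratic term (4 \<tau>
  <= 8 \<tau>0) and half to the potential. The value then stays close to \<open>c0\<close> by
  integrating a gradient of size at most C1 + 1 over a length of at most 2R.\<close>

lemma sol_in_domain:
  assumes f: "adm f" and \<tau>: "\<tau>0 \<le> \<tau>" "\<tau> \<le> 2 * \<tau>0" and x: "norm x \<le> 2 * R"
  shows "norm x \<le> 1" "norm (sol (\<tau> / R) f x - c0) \<le> 1"
    "norm (jac L (sol (\<tau> / R) f) x - (\<Sum>b\<in>Basis. L b (c1 b))) \<le> 1"
proof -
  let ?U = "sol (\<tau> / R) f"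
  show "norm x \<le> 1" using x R by simp
  define g where "g = 8 * \<tau>0 + 4 * r0 * K * M"
  have pd: "norm (pd b ?U y - c1 b) \<le> g" if b: "b \<in> Basis" and y: "norm y \<le> 2 * R" for b y
  proof -
    have "pd b ?U y - c1 b = (\<tau> / R) *\<^sub>R dharm b y + (DN f b y - DN f b 0)"
      using pd_sol[OF adm_cont[OF f] adm_bound[OF f] b] by simp
    also have "norm \<dots> \<le> 4 * \<bar>\<tau>\<bar> + (2 * r0 * K * M + 2 * r0 * K * M)"
      by (intro order_trans[OF norm_triangle_ineq] order_trans[OF norm_triangle_ineq4] add_mono
          tdharm_bound y b DN_bound[OF adm_cont[OF f] adm_bound[OF f] b])
    finally show ?thesis using \<tau> \<tau>0(1) unfolding g_def by linarith
  qed
  have "jac L ?U x - (\<Sum>b\<in>Basis. L b (c1 b)) = (\<Sum>b\<in>Basis. L b (pd b ?U x - c1 b))"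
    by (simp add: jac_def sum_subtractf linear_diff[OF bounded_linear.linear[OF L]])
  also have "norm \<dots> \<le> CL * g" by (rule CL(2)) (rule pd[OF _ x])
  also have "\<dots> \<le> 1" using \<tau>0(3) r0_small(2) by (simp add: g_def distrib_left)
  finally show "norm (jac L ?U x - (\<Sum>b\<in>Basis. L b (c1 b))) \<le> 1" .
  have "norm (?U x - ?U 0) \<le> DIM('a) * (C1 + 1) * norm (x - 0)"
  proof (rule lipschitz_if_pd_bounded[OF convex_cball, of 0 "2 * R"])
    show "?U differentiable at y" for y by (rule sol_differentiable[OF adm_cont[OF f] adm_bound[OF f]])
    show "norm (pd b ?U y) \<le> C1 + 1" if "y \<in> cball 0 (2 * R)" "b \<in> Basis" for y b
    proof -
      have "norm (pd b ?U y) \<le> norm (c1 b) + norm (pd b ?U y - c1 b)"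
        using norm_triangle_ineq[of "c1 b" "pd b ?U y - c1 b"] by simp
      then show ?thesis
        using pd[OF that(2), of y] that(1) C1[OF that(2)] \<tau>0(2) r0_small(1) by (simp add: g_def)
    qed
  qed (use x R in auto)
  also have "\<dots> \<le> DIM('a) * (C1 + 1) * (2 * R)"
    using x C1_nonneg by (intro mult_left_mono) auto
  finally show "norm (?U x - c0) \<le> 1" using R(3) by (simp add: sol_0)
qed

text \<open>Changes of \<open>f\<close> and of the parameter are treated at once, for use both in
  the contraction and in the dependence on \<tau>. Both ansatz functions equal \<open>c0\<close> at
  0, so a gradient bound also controls the difference of the values.\<close>

lemma sol_diff:
  fixes \<tau> \<sigma> \<delta> G :: real
  assumes f: "adm f" and g: "adm g" and \<delta>: "\<And>x. norm (f x - g x) \<le> \<delta>"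
    and x: "norm x \<le> 2 * R"
  defines "G \<equiv> 4 * \<bar>\<tau> - \<sigma>\<bar> + 4 * r0 * K * \<delta>"
  shows "norm (sol (\<tau> / R) f x - sol (\<sigma> / R) g x) \<le> DIM('a) * G"
    and "norm (jac L (sol (\<tau> / R) f) x - jac L (sol (\<sigma> / R) g) x) \<le> CL * G"
proof -
  let ?U = "sol (\<tau> / R) f" and ?V = "sol (\<sigma> / R) g"
  define h where "h = (\<lambda>y. f y - g y)"
  have hc: "continuous_on UNIV h" unfolding h_def
    by (intro continuous_on_diff adm_cont[OF f] adm_cont[OF g])
  have h\<delta>: "norm (h y) \<le> \<delta>" for y using \<delta> by (simp add: h_def)
  have "\<delta> \<ge> 0" using order_trans[OF norm_ge_zero \<delta>] .
  then have G: "G \<ge> 0" using K_nonneg r0 by (simp add: G_def)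
  have pd: "norm (pd b ?U y - pd b ?V y) \<le> G" if b: "b \<in> Basis" and y: "norm y \<le> 2 * R" for b y
  proof -
    have DNh: "DN h b z = DN f b z - DN g b z" for z
      unfolding h_def by (rule DN_diff[OF adm_cont[OF f] adm_bound[OF f] adm_cont[OF g] adm_bound[OF g] b])
    have "pd b ?U y - pd b ?V y = ((\<tau> - \<sigma>) / R) *\<^sub>R dharm b y + (DN h b y - DN h b 0)"
      using pd_sol[OF adm_cont[OF f] adm_bound[OF f] b] pd_sol[OF adm_cont[OF g] adm_bound[OF g] b]
      by (simp add: DNh diff_divide_distrib scaleR_diff_left)
    also have "norm \<dots> \<le> 4 * \<bar>\<tau> - \<sigma>\<bar> + (2 * r0 * K * \<delta> + 2 * r0 * K * \<delta>)"
      by (intro order_trans[OF norm_triangle_ineq] order_trans[OF norm_triangle_ineq4] add_mono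
          tdharm_bound y b DN_bound[OF hc h\<delta> b])
    finally show ?thesis unfolding G_def by linarith
  qed
  have "jac L ?U x - jac L ?V x = (\<Sum>b\<in>Basis. L b (pd b ?U x - pd b ?V x))"
    by (simp add: jac_def sum_subtractf linear_diff[OF bounded_linear.linear[OF L]])
  also have "norm \<dots> \<le> CL * G" by (rule CL(2)) (rule pd[OF _ x])
  finally show "norm (jac L ?U x - jac L ?V x) \<le> CL * G" .
  define D where "D = (\<lambda>y. ?U y - ?V y)"
  have d: "?U differentiable at y" "?V differentiable at y" for y
    by (rule sol_differentiable[OF adm_cont[OF f] adm_bound[OF f]]
        sol_differentiable[OF adm_cont[OF g] adm_bound[OF g]])+
  have "norm (D x - D 0) \<le> DIM('a) * G * norm (x - 0)"
  proof (rule lipschitz_if_pd_bounded[OF convex_cball, of 0 "2 * R"])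
    show "D differentiable at y" for y unfolding D_def by (intro differentiable_diff d)
    show "norm (pd b D y) \<le> G" if "y \<in> cball 0 (2 * R)" "b \<in> Basis" for y b
    proof -
      have "pd b D y = pd b ?U y - pd b ?V y"
        using pd_eqI[OF has_derivative_diff[OF has_derivative_pd[OF d(1)] has_derivative_pd[OF d(2)]], of b y]
        unfolding D_def sum_Basis_inner[OF that(2)] .
      then show ?thesis using pd[OF that(2), of y] that(1) by simp
    qed
  qed (use x R in auto)
  also have "\<dots> \<le> DIM('a) * G * 1"
    using x R G by (intro mult_left_mono) auto
  finally show "norm (?U x - ?V x) \<le> DIM('a) * G" by (simp add: D_def sol_0)
qed

text \<open>The Laplacian of the ansatz is \<open>f\<close> minus its average at scale
  \<open>r0\<close>; adding this average back makes a fixed point satisfy the equation wherever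
  \<zeta> = 1.\<close>

definition F :: "real \<Rightarrow> ('a \<Rightarrow> 'b) \<Rightarrow> 'a \<Rightarrow> 'b" where
  "F \<tau> f x = \<zeta> x *\<^sub>R (A (x, sol (\<tau> / R) f x, jac L (sol (\<tau> / R) f) x) + smear \<phi> r0 f x)"

lemma smear_adm:
  assumes "continuous_on UNIV f" "\<And>x. norm (f x) \<le> \<delta>" "\<And>x. norm x > 2 * R \<Longrightarrow> f x = 0"
  shows "norm (smear \<phi> r0 f x) \<le> \<delta> / 4"
proof -
  have "\<delta> \<ge> 0" using order_trans[OF norm_ge_zero assms(2)] .
  have "norm (smear \<phi> r0 f x) \<le> S * \<delta> * measure lborel (cball 0 (2 * R / r0) :: 'a set)"
    by (rule smear_small[OF bump_kernel_continuous[OF \<alpha>(1) \<alpha>1 \<phi>] S(1) assms(1,2) _ r0(1)]) (rule assms(3))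
  also have "\<dots> \<le> \<delta> * (1 / 4)"
    using mult_left_mono[OF S(2) \<open>\<delta> \<ge> 0\<close>] by (simp add: mult_ac)
  finally show ?thesis by simp
qed

lemma CH_arg:
  assumes "CH \<alpha> (Suc m) U"
  shows "CH \<alpha> m (\<lambda>x. (x, U x, jac L U x))"
  by (intro CH_Pair[OF \<alpha>(1) \<alpha>1] CH_ident[OF \<alpha>(1) \<alpha>1] CH_Suc_imp[OF \<alpha>(1) \<alpha>1 assms] CH_jac assms)

text \<open>For merely continuous bounded \<open>f\<close> the gradient of the ansatz is already
  Hoelder, and \<open>A\<close> is locally Lipschitz because \<open>1 \<le> k\<close>. One
  application of the map thus turns continuity into Hoelder continuity, which starts the regularity
  argument.\<close>

lemma CH_F_0:
  assumes f: "adm f"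
  shows "CH \<alpha> 0 (F \<tau> f)"
proof -
  have "CH \<alpha> (Suc 0) A" using A_CH[of "Suc 0"] k by (simp add: one_enat_def)
  from CH_0_compose[OF \<alpha>(1) \<alpha>1 this CH_arg[OF CH_sol_1[OF adm_cont[OF f] adm_bound[OF f]]]]
  have 1: "CH \<alpha> 0 (\<lambda>x. A (x, sol (\<tau> / R) f x, jac L (sol (\<tau> / R) f) x))" by simp
  have 2: "CH \<alpha> 0 (smear \<phi> r0 f)"
    by (rule smear_CH_0[OF \<alpha> r0 \<phi> adm_cont[OF f] adm_bound[OF f] r0(1)])
  show ?thesis unfolding F_def
    by (rule CH_scaleR[OF \<alpha>(1) \<alpha>1 \<zeta>(1) CH_add[OF \<alpha>(1) \<alpha>1 1 2]])
qed

lemma F_adm: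
  assumes f: "adm f" and \<tau>: "\<tau>0 \<le> \<tau>" "\<tau> \<le> 2 * \<tau>0"
  shows "adm (F \<tau> f)"
  unfolding admissible_def
proof (intro conjI allI impI)
  show "continuous_on UNIV (F \<tau> f)" by (rule CH_continuous[OF \<alpha>(1) \<alpha>1 CH_F_0[OF f]])
  show z: "F \<tau> f x = 0" if "norm x > 2 * R" for x using \<zeta>(3)[of x] that by (simp add: F_def)
  show "norm (F \<tau> f x) \<le> M" for x
  proof (cases "norm x > 2 * R")
    case False
    then have x: "norm x \<le> 2 * R" by simp
    have "norm (A (x, sol (\<tau> / R) f x, jac L (sol (\<tau> / R) f) x) + smear \<phi> r0 f x) \<le> M0 + M / 4"
      by (intro order_trans[OF norm_triangle_ineq] add_mono A_bound sol_in_domain[OF f \<tau> x]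
          smear_adm[OF adm_cont[OF f] adm_bound[OF f] adm_vanish[OF f]])
    \<comment> \<open>This is the purpose of M = 2 M0 + 1: it leaves room for the quarter of M
      coming from the average.\<close>
    also have "\<dots> \<le> M" using M by simp
    finally have "\<bar>\<zeta> x\<bar> * norm (A (x, sol (\<tau> / R) f x, jac L (sol (\<tau> / R) f) x) + smear \<phi> r0 f x) \<le> 1 * M"
      using \<zeta>(4)[of x] by (intro mult_mono) auto
    then show ?thesis by (simp add: F_def)
  qed (use z M_pos in simp)
qed

text \<open>The contraction factor 1/2 is made of 1/4 from the potential inside \<open>A\<close>
  (small \<open>r0\<close>) and 1/4 from the average (\<open>R\<close> small against
  \<open>r0\<close>).\<close>

lemma F_diff:
  assumes f: "adm f" and g: "adm g" and \<delta>: "\<And>x. norm (f x - g x) \<le> \<delta>"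
    and \<tau>: "\<tau>0 \<le> \<tau>" "\<tau> \<le> 2 * \<tau>0" and \<sigma>: "\<tau>0 \<le> \<sigma>" "\<sigma> \<le> 2 * \<tau>0"
  shows "norm (F \<tau> f x - F \<sigma> g x) \<le> 4 * LA * (DIM('a) + CL) * \<bar>\<tau> - \<sigma>\<bar> + \<delta> / 2"
proof (cases "norm x > 2 * R")
  case True
  have "\<delta> \<ge> 0" using order_trans[OF norm_ge_zero \<delta>] .
  then show ?thesis using \<zeta>(3)[of x] True LA CL(1) by (simp add: F_def)
next
  case False
  then have x: "norm x \<le> 2 * R" by simp
  have "\<delta> \<ge> 0" using order_trans[OF norm_ge_zero \<delta>] .
  let ?a = "A (x, sol (\<tau> / R) f x, jac L (sol (\<tau> / R) f) x)"
    and ?b = "A (x, sol (\<sigma> / R) g x, jac L (sol (\<sigma> / R) g) x)"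
  define G where "G = 4 * \<bar>\<tau> - \<sigma>\<bar> + 4 * r0 * K * \<delta>"
  have "norm (?a - ?b) \<le> LA * (norm (sol (\<tau> / R) f x - sol (\<sigma> / R) g x)
      + norm (jac L (sol (\<tau> / R) f) x - jac L (sol (\<sigma> / R) g) x))"
    by (intro A_lipschitz sol_in_domain[OF f \<tau> x] sol_in_domain[OF g \<sigma> x])
  also have "\<dots> \<le> LA * (DIM('a) * G + CL * G)"
    unfolding G_def by (intro mult_left_mono add_mono sol_diff[OF f g \<delta> x] LA)
  also have "\<dots> = 4 * LA * (DIM('a) + CL) * \<bar>\<tau> - \<sigma>\<bar> + LA * (DIM('a) + CL) * (4 * r0 * K) * \<delta>"
    by (simp add: G_def algebra_simps)
  also have "\<dots> \<le> 4 * LA * (DIM('a) + CL) * \<bar>\<tau> - \<sigma>\<bar> + (1 / 4) * \<delta>"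
    using mult_right_mono[OF r0_small(3) \<open>\<delta> \<ge> 0\<close>] by simp
  finally have 1: "norm (?a - ?b) \<le> 4 * LA * (DIM('a) + CL) * \<bar>\<tau> - \<sigma>\<bar> + (1 / 4) * \<delta>" .
  have "smear \<phi> r0 f x - smear \<phi> r0 g x = smear \<phi> r0 (\<lambda>y. f y - g y) x"
    by (rule smear_diff[OF \<phi> \<alpha>(1) \<alpha>1 adm_cont[OF f] adm_cont[OF g], symmetric])
  also have "norm \<dots> \<le> \<delta> / 4"
  proof (rule smear_adm)
    show "continuous_on UNIV (\<lambda>y. f y - g y)" by (intro continuous_on_diff adm_cont[OF f] adm_cont[OF g])
    show "f y - g y = 0" if "norm y > 2 * R" for y using adm_vanish[OF f that] adm_vanish[OF g that] by simp
  qed (rule \<delta>)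
  finally have 2: "norm (smear \<phi> r0 f x - smear \<phi> r0 g x) \<le> \<delta> / 4" .
  have eq: "F \<tau> f x - F \<sigma> g x = \<zeta> x *\<^sub>R ((?a - ?b) + (smear \<phi> r0 f x - smear \<phi> r0 g x))"
    by (simp add: F_def algebra_simps)
  have 3: "norm (F \<tau> f x - F \<sigma> g x) \<le> 1 * (norm (?a - ?b) + norm (smear \<phi> r0 f x - smear \<phi> r0 g x))"
    unfolding eq norm_scaleR
  proof (rule mult_mono[OF _ norm_triangle_ineq])
    show "\<bar>\<zeta> x\<bar> \<le> 1" using \<zeta>(4)[of x] by simp
  qed simp_all
  have "r \<le> B + \<delta> / 2" if "r \<le> 1 * (p + q)" "p \<le> B + (1 / 4) * \<delta>" "q \<le> \<delta> / 4" for p q r B :: real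
    using that by simp
  from this[OF 3 1 2] show ?thesis .
qed

lemma fixed_point_exists:
  assumes \<tau>: "\<tau>0 \<le> \<tau>" "\<tau> \<le> 2 * \<tau>0"
  shows "\<exists>f. adm f \<and> F \<tau> f = f"
proof (rule bounded_continuous_fixed_point)
  show "adm (F \<tau> f)" if "adm f" for f by (rule F_adm[OF that \<tau>])
  show "norm (F \<tau> f x - F \<tau> g x) \<le> \<delta> / 2"
    if "adm f" "adm g" "\<And>x. norm (f x - g x) \<le> \<delta>" for f g \<delta> x
    using F_diff[OF that \<tau> \<tau>, of x] by simp
qed (use M_pos in simp)

text \<open>Bootstrap: if \<open>f\<close> has order m, the ansatz has order m + 2 and its gradient
  m + 1, so \<open>A\<close> along it, and hence \<open>f\<close>, has order m + 1 as long as
  \<open>k\<close> permits.\<close>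

lemma fixed_point_regular:
  assumes f: "adm f" "F \<tau> f = f"
  shows "enat m \<le> k \<Longrightarrow> CH \<alpha> m f"
proof (induction m)
  case 0
  then show ?case using CH_F_0[OF f(1), of \<tau>] f(2) by simp
next
  case (Suc m)
  have fm: "CH \<alpha> m f"
    using Suc.prems by (intro Suc.IH) (metis Suc_ile_eq order_less_imp_le)
  have 1: "CH \<alpha> (Suc m) (\<lambda>x. (x, sol (\<tau> / R) f x, jac L (sol (\<tau> / R) f) x))"
    by (rule CH_arg[OF CH_sol_Suc_Suc[OF fm adm_vanish[OF f(1)]]])
  have m1: "max 1 (Suc m) = Suc m" by simp
  from CH_compose[OF \<alpha>(1) \<alpha>1 A_CH[OF Suc.prems], unfolded m1, OF 1]
  have 2: "CH \<alpha> (Suc m) (\<lambda>x. A (x, sol (\<tau> / R) f x, jac L (sol (\<tau> / R) f) x))" .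
  have 3: "CH \<alpha> (Suc m) (smear \<phi> r0 f)"
    by (rule smear_CH[OF \<alpha> r0 \<phi> r0(1) fm adm_vanish[OF f(1)]])
  have "CH \<alpha> (Suc m) (F \<tau> f)" unfolding F_def
    by (rule CH_scaleR[OF \<alpha>(1) \<alpha>1 \<zeta>(1) CH_add[OF \<alpha>(1) \<alpha>1 2 3]])
  then show ?case using f(2) by simp
qed

lemma fixed_point_solves:
  assumes f: "adm f" "F \<tau> f = f" and x: "norm x \<le> R"
  shows "(\<Sum>b\<in>Basis. pd b (pd b (sol (\<tau> / R) f)) x) = A (x, sol (\<tau> / R) f x, jac L (sol (\<tau> / R) f) x)"
proof -
  have "CH \<alpha> 0 f" by (rule fixed_point_regular[OF f]) (simp add: zero_enat_def[symmetric])
  from laplacian_sol[OF this adm_vanish[OF f(1)]]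
  have "(\<Sum>b\<in>Basis. pd b (pd b (sol (\<tau> / R) f)) x) = f x - smear \<phi> r0 f x" by blast
  also have "f x = F \<tau> f x" using f(2) by simp
  also have "\<dots> = A (x, sol (\<tau> / R) f x, jac L (sol (\<tau> / R) f) x) + smear \<phi> r0 f x"
    using \<zeta>(2)[OF x] by (simp add: F_def)
  finally show ?thesis by simp
qed

lemma fixed_points_lipschitz:
  assumes f: "adm f" "F \<tau> f = f" and g: "adm g" "F \<sigma> g = g"
    and \<tau>: "\<tau>0 \<le> \<tau>" "\<tau> \<le> 2 * \<tau>0" and \<sigma>: "\<tau>0 \<le> \<sigma>" "\<sigma> \<le> 2 * \<tau>0"
  shows "norm (f x - g x) \<le> 2 * (4 * LA * (DIM('a) + CL) * \<bar>\<tau> - \<sigma>\<bar>)"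
proof (rule half_contraction_bound[of "\<lambda>x. norm (f x - g x)"])
  show "norm (f x - g x) \<le> 2 * M" for x
    using norm_triangle_ineq4[of "f x" "g x"] adm_bound[OF f(1), of x] adm_bound[OF g(1), of x] by simp
  show "norm (f x - g x) \<le> 4 * LA * (DIM('a) + CL) * \<bar>\<tau> - \<sigma>\<bar> + \<delta> / 2"
    if "\<And>x. norm (f x - g x) \<le> \<delta>" for \<delta> x
    using F_diff[OF f(1) g(1) that \<tau> \<sigma>, of x] f(2) g(2) by simp
qed

section \<open>The second difference: nonvanishing and injectivity in the parameter\<close>

lemma inner_b12: "b1 \<bullet> b2 = 0" "b2 \<bullet> b1 = 0" "b1 \<bullet> b1 = 1" "b2 \<bullet> b2 = 1"
  using b12 by (auto simp: inner_Basis)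

text \<open>Constants cancel by the signs, linear parts because the points come in antipodal pairs.
  The four values of \<open>harm\<close> add up to R^2 e, which the amplitude \<tau>/R turns into
  \<tau> R e.\<close>

lemma probe_sol: "probe R b1 b2 (sol (\<tau> / R) f) = (\<tau> * R) *\<^sub>R e + probe R b1 b2 (N f)"
proof -
  define p q where "p = (R / 2) *\<^sub>R (b1 + b2)" and "q = (R / 2) *\<^sub>R (b1 - b2)"
  have h: "harm p = (R / 2)\<^sup>2 *\<^sub>R e" "harm (- p) = (R / 2)\<^sup>2 *\<^sub>R e"
    "harm q = - ((R / 2)\<^sup>2 *\<^sub>R e)" "harm (- q) = - ((R / 2)\<^sup>2 *\<^sub>R e)"
    by (simp_all add: harm_def p_def q_def inner_add_left inner_diff_left inner_b12 power2_eq_square)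
  have l: "(\<Sum>b\<in>Basis. (- y \<bullet> b) *\<^sub>R C b) = - (\<Sum>b\<in>Basis. (y \<bullet> b) *\<^sub>R C b)" for y :: 'a and C :: "'a \<Rightarrow> 'b"
    by (simp add: sum_negf)
  have "probe R b1 b2 (sol (\<tau> / R) f) = (\<tau> / R) *\<^sub>R (harm p + harm (- p) - harm q - harm (- q))
      + (N f p + N f (- p) - N f q - N f (- q))"
    unfolding probe_def p_def[symmetric] q_def[symmetric] sol_def l
    by (simp add: scaleR_add_right scaleR_diff_right)
  also have "harm p + harm (- p) - harm q - harm (- q) = R\<^sup>2 *\<^sub>R e"
    by (simp add: h power2_eq_square flip: scaleR_add_left)
  finally show ?thesis
    using R by (simp add: probe_def p_def q_def power2_eq_square)
qed

text \<open>The four values are paired with opposite signs at distance R, so the Lipschitz bound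
  gives one factor R and the small factor \<open>r0\<close>.\<close>

lemma probe_N_bound:
  assumes "continuous_on UNIV f" "\<And>x. norm (f x) \<le> \<delta>"
  shows "norm (probe R b1 b2 (N f)) \<le> 4 * DIM('a) * r0 * K * \<delta> * R"
proof -
  define p q where "p = (R / 2) *\<^sub>R (b1 + b2)" and "q = (R / 2) *\<^sub>R (b1 - b2)"
  have "p - q = R *\<^sub>R b2" "- p - - q = - (R *\<^sub>R b2)"
    by (simp_all add: p_def q_def algebra_simps flip: scaleR_add_left)
  then have n: "norm (p - q) = R" "norm (- p - - q) = R" using R b12 by (simp_all del: minus_diff_minus)
  have "probe R b1 b2 (N f) = (N f p - N f q) + (N f (- p) - N f (- q))"
    by (simp add: probe_def p_def q_def)
  also have "norm \<dots> \<le> DIM('a) * (2 * r0 * K * \<delta>) * R + DIM('a) * (2 * r0 * K * \<delta>) * R"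
    using N_lipschitz[OF assms, of p q] N_lipschitz[OF assms, of "- p" "- q"]
    unfolding n by (intro order_trans[OF norm_triangle_ineq] add_mono)
  finally show ?thesis by (simp add: algebra_simps)
qed

lemma probe_nonzero:
  assumes f: "adm f" and \<tau>: "\<tau>0 \<le> \<tau>"
  shows "probe R b1 b2 (sol (\<tau> / R) f) \<noteq> 0"
proof
  assume "probe R b1 b2 (sol (\<tau> / R) f) = 0"
  then have "(\<tau> * R) *\<^sub>R e = - probe R b1 b2 (N f)" by (simp add: probe_sol eq_neg_iff_add_eq_0)
  then have "norm ((\<tau> * R) *\<^sub>R e) = norm (probe R b1 b2 (N f))" by (simp only: norm_minus_cancel)
  then have "\<tau> * R = norm (probe R b1 b2 (N f))" using e R \<tau> \<tau>0(1) by simp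
  also have "\<dots> \<le> 4 * DIM('a) * r0 * K * M * R"
    by (rule probe_N_bound[OF adm_cont[OF f] adm_bound[OF f]])
  finally have "\<tau> \<le> 4 * DIM('a) * r0 * K * M" using R(1) mult_le_cancel_right by fastforce
  then show False using r0_small(4) \<tau> by simp
qed

text \<open>If the probes agreed, |\<tau> - \<sigma>| R would equal the norm of the probe of the
  potential of f - g. As f - g is O(|\<tau> - \<sigma>|), that is a small multiple of |\<tau> -
  \<sigma>| R, which is impossible for \<tau> \<noteq> \<sigma>.\<close>

lemma probe_inj:
  assumes f: "adm f" "F \<tau> f = f" and g: "adm g" "F \<sigma> g = g"
    and \<tau>: "\<tau>0 \<le> \<tau>" "\<tau> \<le> 2 * \<tau>0" and \<sigma>: "\<tau>0 \<le> \<sigma>" "\<sigma> \<le> 2 * \<tau>0"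
    and eq: "probe R b1 b2 (sol (\<tau> / R) f) = probe R b1 b2 (sol (\<sigma> / R) g)"
  shows "\<tau> = \<sigma>"
proof (rule ccontr)
  assume ne: "\<tau> \<noteq> \<sigma>"
  define h where "h = (\<lambda>y. f y - g y)"
  have hc: "continuous_on UNIV h" unfolding h_def
    by (intro continuous_on_diff adm_cont[OF f(1)] adm_cont[OF g(1)])
  have hb: "norm (h y) \<le> 2 * (4 * LA * (DIM('a) + CL) * \<bar>\<tau> - \<sigma>\<bar>)" for y
    unfolding h_def by (rule fixed_points_lipschitz[OF f g \<tau> \<sigma>])
  have Nh: "N h y = N f y - N g y" for y
    unfolding h_def by (rule N_diff[OF adm_cont[OF f(1)] adm_bound[OF f(1)] adm_cont[OF g(1)] adm_bound[OF g(1)]])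
  have "(\<tau> * R) *\<^sub>R e - (\<sigma> * R) *\<^sub>R e = - probe R b1 b2 (N h)"
    using eq unfolding probe_sol by (simp add: probe_def Nh algebra_simps)
  then have "((\<tau> - \<sigma>) * R) *\<^sub>R e = - probe R b1 b2 (N h)" by (simp add: algebra_simps)
  then have "norm (((\<tau> - \<sigma>) * R) *\<^sub>R e) = norm (probe R b1 b2 (N h))" by (simp only: norm_minus_cancel)
  then have "\<bar>\<tau> - \<sigma>\<bar> * R = norm (probe R b1 b2 (N h))" using e R by (simp add: abs_mult)
  also have "\<dots> \<le> 4 * DIM('a) * r0 * K * (2 * (4 * LA * (DIM('a) + CL) * \<bar>\<tau> - \<sigma>\<bar>)) * R"
    by (rule probe_N_bound[OF hc hb])
  also have "\<dots> = (8 * DIM('a) * r0 * K * (4 * LA * (DIM('a) + CL))) * (\<bar>\<tau> - \<sigma>\<bar> * R)"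
    by simp
  also have "\<dots> < 1 * (\<bar>\<tau> - \<sigma>\<bar> * R)"
    using r0_small(5) ne R(1) by (intro mult_strict_right_mono) auto
  finally show False by simp
qed

text \<open>Nonvanishing and injectivity are stated for the probe instead of \<open>U\<close>
  itself: it reads only four points of the ball and therefore survives restriction to the
  ball.\<close>

theorem solution_family:
  "\<exists>U. (\<forall>\<tau>\<in>{\<tau>0..2 * \<tau>0}.
      (\<forall>m. enat m \<le> k \<longrightarrow> CH \<alpha> (Suc (Suc m)) (U \<tau>)) \<and>
      (\<forall>x\<in>cball 0 R. (\<Sum>b\<in>Basis. pd b (pd b (U \<tau>)) x) = A (x, U \<tau> x, jac L (U \<tau>) x)) \<and>
      U \<tau> 0 = c0 \<and> (\<forall>b\<in>Basis. pd b (U \<tau>) 0 = c1 b) \<and> probe R b1 b2 (U \<tau>) \<noteq> 0) \<and>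
    inj_on (\<lambda>\<tau>. probe R b1 b2 (U \<tau>)) {\<tau>0..2 * \<tau>0}"
proof -
  have "\<forall>\<tau>\<in>{\<tau>0..2 * \<tau>0}. \<exists>f. adm f \<and> F \<tau> f = f" using fixed_point_exists by simp
  then obtain f where "\<forall>\<tau>\<in>{\<tau>0..2 * \<tau>0}. adm (f \<tau>) \<and> F \<tau> (f \<tau>) = f \<tau>" by (rule bchoice[THEN exE])
  then have f: "adm (f \<tau>)" "F \<tau> (f \<tau>) = f \<tau>" if "\<tau> \<in> {\<tau>0..2 * \<tau>0}" for \<tau> using that by auto
  define U where "U = (\<lambda>\<tau>. sol (\<tau> / R) (f \<tau>))"
  have "CH \<alpha> (Suc (Suc m)) (U \<tau>)" if "\<tau> \<in> {\<tau>0..2 * \<tau>0}" "enat m \<le> k" for \<tau> m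
    unfolding U_def
    by (rule CH_sol_Suc_Suc[OF fixed_point_regular[OF f[OF that(1)] that(2)] adm_vanish[OF f(1)[OF that(1)]]])
  moreover have "(\<Sum>b\<in>Basis. pd b (pd b (U \<tau>)) x) = A (x, U \<tau> x, jac L (U \<tau>) x)"
    if "\<tau> \<in> {\<tau>0..2 * \<tau>0}" "x \<in> cball 0 R" for \<tau> x
    unfolding U_def by (rule fixed_point_solves[OF f[OF that(1)]]) (use that(2) in simp)
  moreover have "U \<tau> 0 = c0" for \<tau> by (simp add: U_def sol_0)
  moreover have "pd b (U \<tau>) 0 = c1 b" if "\<tau> \<in> {\<tau>0..2 * \<tau>0}" "b \<in> Basis" for \<tau> b
    unfolding U_def by (rule pd_sol_0[OF adm_cont[OF f(1)[OF that(1)]] adm_bound[OF f(1)[OF that(1)]] that(2)])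
  moreover have "probe R b1 b2 (U \<tau>) \<noteq> 0" if "\<tau> \<in> {\<tau>0..2 * \<tau>0}" for \<tau>
    unfolding U_def by (rule probe_nonzero[OF f(1)[OF that]]) (use that in simp)
  moreover have "inj_on (\<lambda>\<tau>. probe R b1 b2 (U \<tau>)) {\<tau>0..2 * \<tau>0}"
  proof (rule inj_onI)
    fix \<tau> \<sigma> assume "\<tau> \<in> {\<tau>0..2 * \<tau>0}" "\<sigma> \<in> {\<tau>0..2 * \<tau>0}" "probe R b1 b2 (U \<tau>) = probe R b1 b2 (U \<sigma>)"
    then show "\<tau> = \<sigma>"
      using probe_inj[OF f[of \<tau>] f[of \<sigma>]] by (simp add: U_def)
  qed
  ultimately show ?thesis by (intro exI[of _ U]) blast
qed

end

section \<open>Choice of the constants\<close>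

lemma content_cball_shrinking:
  assumes "0 < r"
  shows "((\<lambda>R. measure lborel (cball 0 (2 * R / r) :: 'a::euclidean_space set)) \<longlongrightarrow> 0) (at_right 0)"
proof (rule Lim_transform_eventually)
  have "((\<lambda>R. unit_ball_vol (real DIM('a)) * (2 * R / r) ^ DIM('a))
      \<longlongrightarrow> unit_ball_vol (real DIM('a)) * (2 * 0 / r) ^ DIM('a)) (at_right 0)"
    using assms by (intro tendsto_intros) auto
  then show "((\<lambda>R. unit_ball_vol (real DIM('a)) * (2 * R / r) ^ DIM('a)) \<longlongrightarrow> 0) (at_right 0)"
    by (simp add: power_0_left)
  show "\<forall>\<^sub>F R in at_right 0. unit_ball_vol (real DIM('a)) * (2 * R / r) ^ DIM('a)
      = measure lborel (cball 0 (2 * R / r) :: 'a set)"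
    using eventually_at_right_less[of "0::real"]
  proof eventually_elim
    case (elim R)
    then show ?case using content_cball[of "2 * R / r" "0::'a"] assms by simp
  qed
qed

text \<open>Everything but \<open>R\<close> and the cutoff is fixed beforehand, so the remaining
  conditions hold for all sufficiently small \<open>R\<close> and not merely for some.\<close>

lemma small_solutions_exist:
  fixes A :: "'a::euclidean_space \<times> 'b::euclidean_space \<times> 'q::euclidean_space \<Rightarrow> 'b"
  assumes \<alpha>: "0 < \<alpha>" "\<alpha> < 1" and A_CH: "\<And>m. enat m \<le> k \<Longrightarrow> CH \<alpha> m A" and k: "1 \<le> k"
    and L: "\<And>b. bounded_linear (L b)"
    and b12: "b1 \<in> Basis" "b2 \<in> Basis" "b1 \<noteq> b2"
  shows "\<forall>\<^sub>F R in at_right 0. 0 < R \<and> (\<exists>U. \<exists>T :: real set. infinite T \<and>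
    (\<forall>\<tau>\<in>T.
      (\<forall>m. enat m \<le> k \<longrightarrow> CH \<alpha> (Suc (Suc m)) (U \<tau>)) \<and>
      (\<forall>x\<in>cball 0 R. (\<Sum>b\<in>Basis. pd b (pd b (U \<tau>)) x) = A (x, U \<tau> x, jac L (U \<tau>) x)) \<and>
      U \<tau> 0 = c0 \<and> (\<forall>b\<in>Basis. pd b (U \<tau>) 0 = c1 b) \<and> probe R b1 b2 (U \<tau>) \<noteq> 0) \<and>
    inj_on (\<lambda>\<tau>. probe R b1 b2 (U \<tau>)) T)"
proof -
  have \<alpha>1: "\<alpha> \<le> 1" using \<alpha> by simp
  obtain \<psi> \<phi> :: "'a \<Rightarrow> real" where \<psi>: "\<And>m. CH \<alpha> m \<psi>" and \<phi>: "\<And>m. CH \<alpha> m \<phi>"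
    and v: "\<And>x. norm x \<ge> 1 \<Longrightarrow> \<psi> x = 0" "\<And>x. norm x \<ge> 1 \<Longrightarrow> \<phi> x = 0"
    and lap: "\<And>x. (\<Sum>b\<in>Basis. pd b (pd b \<psi>) x) = 2 ^ DIM('a) * \<phi> (2 *\<^sub>R x) - \<phi> x"
    and one: "integral\<^sup>L lborel \<phi> = 1"
    by (rule dyadic_kernel_exists[OF \<alpha>(1) \<alpha>1]) (rule that; blast)
  obtain K1 where K1: "bump_kernel \<alpha> \<psi> K1"
    using bump_kernelI[OF \<alpha>(1) \<alpha>1 \<psi>] v(1) by (metis less_imp_le)
  obtain K2 where K2: "bump_kernel \<alpha> \<phi> K2"
    using bump_kernelI[OF \<alpha>(1) \<alpha>1 \<phi>] v(2) by (metis less_imp_le)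
  have "\<exists>K\<ge>0. \<forall>b\<in>Basis. bump_kernel \<alpha> (pd b \<psi>) K"
    by (rule bump_kernel_uniform[OF \<alpha>, of 1]) (use bump_kernel_pd[OF \<alpha>, of 1, OF _ _ K1] in auto)
  then obtain K3 where K3: "K3 \<ge> 0" "\<And>b. b \<in> Basis \<Longrightarrow> bump_kernel \<alpha> (pd b \<psi>) K3" by blast
  define K where "K = K1 + K2 + K3"
  have Knn: "K1 \<ge> 0" "K2 \<ge> 0" "K \<ge> 0"
    using bump_kernel_nonneg[OF K1] bump_kernel_nonneg[OF K2] K3(1) by (auto simp: K_def)
  have K: "bump_kernel \<alpha> \<psi> K" "bump_kernel \<alpha> \<phi> K" "\<And>b. b \<in> Basis \<Longrightarrow> bump_kernel \<alpha> (pd b \<psi>) K"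
    using Knn K3(1) bump_kernel_mono[OF K1] bump_kernel_mono[OF K2] bump_kernel_mono[OF K3(2)]
    by (auto simp: K_def)
  obtain S where S: "\<And>z. \<bar>\<phi> z\<bar> \<le> S"
    using CH_bounded_if_vanishing[OF \<alpha>(1) \<alpha>1 \<phi>, of 1] v(2) by auto
  have S0: "S \<ge> 0" using order_trans[OF abs_ge_zero S] .
  have "\<forall>b. \<exists>C\<ge>0. \<forall>y. norm (L b y) \<le> norm y * C"
    using bounded_linear.nonneg_bounded[OF L] by blast
  then obtain C where C: "\<And>b. C b \<ge> 0" "\<And>b y. norm (L b y) \<le> norm y * C b" by metis
  define CL where "CL = (\<Sum>b\<in>Basis. C b)"
  have CL0: "CL \<ge> 0" unfolding CL_def by (rule sum_nonneg) (rule C(1))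
  have CL: "norm (\<Sum>b\<in>Basis. L b (P b)) \<le> CL * B" if "\<And>b. b \<in> Basis \<Longrightarrow> norm (P b) \<le> B" for P B
  proof -
    have "norm (\<Sum>b\<in>Basis. L b (P b)) \<le> (\<Sum>b\<in>Basis. B * C b)"
      by (rule sum_norm_le) (rule order_trans[OF C(2) mult_right_mono[OF that C(1)]])
    then show ?thesis by (simp add: CL_def sum_distrib_left mult.commute)
  qed
  define c where "c = (\<Sum>b\<in>Basis. L b (c1 b))"
  \<comment> \<open>A compact convex neighbourhood of the prescribed 1-jet: compactness bounds
    \<open>A\<close>, and convexity turns bounded partial derivatives into a Lipschitz
    constant.\<close>
  define Z where "Z = cball (0::'a) 1 \<times> cball c0 1 \<times> cball c (1::real)"
  have Z: "compact Z" "convex Z" unfolding Z_def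
    by (intro compact_Times compact_cball) (intro convex_Times convex_cball)
  have Zmem: "(x, p, q) \<in> Z" if "norm x \<le> 1" "norm (p - c0) \<le> 1" "norm (q - c) \<le> 1" for x p q
    using that by (simp add: Z_def dist_norm norm_minus_commute)
  have A1: "CH \<alpha> (Suc 0) A" using A_CH[of "Suc 0"] k by (simp add: one_enat_def)
  have "bounded (A ` Z)"
    by (intro compact_imp_bounded compact_continuous_image[OF _ Z(1)]
        continuous_on_subset[OF CH_continuous[OF \<alpha>(1) \<alpha>1 A1]]) simp
  then obtain M' where M': "\<forall>y\<in>A ` Z. norm y \<le> M'" using bounded_iff by blast
  define M0 where "M0 = \<bar>M'\<bar>"
  have M0: "norm (A (x, p, q)) \<le> M0" if "norm x \<le> 1" "norm (p - c0) \<le> 1" "norm (q - c) \<le> 1" for x p q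
    using M' Zmem[OF that] unfolding M0_def by (meson abs_ge_self imageI order_trans)
  have M0_nonneg: "M0 \<ge> 0" by (simp add: M0_def)
  have "A differentiable_on UNIV" "\<And>b. b \<in> Basis \<Longrightarrow> continuous_on UNIV (pd b A)"
    using A1 CH_continuous[OF \<alpha>(1) \<alpha>1] by (auto simp: CH_Suc)
  then obtain LA where LA: "LA \<ge> 0" "\<And>z z'. z \<in> Z \<Longrightarrow> z' \<in> Z \<Longrightarrow> norm (A z - A z') \<le> LA * norm (z - z')"
    using C1_lipschitz_on_compact_convex[OF Z, of A] by metis
  have Lip: "norm (A (x, p, q) - A (x, p', q')) \<le> LA * (norm (p - p') + norm (q - q'))"
    if "norm x \<le> 1" "norm (p - c0) \<le> 1" "norm (q - c) \<le> 1" "norm (p' - c0) \<le> 1" "norm (q' - c) \<le> 1"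
    for x p q p' q'
  proof -
    have "norm ((x, p, q) - (x, p', q')) \<le> norm (p - p') + norm (q - q')"
      using norm_Pair_le[of "p - p'" "q - q'"] by (simp add: norm_Pair)
    then have "LA * norm ((x, p, q) - (x, p', q')) \<le> LA * (norm (p - p') + norm (q - q'))"
      by (rule mult_left_mono[OF _ LA(1)])
    then show ?thesis using LA(2)[OF Zmem[OF that(1-3)] Zmem[OF that(1,4,5)]] by (rule order_trans[rotated])
  qed
  define M where "M = 2 * M0 + 1"
  have M_pos: "M > 0" by (simp add: M_def M0_def)
  \<comment> \<open>Then 8 \<tau>0 = 1 / (2 (1 + CL)), which serves the bounds with and without the
    factor CL.\<close>
  define \<tau>0 where "\<tau>0 = 1 / (16 * (1 + CL))"
  have \<tau>0: "\<tau>0 > 0" "8 * \<tau>0 \<le> 1 / 2" "CL * (8 * \<tau>0) \<le> 1 / 2"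
    using CL0 by (auto simp: \<tau>0_def field_simps)
  define n where "n = real DIM('a)"
  have n: "n > 0" by (simp add: n_def)
  define P where "P = LA * (n + CL)"
  have P: "P \<ge> 0" using LA(1) n CL0 by (simp add: P_def)
  \<comment> \<open>Each of the five smallness conditions on \<open>r0\<close> follows from r0 x <=
    1 for one of these numbers. The numerical factors are doubled where a strict inequality is
    wanted.\<close>
  define x1 x2 x3 x4 x5 where "x1 = 8 * (K * M)" and "x2 = 8 * (CL * (K * M))" and "x3 = 16 * (P * K)"
    and "x4 = 8 * (n * (K * M)) / \<tau>0" and "x5 = 64 * (n * (K * P))"
  have xs: "x1 \<ge> 0" "x2 \<ge> 0" "x3 \<ge> 0" "x4 \<ge> 0" "x5 \<ge> 0"
    using Knn(3) M_pos CL0 P n \<tau>0(1) by (auto simp: x1_def x2_def x3_def x4_def x5_def)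
  define r0 where "r0 = 1 / (1 + x1 + x2 + x3 + x4 + x5)"
  have r0: "0 < r0" "r0 \<le> 1" using xs by (auto simp: r0_def)
  have le: "r0 * x \<le> 1" if "x \<le> 1 + x1 + x2 + x3 + x4 + x5" for x
    using that xs by (simp add: r0_def divide_le_eq)
  have "r0 * x1 \<le> 1" "r0 * x2 \<le> 1" "r0 * x3 \<le> 1" "r0 * x4 \<le> 1" "r0 * x5 \<le> 1"
    using xs by (intro le; simp)+
  then have small: "4 * r0 * K * M \<le> 1 / 2" "CL * (4 * r0 * K * M) \<le> 1 / 2"
      "LA * (DIM('a) + CL) * (4 * r0 * K) \<le> 1 / 4"
      "4 * DIM('a) * r0 * K * M < \<tau>0"
      "8 * DIM('a) * r0 * K * (4 * LA * (DIM('a) + CL)) < 1"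
  proof -
    assume a: "r0 * x1 \<le> 1" "r0 * x2 \<le> 1" "r0 * x3 \<le> 1" "r0 * x4 \<le> 1" "r0 * x5 \<le> 1"
    have "4 * r0 * K * M = r0 * x1 / 2" by (simp add: x1_def)
    also have "\<dots> \<le> 1 / 2" using a(1) by simp
    finally show "4 * r0 * K * M \<le> 1 / 2" .
    have "CL * (4 * r0 * K * M) = r0 * x2 / 2" by (simp add: x2_def)
    also have "\<dots> \<le> 1 / 2" using a(2) by simp
    finally show "CL * (4 * r0 * K * M) \<le> 1 / 2" .
    have "LA * (DIM('a) + CL) * (4 * r0 * K) = r0 * x3 / 4" by (simp add: x3_def P_def n_def)
    also have "\<dots> \<le> 1 / 4" using a(3) by simp
    finally show "LA * (DIM('a) + CL) * (4 * r0 * K) \<le> 1 / 4" .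
    have "4 * DIM('a) * r0 * K * M = r0 * x4 * \<tau>0 / 2" using \<tau>0(1) by (simp add: x4_def n_def)
    also have "\<dots> \<le> 1 * \<tau>0 / 2" using a(4) \<tau>0(1) by (intro divide_right_mono mult_right_mono) auto
    also have "\<dots> < \<tau>0" using \<tau>0(1) by simp
    finally show "4 * DIM('a) * r0 * K * M < \<tau>0" .
    have "8 * DIM('a) * r0 * K * (4 * LA * (DIM('a) + CL)) = r0 * x5 / 2"
      by (simp add: x5_def P_def n_def)
    also have "\<dots> < 1" using a(5) by simp
    finally show "8 * DIM('a) * r0 * K * (4 * LA * (DIM('a) + CL)) < 1" .
  qed
  define C1 where "C1 = (\<Sum>b\<in>Basis. norm (c1 b))"
  have C1: "norm (c1 b) \<le> C1" if "b \<in> Basis" for b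
    unfolding C1_def by (rule member_le_sum[OF that]) auto
  have C10: "C1 \<ge> 0" by (simp add: C1_def sum_nonneg)
  obtain e :: 'b where "e \<in> Basis" using nonempty_Basis by blast
  then have e: "norm e = 1" by simp
  define \<epsilon> where "\<epsilon> = min (1/2) (1 / (DIM('a) * (C1 + 1) * 2))"
  have \<epsilon>: "\<epsilon> > 0" using C10 by (simp add: \<epsilon>_def)
  have ev1: "\<forall>\<^sub>F R in at_right (0::real). R < \<epsilon>"
    using \<epsilon> eventually_at_right_field by blast
  have "((\<lambda>R. S * measure lborel (cball 0 (2 * R / r0) :: 'a set)) \<longlongrightarrow> 0) (at_right 0)"
    using tendsto_mult_left[OF content_cball_shrinking[OF r0(1), where 'a = 'a], of S] by simp
  then have "\<forall>\<^sub>F R in at_right (0::real). S * measure lborel (cball 0 (2 * R / r0) :: 'a set) < 1 / 4"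
    by (rule order_tendstoD) simp
  with ev1 eventually_at_right_less[of "0::real"] show ?thesis
  proof eventually_elim
    case (elim R)
    obtain \<zeta> :: "'a \<Rightarrow> real" where \<zeta>: "\<And>m. CH \<alpha> m \<zeta>" "\<And>x. norm x \<le> R \<Longrightarrow> \<zeta> x = 1"
      "\<And>x. norm x \<ge> 2 * R \<Longrightarrow> \<zeta> x = 0" "\<And>x. 0 \<le> \<zeta> x \<and> \<zeta> x \<le> 1"
      by (rule cutoff_exists[OF \<alpha>(1) \<alpha>1 elim(2)]) (rule that; blast)
    have R2: "2 * R \<le> 1" using elim(1) by (simp add: \<epsilon>_def)
    have "R \<le> 1 / (DIM('a) * (C1 + 1) * 2)" using elim(1) by (simp add: \<epsilon>_def)
    moreover have "DIM('a) * (C1 + 1) * 2 > 0" using C10 by simp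
    ultimately have R3: "DIM('a) * (C1 + 1) * (2 * R) \<le> 1"
      by (simp add: pos_le_divide_eq mult_ac)
    have "semilinear_problem \<alpha> r0 K \<psi> \<phi> L c0 c1 b1 b2 e A k CL LA M0 M C1 \<tau>0 R S \<zeta>"
      by (intro semilinear_problem.intro semilinear_ansatz.intro semilinear_problem_axioms.intro)
        (assumption | rule \<alpha> r0 K lap one L b12 e CL0 CL A_CH k M0[unfolded c_def] M0_nonneg LA(1)
          Lip[unfolded c_def] M_def C1 \<tau>0 small elim(2) R2 R3 S less_imp_le[OF elim(3)] \<zeta> | blast)+
    from semilinear_problem.solution_family[OF this]
    show ?case using elim(2) \<tau>0(1)
      by (intro conjI) (auto intro!: exI[of _ "{\<tau>0..2 * \<tau>0}"] infinite_Icc elim!: ex_forward)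
  qed
qed

section \<open>Passage between the classes of the statement and \<open>CH\<close>\<close>

lemma continuous_partials_imp_CH:
  assumes \<alpha>: "0 < \<alpha>" "\<alpha> \<le> 1"
  shows "partials_upto (continuous_on UNIV) UNIV (Suc m) f \<Longrightarrow> CH \<alpha> m f"
proof (induction m arbitrary: f)
  case 0
  \<comment> \<open>Continuous partial derivatives make the function locally Lipschitz, hence
    Hoelder; this costs one order, which is harmless when all orders are available.\<close>
  then show ?case by (intro CH_C1[OF \<alpha>]) auto
next
  case (Suc m)
  have "f differentiable_on UNIV" using Suc.prems by simp
  moreover have "CH \<alpha> m (pd b f)" if "b \<in> Basis" for b
    by (rule Suc.IH) (use Suc.prems that in simp)
  ultimately show ?case by (simp add: CH_Suc)
qed

lemma C_holder_loc_imp_CH: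
  assumes "0 < \<alpha>" "\<alpha> \<le> 1" "C_holder_loc k \<alpha> UNIV f" "enat m \<le> k"
  shows "CH \<alpha> m f"
proof (cases k)
  case (enat j)
  then have "CH \<alpha> j f" "m \<le> j" using assms(3,4) by (simp_all add: C_holder_loc_def CH_def)
  then show ?thesis using CH_mono[OF assms(1,2)] by blast
next
  case infinity
  then have "smooth_on UNIV f" using assms(3) by (simp add: C_holder_loc_def)
  then show ?thesis
    using continuous_partials_imp_CH[OF assms(1,2)] unfolding smooth_on_def by blast
qed

text \<open>The closed ball is compact, so local Hoelder continuity of the extension is Hoelder
  continuity on the ball.\<close>

lemma CH_imp_C_holder_cball:
  fixes f :: "'a::euclidean_space \<Rightarrow> 'b::real_normed_vector"
  assumes \<alpha>: "0 < \<alpha>" "\<alpha> \<le> 1" and R: "0 < R"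
    and F: "\<And>m. enat m \<le> k \<Longrightarrow> CH \<alpha> (Suc (Suc m)) F" and eq: "\<forall>x\<in>cball 0 R. f x = F x"
  shows "C_holder (k + 2) \<alpha> (cball 0 R) f"
proof (cases k)
  case (enat j)
  have "partials_upto (holder_on \<alpha> (cball 0 R)) (cball 0 R) (Suc (Suc j)) f"
  proof (rule partials_upto_cball[OF R \<alpha> _ F eq])
    fix g G :: "'a \<Rightarrow> 'b"
    assume G: "CH \<alpha> 0 G" and g: "\<forall>x\<in>cball 0 R. g x = G x"
    have "holder_on \<alpha> (cball 0 R) G"
      using G unfolding CH_0 locally_holder_on_def by simp
    then show "holder_on \<alpha> (cball 0 R) g"
      using g unfolding holder_on_def by simp
  qed (use enat in simp)
  moreover have "k + 2 = enat (Suc (Suc j))"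
    by (simp add: enat numeral_eq_enat)
  ultimately show ?thesis by (simp only: C_holder_def enat.case)
next
  case infinity
  have "partials_upto (continuous_on (cball 0 R)) (cball 0 R) m f" for m
  proof (rule partials_upto_cball[OF R \<alpha> _ _ eq])
    show "CH \<alpha> m F"
      by (rule CH_mono[OF \<alpha> F[of m]]) (use infinity in auto)
    fix g G :: "'a \<Rightarrow> 'b"
    assume G: "CH \<alpha> 0 G" and g: "\<forall>x\<in>cball 0 R. g x = G x"
    have "continuous_on (cball 0 R) G"
      by (rule continuous_on_subset[OF CH_continuous[OF \<alpha> G]]) simp
    then show "continuous_on (cball 0 R) g"
      by (subst continuous_on_cong[OF refl]) (use g in auto)
  qed
  then show ?thesis using infinity by (simp add: C_holder_def smooth_on_def)
qed

text \<open>The choice of \<open>L\<close> for which \<open>jac\<close> is the Jacobian matrix: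
  \<open>y\<close> becomes the column belonging to \<open>b\<close>.\<close>

definition jacobian_term :: "real^'n \<Rightarrow> real^'N \<Rightarrow> real^'n^'N" where
  "jacobian_term b y = (\<chi> j i. if axis i 1 = b then y $ j else 0)"

lemma bounded_linear_jacobian_term: "bounded_linear (jacobian_term b)"
  by (intro linear_conv_bounded_linear[THEN iffD1] linearI)
    (simp_all add: jacobian_term_def vec_eq_iff)

lemma sum_jacobian_term:
  "(\<Sum>b\<in>Basis. jacobian_term b (P b)) = (\<chi> j i. P (axis i 1) $ j)" for P :: "real^'n \<Rightarrow> real^'N"
proof -
  have "(\<Sum>b\<in>Basis. if axis i 1 = b then P b $ j else 0) = P (axis i 1) $ j" for i :: 'n and j
    by (subst sum.delta') (auto simp: axis_in_Basis_iff)
  then show ?thesis by (simp add: vec_eq_iff jacobian_term_def)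
qed

lemma jac_eq_matrix: "jac jacobian_term U x = matrix (frechet_derivative U (at x))"
  by (simp add: jac_def sum_jacobian_term matrix_def partial_deriv_def)

text \<open>b1 + b2 and b1 - b2 have the same length by orthogonality, so all four points lie on one
  sphere inside the ball, and the signs cancel.\<close>

lemma probe_eq_0_if_radial:
  assumes "radially_symmetric_on (cball 0 R) u" "b1 \<in> Basis" "b2 \<in> Basis" "b1 \<noteq> b2" "0 < R"
  shows "probe R b1 b2 u = 0"
proof -
  define p q where "p = (R / 2) *\<^sub>R (b1 + b2)" and "q = (R / 2) *\<^sub>R (b1 - b2)"
  have o: "b1 \<bullet> b2 = 0" "b2 \<bullet> b1 = 0" "b1 \<bullet> b1 = 1" "b2 \<bullet> b2 = 1"
    using assms(2-4) by (auto simp: inner_Basis)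
  have "norm (b1 + b2) = norm (b1 - b2)"
    by (simp add: norm_eq_sqrt_inner inner_add_left inner_diff_left inner_add_right inner_diff_right o)
  then have pq: "norm p = norm q" by (simp add: p_def q_def)
  have "norm (b1 + b2) \<le> 2" using norm_triangle_ineq[of b1 b2] assms(2,3) by simp
  then have "norm p \<le> R / 2 * 2"
    using assms(5) by (simp only: p_def norm_scaleR) (intro mult_mono, auto)
  then have p: "norm p \<le> R" by simp
  have "u x = u p" if "norm x = norm p" for x
    using assms(1)[unfolded radially_symmetric_on_def, rule_format, of x p] that p by simp
  from this[of "- p"] this[of q] this[of "- q"] show ?thesis
    using pq by (simp add: probe_def p_def[symmetric] q_def[symmetric])
qed

theorem theorem1p2:
  fixes a :: "real^'n \<Rightarrow> real^'N \<Rightarrow> real^'n^'N \<Rightarrow> real^'N"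
    and \<alpha> :: real and k :: enat
    and c0 :: "real^'N" and c1 :: "real^'n^'N"
  assumes "CARD('n) \<ge> 2"
    and "0 < \<alpha>" and "\<alpha> < 1"
    and "1 \<le> k"
    and "C_holder_loc k \<alpha> UNIV (\<lambda>(x, p, q). a x p q)"
  shows "\<forall>\<^sub>F R in at_right 0.
    infinite {u \<in> cball 0 R \<rightarrow>\<^sub>E UNIV.
      C_holder (k + 2) \<alpha> (cball 0 R) u \<and> solves_system a c0 c1 R u \<and>
      \<not> radially_symmetric_on (cball 0 R) u}"
proof -
  have \<alpha>1: "\<alpha> \<le> 1" using assms(3) by simp
  have "\<exists>i j :: 'n. i \<noteq> j"
  proof (rule ccontr)
    assume "\<nexists>i j :: 'n. i \<noteq> j"
    then have "(UNIV :: 'n set) = {undefined}" by auto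
    then have "CARD('n) = 1" by (metis card_1_singleton_iff One_nat_def)
    then show False using assms(1) by simp
  qed
  then obtain i j :: 'n where "i \<noteq> j" by blast
  then have b12: "axis i (1::real) \<in> Basis" "axis j (1::real) \<in> Basis" "axis i (1::real) \<noteq> axis j 1"
    by (auto simp: axis_in_Basis_iff axis_eq_axis)
  let ?A = "\<lambda>(x, p, q). a x p q"
  have A: "CH \<alpha> m ?A" if "enat m \<le> k" for m
    by (rule C_holder_loc_imp_CH[OF assms(2) \<alpha>1 assms(5) that])
  show ?thesis
  \<comment> \<open>The columns \<open>c1 *v b\<close> are the prescribed partial derivatives at
    0.\<close>
  proof (rule eventually_mono, rule small_solutions_exist[where L = jacobian_term and ?c0.0 = c0
          and ?c1.0 = "\<lambda>b. c1 *v b", OF assms(2,3) _ assms(4) bounded_linear_jacobian_term b12],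
        rule A, assumption, elim conjE exE)
    fix R and U :: "real \<Rightarrow> real^'n \<Rightarrow> real^'N" and T :: "real set"
    assume R: "0 < R" and T: "infinite T"
      and sol: "\<forall>\<tau>\<in>T.
        (\<forall>m. enat m \<le> k \<longrightarrow> CH \<alpha> (Suc (Suc m)) (U \<tau>)) \<and>
        (\<forall>x\<in>cball 0 R. (\<Sum>b\<in>Basis. pd b (pd b (U \<tau>)) x) = ?A (x, U \<tau> x, jac jacobian_term (U \<tau>) x)) \<and>
        U \<tau> 0 = c0 \<and> (\<forall>b\<in>Basis. pd b (U \<tau>) 0 = c1 *v b) \<and> probe R (axis i 1) (axis j 1) (U \<tau>) \<noteq> 0"
      and inj: "inj_on (\<lambda>\<tau>. probe R (axis i 1) (axis j 1) (U \<tau>)) T"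
    have U: "\<And>\<tau> m. \<tau> \<in> T \<Longrightarrow> enat m \<le> k \<Longrightarrow> CH \<alpha> (Suc (Suc m)) (U \<tau>)"
      and eqn: "\<And>\<tau> x. \<tau> \<in> T \<Longrightarrow> x \<in> cball 0 R \<Longrightarrow>
        (\<Sum>b\<in>Basis. pd b (pd b (U \<tau>)) x) = ?A (x, U \<tau> x, jac jacobian_term (U \<tau>) x)"
      and U0: "\<And>\<tau>. \<tau> \<in> T \<Longrightarrow> U \<tau> 0 = c0"
      and DU0: "\<And>\<tau> b. \<tau> \<in> T \<Longrightarrow> b \<in> Basis \<Longrightarrow> pd b (U \<tau>) 0 = c1 *v b"
      and probe0: "\<And>\<tau>. \<tau> \<in> T \<Longrightarrow> probe R (axis i 1) (axis j 1) (U \<tau>) \<noteq> 0"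
      using sol by blast+
    \<comment> \<open>The statement counts extensional functions on the ball, so that different
      extensions beyond it are not counted as different solutions.\<close>
    define u where "u = (\<lambda>\<tau>. restrict (U \<tau>) (cball 0 R))"
    have eq: "\<forall>x\<in>cball 0 R. u \<tau> x = U \<tau> x" for \<tau> by (simp add: u_def)
    \<comment> \<open>The four points have norm at most R, so restriction does not affect the
      probe.\<close>
    have probe_u: "probe R (axis i 1) (axis j 1) (u \<tau>) = probe R (axis i 1) (axis j 1) (U \<tau>)" for \<tau>
    proof -
      have le: "norm ((R / 2) *\<^sub>R w) \<le> R" if "norm w \<le> 2" for w :: "real^'n"
        using R that by simp
      have "norm (axis i 1 + axis j 1 :: real^'n) \<le> 2" "norm (axis i 1 - axis j 1 :: real^'n) \<le> 2"
        using norm_triangle_ineq[of "axis i 1" "axis j 1 :: real^'n"]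
          norm_triangle_ineq4[of "axis i 1" "axis j 1 :: real^'n"] by simp_all
      from le[OF this(1)] le[OF this(2)] show ?thesis
        by (simp only: probe_def u_def restrict_apply mem_cball_0 norm_minus_cancel if_True)
    qed
    have "u ` T \<subseteq> {u \<in> cball 0 R \<rightarrow>\<^sub>E UNIV.
      C_holder (k + 2) \<alpha> (cball 0 R) u \<and> solves_system a c0 c1 R u \<and>
      \<not> radially_symmetric_on (cball 0 R) u}"
    proof (intro image_subsetI CollectI conjI)
      fix \<tau> assume \<tau>: "\<tau> \<in> T"
      show "u \<tau> \<in> cball 0 R \<rightarrow>\<^sub>E UNIV" by (simp add: u_def)
      show "C_holder (k + 2) \<alpha> (cball 0 R) (u \<tau>)"
        by (rule CH_imp_C_holder_cball[OF assms(2) \<alpha>1 R U[OF \<tau>] eq])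
      have U2: "CH \<alpha> 2 (U \<tau>)"
        using U[OF \<tau>, of 0] by (simp add: numeral_2_eq_2 zero_enat_def[symmetric])
      have jac: "jacobian (u \<tau>) (at x within cball 0 R) = jac jacobian_term (U \<tau>) x"
        if x: "x \<in> cball 0 R" for x
      proof -
        have "U \<tau> differentiable at x"
          using CH_differentiable[OF assms(2) \<alpha>1, of 1] U2 by (simp add: numeral_2_eq_2)
        from frechet_derivative_within_cball(2)[OF R x eq[rule_format] this]
        show ?thesis by (simp add: jacobian_def jac_eq_matrix)
      qed
      have "jac jacobian_term (U \<tau>) 0 = (\<Sum>b\<in>Basis. jacobian_term b (c1 *v b))"
        unfolding jac_def using DU0[OF \<tau>] by simp
      also have "\<dots> = c1"
        by (simp add: sum_jacobian_term vec_eq_iff matrix_vector_mult_basis column_def)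
      finally show "solves_system a c0 c1 R (u \<tau>)"
        unfolding solves_system_def
        using laplacian_cball[OF R assms(2) \<alpha>1 U2 eq] eqn[OF \<tau>] jac eq U0[OF \<tau>] R by simp
      show "\<not> radially_symmetric_on (cball 0 R) (u \<tau>)"
        using probe_eq_0_if_radial[OF _ b12 R, of "u \<tau>"] probe0[OF \<tau>] probe_u by auto
    qed
    moreover have "inj_on u T"
    proof (rule inj_onI)
      fix \<tau> \<sigma> assume "\<tau> \<in> T" "\<sigma> \<in> T" "u \<tau> = u \<sigma>"
      then show "\<tau> = \<sigma>" using inj probe_u unfolding inj_on_def by metis
    qed
    ultimately show "infinite {u \<in> cball 0 R \<rightarrow>\<^sub>E UNIV.
      C_holder (k + 2) \<alpha> (cball 0 R) u \<and> solves_system a c0 c1 R u \<and>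
      \<not> radially_symmetric_on (cball 0 R) u}"
      using T by (meson finite_imageD finite_subset)
  qed
qed

end
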